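(* Let $\varepsilon>0$ and let $k=k(n)$ be a sequence of positive integers with $n\ge 2k$ and $k\ge(1+\varepsilon)\log_2\log_2 n$ for all sufficiently large $n$. Then, asymptotically almost surely as $n\to\infty$, $$\chi\big(KG_{n,k}(1/2)\big)\ \ge\ n-2k-10 .$$
   Context: For positive integers $n\ge 2k$, the Kneser graph $KG_{n,k}$ has as vertices all $k$-element subsets of $[n]=\{1,\dots,n\}$, with two vertices adjacent iff the sets are disjoint. The random Kneser graph $KG_{n,k}(p)$ is the random graph on the same vertex set obtained by including each edge of $KG_{n,k}$ independently with probability $p$. $\chi$ denotes the chromatic number. "Asymptotically almost surely" means with probability tending to $1$ as $n\to\infty$. *)

theory Defs
  imports "HOL-Probability.Probability"
begin

definition kneser_verts :: "nat \<Rightarrow> nat \<Rightarrow> nat set set" where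
  "kneser_verts n k = {A. A \<subseteq> {1..n} \<and> card A = k}"

text \<open>
  Edges are unordered pairs. The condition \<open>A \<noteq> B\<close> only matters for \<open>k = 0\<close>,
  where it keeps the graph loopless.
\<close>

definition kneser_edges :: "nat \<Rightarrow> nat \<Rightarrow> nat set set set" where
  "kneser_edges n k =
     {{A, B} | A B. A \<in> kneser_verts n k \<and> B \<in> kneser_verts n k \<and> A \<noteq> B \<and> A \<inter> B = {}}"

definition proper_colouring :: "'v set \<Rightarrow> 'v set set \<Rightarrow> nat \<Rightarrow> ('v \<Rightarrow> nat) \<Rightarrow> bool" where
  "proper_colouring V E c f \<longleftrightarrow>
     f ` V \<subseteq> {..<c} \<and> (\<forall>u\<in>V. \<forall>v\<in>V. {u, v} \<in> E \<longrightarrow> f u \<noteq> f v)"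

definition chromatic_number :: "'v set \<Rightarrow> 'v set set \<Rightarrow> nat" where
  "chromatic_number V E = (LEAST c. \<exists>f. proper_colouring V E c f)"

text \<open>
  The distribution of the edge set of the random Kneser graph; its vertex set is
  always \<open>kneser_verts n k\<close>. The index set of the product is finite (see below), so
  the coordinates of \<open>Pi_pmf\<close> are independent Bernoulli variables, one per edge.
\<close>

definition random_kneser_edges :: "nat \<Rightarrow> nat \<Rightarrow> real \<Rightarrow> nat set set set pmf" where
  "random_kneser_edges n k p =
     map_pmf (\<lambda>\<omega>. {e \<in> kneser_edges n k. \<omega> e})
       (Pi_pmf (kneser_edges n k) False (\<lambda>_. bernoulli_pmf p))"

lemma finite_kneser_verts: "finite (kneser_verts n k)"
proof (rule finite_subset)
  show "kneser_verts n k \<subseteq> Pow {1..n}" unfolding kneser_verts_def by blast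
qed simp

lemma finite_kneser_edges: "finite (kneser_edges n k)"
proof (rule finite_subset)
  show "kneser_edges n k \<subseteq> Pow (kneser_verts n k)" unfolding kneser_edges_def by blast
  show "finite (Pow (kneser_verts n k))" using finite_kneser_verts by simp
qed

text \<open>The minimum defining the chromatic number is over a nonempty set.\<close>

lemma chromatic_number_attained:
  assumes "finite V" and loopless: "\<And>v. {v} \<notin> E"
  shows "\<exists>f. proper_colouring V E (chromatic_number V E) f"
proof -
  obtain f where "bij_betw f V {0..<card V}"
    using ex_bij_betw_finite_nat[OF assms(1)] by blast
  then have inj: "inj_on f V" and img: "f ` V = {0..<card V}"
    unfolding bij_betw_def by blast+
  have "proper_colouring V E (card V) f"
    unfolding proper_colouring_def
  proof (intro conjI ballI impI notI)
    show "f ` V \<subseteq> {..<card V}" unfolding img by auto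
    fix u v assume uv: "u \<in> V" "v \<in> V" "{u, v} \<in> E" "f u = f v"
    have "u = v" using inj_onD[OF inj uv(4,1,2)] .
    with uv(3) show False using loopless by simp
  qed
  then have "\<exists>c f. proper_colouring V E c f" by blast
  then show ?thesis
    unfolding chromatic_number_def
    by (rule LeastI_ex[where P = "\<lambda>c. \<exists>f. proper_colouring V E c f"])
qed

end

theory Submission
  imports Defs "HOL-Combinatorics.List_Permutation" "HOL-Real_Asymp.Real_Asymp"
begin

text \<open>
  Suppose that fewer than \<open>n - 2k - 10\<close> colours suffice. As long as all sets of some colour
  share a point of the ground set, that point and that colour are deleted; the number of
  points minus the number of colours does not change (\<open>star_reduction\<close>). What remains is a
  ground set \<open>S\<close> with \<open>card S \<ge> c + 2k + 11\<close>, where \<open>c\<close> is the number of surviving colours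
  and no surviving colour class on \<open>S\<close> has a common point. Such a configuration is unlikely
  for two different reasons, according to the size \<open>y\<close> of \<open>S\<close>.

  If \<open>y\<close> is at most about \<open>k powr (17/4)\<close>, put \<open>K = k + 5\<close> and give every \<open>K\<close>-set a colour that
  is popular among its \<open>k\<close>-subsets, shared by \<open>s \<ge> (K choose 5) / y\<close> of them. Two disjoint
  \<open>K\<close>-sets of equal colour force \<open>s\<^sup>2\<close> edges of the Kneser graph to be absent. Such pairs exist
  in abundance: the Lovasz bound survives when a few \<open>K\<close>-sets may break the colouring rule
  (\<open>kneser_with_few_bad_sets\<close>), so fewer than \<open>2 ^ k / poly(k)\<close> edge-disjoint pairs would
  contradict \<open>y \<ge> c + 2k + 11 > c + 2K - 1\<close>. Each pair has probability \<open>2 ^ (- s\<^sup>2)\<close>, which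
  beats the \<open>k ^ O(k + s)\<close> ways to choose it since \<open>s\<close> is at least of order \<open>k powr (3/4)\<close>;
  and \<open>2 ^ k / poly(k)\<close> pairs beat the \<open>n ^ y\<close> choices of \<open>S\<close>, because \<open>log 2 n \<le> 2 powr (k / (1 + \<epsilon>))\<close>.

  The robust Lovasz bound is proved with Tucker's lemma for the octahedron. The
  labelling counts alternations along a linear order of \<open>S\<close>, and it works as soon as no two
  bad \<open>K\<close>-sets alternate along the order. A random order makes two given disjoint \<open>K\<close>-sets
  alternate with probability \<open>2 / (2K choose K)\<close>, so up to about \<open>2 ^ K\<close> bad sets do no harm.

  If \<open>y\<close> is larger, each colour class is described by a bounded amount of data
  (\<open>colour_class_container\<close>): either nearly all its members contain two fixed points, and
  then a typical \<open>k\<close>-set avoids them; or it contains a small family \<open>\<G>\<close>, such that a typical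
  \<open>k\<close>-set \<open>A\<close> is disjoint from many members of \<open>\<G>\<close>, with the possible exception of the \<open>A\<close> through
  one fixed point, which are still disjoint from one member. The set \<open>A\<close> may receive the
  colour only if all edges from \<open>A\<close> to those members are absent. A typical \<open>A\<close> contains at most
  \<open>2k\<close> of the fixed points, so with probability at least \<open>2 ^ (- 2k - 1)\<close> no colour is left
  for it. These events are independent for different \<open>A\<close>, and there are at least \<open>(y choose k) / 4\<close>
  of them, which beats the number of possible data.
\<close>

section \<open>The octahedral Tucker lemma\<close>

definition remove_nth :: "nat \<Rightarrow> 'a list \<Rightarrow> 'a list" where
  "remove_nth i xs = take i xs @ drop (Suc i) xs"

fun alternates :: "bool \<Rightarrow> bool list \<Rightarrow> bool" where
  "alternates s [] = True"
| "alternates s (b # bs) = (b = s \<and> alternates (\<not> s) bs)"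

lemma remove_nth_Cons_0 [simp]: "remove_nth 0 (x # xs) = xs"
  by (simp add: remove_nth_def)

lemma remove_nth_Cons_Suc [simp]: "remove_nth (Suc i) (x # xs) = x # remove_nth i xs"
  by (simp add: remove_nth_def)

lemma map_remove_nth: "map f (remove_nth i xs) = remove_nth i (map f xs)"
  by (simp add: remove_nth_def take_map drop_map)

lemma mset_remove_nth:
  assumes "i < length xs" shows "mset (remove_nth i xs) = mset xs - {#xs ! i#}"
proof -
  have "mset xs = mset (take i xs @ xs ! i # drop (Suc i) xs)"
    using id_take_nth_drop[OF assms] by simp
  then show ?thesis by (simp add: remove_nth_def)
qed

lemma sorted_remove_nth:
  assumes "sorted xs" shows "sorted (remove_nth i xs)"
proof -
  have "sorted (take i xs @ drop i xs)" using assms by simp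
  moreover have "set (drop (Suc i) xs) \<subseteq> set (drop i xs)"
    by (rule set_drop_subset_set_drop) simp
  ultimately show ?thesis
    using assms unfolding remove_nth_def sorted_append by (auto intro: sorted_wrt_drop)
qed

lemma card_less_Suc_split:
  "card {i. i < Suc n \<and> P i} = (if P 0 then 1 else 0) + card {i. i < n \<and> P (Suc i)}"
proof -
  have "{i. i < Suc n \<and> P i} = {i. i = 0 \<and> P i} \<union> Suc ` {i. i < n \<and> P (Suc i)}"
    by (auto simp: less_Suc_eq_0_disj)
  moreover have "card ({i. i = 0 \<and> P i} \<union> Suc ` {i. i < n \<and> P (Suc i)})
      = card {i. i = 0 \<and> P i} + card (Suc ` {i. i < n \<and> P (Suc i)})"
    by (rule card_Un_disjoint) (auto intro: finite_subset[of _ "{0}"])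
  moreover have "card {i::nat. i = 0 \<and> P i} = (if P 0 then 1 else 0)"
    by (cases "P 0") (auto simp: conj_commute cong: conj_cong)
  ultimately show ?thesis by (simp add: card_image)
qed

text \<open>
  The parity count behind Ky Fan's theorem, for sign sequences. An \<open>s\<close>-alternating word keeps
  one \<open>s\<close>-alternating removal (its last letter), a word alternating from the other sign keeps
  one as well (its first letter), and in every other word the good removals come in pairs.
\<close>

lemma odd_removals_alternating:
  assumes "bs \<noteq> []"
  shows "odd (card {i. i < length bs \<and> alternates s (remove_nth i bs)})
    \<longleftrightarrow> alternates s bs \<or> alternates (\<not> s) bs"
  using assms
proof (induction bs arbitrary: s)
  case (Cons b bs)
  have split: "card {i. i < length (b # bs) \<and> alternates s (remove_nth i (b # bs))}
    = (if alternates s bs then 1 else 0)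
      + card {i. i < length bs \<and> b = s \<and> alternates (\<not> s) (remove_nth i bs)}"
    by (simp add: card_less_Suc_split)
  show ?case
  proof (cases "bs = []")
    case True
    then show ?thesis unfolding split by auto
  next
    case False
    then have excl: "\<not> (alternates s bs \<and> alternates (\<not> s) bs)"
      by (cases bs) auto
    show ?thesis
    proof (cases "b = s")
      case True
      then show ?thesis unfolding split using Cons.IH[OF False, of "\<not> s"] excl by auto
    next
      case False
      then show ?thesis unfolding split by auto
    qed
  qed
qed simp

text \<open>
  The labels, listed by increasing absolute value, alternate in sign and the first has sign \<open>s\<close>
  (\<open>True\<close> for plus). Strict growth of the absolute values is automatic in
  the absence of complementary labels: equal absolute values would mean equal signs.
\<close>

definition fan_pattern :: "bool \<Rightarrow> int list \<Rightarrow> bool" where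
  "fan_pattern s ls \<longleftrightarrow> alternates s (map (\<lambda>x. 0 < x) (sort_key abs ls))"

lemma inj_abs_no_complement:
  fixes A :: "int set"
  assumes "\<forall>x\<in>A. - x \<notin> A" shows "inj_on abs A"
proof (rule inj_onI)
  fix x y assume "x \<in> A" "y \<in> A" "\<bar>x\<bar> = \<bar>y\<bar>"
  moreover from this have "x = y \<or> x = - y" by linarith
  ultimately show "x = y" using assms by auto
qed

text \<open>
  Sorting permutes the positions of a label list, hence also its removals. Without
  complementary labels the sorted list is determined by the multiset of labels, so that
  sorting commutes with removal and the count for sign words applies.
\<close>

lemma odd_removals_fan_pattern:
  assumes "ls \<noteq> []" and nc: "\<forall>x\<in>set ls. - x \<notin> set ls"
  shows "odd (card {i. i < length ls \<and> fan_pattern s (remove_nth i ls)}) \<longleftrightarrow> fan_pattern s ls \<or> fan_pattern (\<not> s) ls"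
proof -
  define ys where "ys = sort_key abs ls"
  have inj: "inj_on abs (set ls)" by (rule inj_abs_no_complement[OF nc])
  have mys: "mset ls = mset ys" by (simp add: ys_def)
  obtain p where p: "bij_betw p {..<length ls} {..<length ys}"
    and pn: "\<forall>i<length ls. ls ! i = ys ! p i"
    using permutation_Ex_bij[OF mys] by blast
  have fan_rem: "fan_pattern t (remove_nth i ls)
      \<longleftrightarrow> alternates t (remove_nth (p i) (map (\<lambda>x. 0 < x) ys))" if i: "i < length ls" for i t
  proof -
    have pi: "p i < length ys" using p i by (auto simp: bij_betw_def)
    have "mset (remove_nth i ls) = mset (remove_nth (p i) ys)"
      using i pi pn mys by (simp add: mset_remove_nth)
    moreover have "inj_on abs (set (remove_nth i ls))"
      by (rule inj_on_subset[OF inj]) (auto simp: remove_nth_def dest: in_set_takeD in_set_dropD)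
    moreover have "sorted (map abs (remove_nth (p i) ys))"
      unfolding map_remove_nth by (rule sorted_remove_nth) (simp add: ys_def)
    ultimately have "sort_key abs (remove_nth i ls) = remove_nth (p i) ys"
      by (rule sort_key_inj_key_eq)
    then show ?thesis unfolding fan_pattern_def by (simp add: map_remove_nth)
  qed
  have "bij_betw p {i. i < length ls \<and> fan_pattern s (remove_nth i ls)}
      {j. j < length ys \<and> alternates s (remove_nth j (map (\<lambda>x. 0 < x) ys))}"
    unfolding bij_betw_def
  proof
    show "inj_on p {i. i < length ls \<and> fan_pattern s (remove_nth i ls)}"
      by (rule inj_on_subset[OF bij_betw_imp_inj_on[OF p]]) auto
    show "p ` {i. i < length ls \<and> fan_pattern s (remove_nth i ls)}
      = {j. j < length ys \<and> alternates s (remove_nth j (map (\<lambda>x. 0 < x) ys))}"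
    proof (intro equalityI subsetI)
      fix j assume "j \<in> p ` {i. i < length ls \<and> fan_pattern s (remove_nth i ls)}"
      then show "j \<in> {j. j < length ys \<and> alternates s (remove_nth j (map (\<lambda>x. 0 < x) ys))}"
        using fan_rem p by (auto simp: bij_betw_def)
    next
      fix j assume j: "j \<in> {j. j < length ys \<and> alternates s (remove_nth j (map (\<lambda>x. 0 < x) ys))}"
      then obtain i where "i < length ls" "p i = j"
        using p unfolding bij_betw_def by (metis (mono_tags, lifting) imageE lessThan_iff mem_Collect_eq)
      then show "j \<in> p ` {i. i < length ls \<and> fan_pattern s (remove_nth i ls)}"
        using fan_rem j by auto
    qed
  qed
  then have "card {i. i < length ls \<and> fan_pattern s (remove_nth i ls)}
      = card {j. j < length ys \<and> alternates s (remove_nth j (map (\<lambda>x. 0 < x) ys))}"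
    by (rule bij_betw_same_card)
  moreover have "odd (card {j. j < length ys \<and> alternates s (remove_nth j (map (\<lambda>x. 0 < x) ys))})
      \<longleftrightarrow> alternates s (map (\<lambda>x. 0 < x) ys) \<or> alternates (\<not> s) (map (\<lambda>x. 0 < x) ys)"
  proof -
    have "ys \<noteq> []" using assms(1) mys by force
    then show ?thesis using odd_removals_alternating[of "map (\<lambda>x. 0 < x) ys" s] by simp
  qed
  ultimately show ?thesis by (simp only: fan_pattern_def[of s ls] fan_pattern_def[of "\<not> s" ls] ys_def)
qed

lemma even_card_fixpoint_free_involution:
  assumes "finite A" "\<And>x. x \<in> A \<Longrightarrow> f x \<in> A" "\<And>x. x \<in> A \<Longrightarrow> f (f x) = x" "\<And>x. x \<in> A \<Longrightarrow> f x \<noteq> x"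
  shows "even (card A)"
  using assms
proof (induction A rule: finite_psubset_induct)
  case (psubset A)
  show ?case
  proof (cases "A = {}")
    case False
    then obtain x where x: "x \<in> A" by blast
    have sub: "A - {x, f x} \<subset> A" using x by blast
    have "even (card (A - {x, f x}))"
    proof (rule psubset.IH[OF sub])
      fix y assume y: "y \<in> A - {x, f x}"
      show "f (f y) = y" using psubset.prems(2) y by blast
      show "f y \<noteq> y" using psubset.prems(3) y by blast
      have "f y \<noteq> x" "f y \<noteq> f x"
        using psubset.prems(2) x y by (metis DiffE insertCI)+
      then show "f y \<in> A - {x, f x}" using psubset.prems(1) y by blast
    qed
    moreover have "card A = card (A - {x, f x}) + 2"
    proof -
      have s: "{x, f x} \<subseteq> A" using x psubset.prems(1) by blast
      have "card {x, f x} = 2" using psubset.prems(3)[OF x] by auto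
      then show ?thesis
        using card_Diff_subset[OF _ s] card_mono[OF psubset.hyps s] by simp
    qed
    ultimately show ?thesis by simp
  qed simp
qed

text \<open>
  The faces of the octahedron in dimension \<open>n\<close>: a nonempty partial assignment of signs to the
  coordinates, given as its graph.
\<close>

definition signed_sets :: "nat \<Rightarrow> (nat \<times> bool) set set" where
  "signed_sets n = {X. X \<subseteq> {..<n} \<times> UNIV \<and> X \<noteq> {} \<and> (\<forall>i. (i, True) \<in> X \<longrightarrow> (i, False) \<notin> X)}"

definition flip :: "nat \<times> bool \<Rightarrow> nat \<times> bool" where
  "flip p = (fst p, \<not> snd p)"

lemma flip_flip [simp]: "flip (flip p) = p" by (simp add: flip_def)
lemma fst_flip [simp]: "fst (flip p) = fst p" by (simp add: flip_def)
lemma snd_flip [simp]: "snd (flip p) = (\<not> snd p)" by (simp add: flip_def)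
lemma flip_neq [simp]: "flip p \<noteq> p" by (metis snd_flip)
lemma flip_comp_flip [simp]: "flip \<circ> flip = id" by (auto simp: fun_eq_iff)
lemma fst_comp_flip [simp]: "fst \<circ> flip = fst" by (auto simp: fun_eq_iff)

text \<open>
  A maximal flag of faces adds one signed coordinate at a time; it is stored as the list of
  the signed coordinates in this order, and the faces are the sets of its initial segments.
\<close>

definition signed_perms :: "nat \<Rightarrow> (nat \<times> bool) list set" where
  "signed_perms n = {w. distinct (map fst w) \<and> set (map fst w) = {..<n}}"

lemma length_signed_perms: "w \<in> signed_perms n \<Longrightarrow> length w = n"
  unfolding signed_perms_def using distinct_card[of "map fst w"] by auto

lemma finite_signed_perms: "finite (signed_perms n)"
proof (rule finite_subset)
  show "signed_perms n \<subseteq> {w. set w \<subseteq> {..<n} \<times> UNIV \<and> length w = n}"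
  proof
    fix w assume w: "w \<in> signed_perms n"
    have "fst p < n" if "p \<in> set w" for p using w that by (auto simp: signed_perms_def)
    then show "w \<in> {w. set w \<subseteq> {..<n} \<times> UNIV \<and> length w = n}"
      using length_signed_perms[OF w] by auto
  qed
  show "finite {w :: (nat \<times> bool) list. set w \<subseteq> {..<n} \<times> UNIV \<and> length w = n}"
    by (rule finite_lists_length_eq) simp
qed

lemma set_take_signed_perm:
  assumes w: "w \<in> signed_perms n" and j: "j < n"
  shows "set (take (Suc j) w) \<in> signed_sets n"
proof -
  have len: "length w = n" by (rule length_signed_perms[OF w])
  have inj: "inj_on fst (set w)" using w by (auto simp: signed_perms_def distinct_map)
  have sub: "set (take (Suc j) w) \<subseteq> set w" by (rule set_take_subset)
  have "set (take (Suc j) w) \<subseteq> {..<n} \<times> UNIV"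
  proof
    fix p assume "p \<in> set (take (Suc j) w)"
    then have "fst p \<in> set (map fst w)" using sub by auto
    then show "p \<in> {..<n} \<times> UNIV" using w by (cases p) (auto simp: signed_perms_def)
  qed
  moreover have "set (take (Suc j) w) \<noteq> {}" using j len by (cases w) auto
  moreover have "(i, False) \<notin> set (take (Suc j) w)" if "(i, True) \<in> set (take (Suc j) w)" for i
    using inj_onD[OF inj, of "(i, True)" "(i, False)"] sub that by auto
  ultimately show ?thesis by (simp add: signed_sets_def)
qed

definition flag_labels :: "((nat \<times> bool) set \<Rightarrow> int) \<Rightarrow> (nat \<times> bool) list \<Rightarrow> int list" where
  "flag_labels l w = map (\<lambda>j. l (set (take (Suc j) w))) [0..<length w]"

lemma length_flag_labels [simp]: "length (flag_labels l w) = length w"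
  by (simp add: flag_labels_def)

lemma remove_nth_flag_labels_cong:
  assumes len: "length w = length w'"
    and same: "\<And>i. i < length w \<Longrightarrow> i \<noteq> j \<Longrightarrow> set (take (Suc i) w) = set (take (Suc i) w')"
  shows "remove_nth j (flag_labels l w) = remove_nth j (flag_labels l w')"
proof -
  have "take j [0..<length w] @ drop (Suc j) [0..<length w]
      = filter (\<lambda>i. i \<noteq> j) [0..<length w]" (is "?js = _")
  proof (cases "j < length w")
    case True
    have "[0..<length w] = [0..<j] @ j # [Suc j..<length w]"
      using True by (metis upt_conv_Cons upt_add_eq_append zero_le le_add_diff_inverse less_imp_le)
    then show ?thesis by (auto simp: filter_id_conv)
  next
    case False
    then show ?thesis by (auto simp: filter_id_conv intro!: filter_True[symmetric])
  qed
  then show ?thesis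
    unfolding remove_nth_def flag_labels_def take_map drop_map map_append[symmetric] len[symmetric]
    using same by auto
qed

lemma remove_last_flag_labels:
  assumes "length w = Suc d"
  shows "remove_nth d (flag_labels l w) = flag_labels l (butlast w)"
  unfolding remove_nth_def flag_labels_def take_map drop_map
  using assms by (auto simp: take_butlast)

text \<open>
  Induction over the dimension. Consider the flags of dimension \<open>d + 1\<close> in the hemisphere where
  coordinate \<open>d\<close> is positive, and count pairs of such a flag and a position whose removal leaves
  a positively alternating label list. By flags, the count is odd exactly for the
  alternating flags of either sign, and the antipodal map turns these into all positively
  alternating flags. By positions, a removal in the middle is shared by the two
  flags that differ by a transposition, and removal of the top face is shared by
  the two flags that differ in the last sign; only flags whose last signed coordinate is \<open>(d, True)\<close>
  remain unpaired, and they extend the flags of the equator in a unique way.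
\<close>

lemma octahedral_fan_parity:
  fixes l :: "(nat \<times> bool) set \<Rightarrow> int"
  assumes anti: "\<And>X. X \<in> signed_sets n \<Longrightarrow> l (flip ` X) = - l X"
    and nc: "\<And>X Y. X \<in> signed_sets n \<Longrightarrow> Y \<in> signed_sets n \<Longrightarrow> X \<subseteq> Y \<Longrightarrow> l X \<noteq> - l Y"
    and d: "0 < d" "d \<le> n"
  shows "odd (card {w \<in> signed_perms d. fan_pattern True (flag_labels l w)})"
  using d
proof (induction d rule: nat_induct_non_zero)
  case 1
  have perms: "signed_perms 1 = {[(0, True)], [(0, False)]}"
  proof (intro equalityI subsetI)
    fix w :: "(nat \<times> bool) list" assume w: "w \<in> signed_perms 1"
    then obtain p where "w = [p]"
      using length_signed_perms[OF w] by (cases w) auto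
    moreover from this w have "fst p = 0" by (simp add: signed_perms_def lessThan_Suc)
    ultimately show "w \<in> {[(0, True)], [(0, False)]}"
      by (cases "snd p") (simp_all add: prod_eq_iff)
  qed (auto simp: signed_perms_def)
  have sets: "{(0, b)} \<in> signed_sets n" for b using d by (cases b) (auto simp: signed_sets_def)
  have neg: "l {(0, False)} = - l {(0, True)}"
    using anti[OF sets[of True]] by (simp add: flip_def)
  have "l {(0, True)} \<noteq> 0" using nc[OF sets[of True] sets[of True]] by auto
  then have "{w \<in> signed_perms 1. fan_pattern True (flag_labels l w)} = {[(0, 0 < l {(0, True)})]}"
    unfolding perms by (cases "0 < l {(0, True)}") (auto simp: flag_labels_def fan_pattern_def neg)
  then show ?case by simp
next
  case (Suc d)
  define W where "W = {w \<in> signed_perms (Suc d). (d, True) \<in> set w}"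
  define R where "R j = {w \<in> W. fan_pattern True (remove_nth j (flag_labels l w))}" for j
  have finW: "finite W" unfolding W_def using finite_signed_perms[of "Suc d"] by simp
  have WD: "length w = Suc d" "distinct (map fst w)" "set (map fst w) = {..<Suc d}"
    "(d, True) \<in> set w" if "w \<in> W" for w
    using that length_signed_perms[of w "Suc d"] by (auto simp: W_def signed_perms_def)
  have setn: "set (take (Suc j) w) \<in> signed_sets n" if "w \<in> signed_perms (Suc d)" "j < Suc d" for w j
  proof -
    have "set (take (Suc j) w) \<in> signed_sets (Suc d)" by (rule set_take_signed_perm[OF that])
    moreover have "{..<Suc d} \<subseteq> {..<n}" using Suc.prems by auto
    moreover from this have "{..<Suc d} \<times> UNIV \<subseteq> {..<n} \<times> (UNIV :: bool set)" by (rule Sigma_mono) simp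
    ultimately show ?thesis unfolding signed_sets_def by (auto dest: subsetD)
  qed
  have nocomp: "\<forall>x\<in>set (flag_labels l w). - x \<notin> set (flag_labels l w)"
    if w: "w \<in> signed_perms (Suc d)" for w
  proof (intro ballI notI)
    fix x assume "x \<in> set (flag_labels l w)" "- x \<in> set (flag_labels l w)"
    then obtain i j where ij: "i < Suc d" "j < Suc d"
      "x = l (set (take (Suc i) w))" "- x = l (set (take (Suc j) w))"
      using length_signed_perms[OF w] by (auto simp: flag_labels_def simp del: upt_Suc)
    have "set (take (Suc i) w) \<subseteq> set (take (Suc j) w) \<or> set (take (Suc j) w) \<subseteq> set (take (Suc i) w)"
      using set_take_subset_set_take[of "Suc i" "Suc j" w] set_take_subset_set_take[of "Suc j" "Suc i" w]
      by (meson linear)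
    then show False
      using nc[OF setn[OF w ij(1)] setn[OF w ij(2)]] nc[OF setn[OF w ij(2)] setn[OF w ij(1)]] ij
      by auto
  qed
  have swap: "even (card (R j))" if j: "j < d" for j
  proof (rule even_card_fixpoint_free_involution)
    \<comment> \<open>Exchanging two neighbouring coordinates changes only the face at position \<open>j\<close>.\<close>
    let ?f = "\<lambda>w. w[j := w ! Suc j, Suc j := w ! j]"
    show "finite (R j)" unfolding R_def using finW by simp
    fix w assume w: "w \<in> R j"
    then have wW: "w \<in> W" by (simp add: R_def)
    note len = WD(1)[OF wW]
    have "mset (?f w) = mset w" using j len by (intro mset_swap) auto
    then have "mset (map fst (?f w)) = mset (map fst w)" by (metis mset_map)
    then have "distinct (map fst (?f w))" "set (map fst (?f w)) = set (map fst w)"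
      using WD(2)[OF wW] mset_eq_imp_distinct_iff mset_eq_setD by blast+
    moreover have "set (?f w) = set w" using j len by (intro set_swap) auto
    ultimately have fW: "?f w \<in> W" using WD[OF wW] unfolding W_def signed_perms_def by simp
    have "remove_nth j (flag_labels l w) = remove_nth j (flag_labels l (?f w))"
    proof (rule remove_nth_flag_labels_cong)
      fix i assume i: "i < length w" "i \<noteq> j"
      show "set (take (Suc i) w) = set (take (Suc i) (?f w))"
      proof (cases "i < j")
        case True
        then show ?thesis by (simp add: take_update_cancel)
      next
        case False
        with i have "j < i" by simp
        then have "set ((take (Suc i) w)[j := take (Suc i) w ! Suc j, Suc j := take (Suc i) w ! j])
            = set (take (Suc i) w)"
          using i by (intro set_swap) auto
        then show ?thesis using \<open>j < i\<close> i by (simp add: take_update_swap)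
      qed
    qed simp
    then show "?f w \<in> R j" using w fW unfolding R_def by simp
    show "?f (?f w) = w"
      using j len by (intro nth_equalityI) (auto simp: nth_list_update)
    have "w ! j \<noteq> w ! Suc j"
      using WD(2)[OF wW] j len nth_eq_iff_index_eq[of "map fst w" j "Suc j"] by auto
    then show "?f w \<noteq> w"
    proof -
      have "?f w ! j = w ! Suc j" using j len by simp
      then show ?thesis using \<open>w ! j \<noteq> w ! Suc j\<close> by metis
    qed
  qed
  have last: "odd (card (R d)) \<longleftrightarrow> odd (card {w \<in> signed_perms d. fan_pattern True (flag_labels l w)})"
  proof -
    let ?g = "\<lambda>w. butlast w @ [flip (last w)]"
    \<comment> \<open>Changing the last sign pairs off the flags, except those whose top face must keep the sign of coordinate \<open>d\<close>.\<close>
    define R' where "R' = {w \<in> R d. last w \<noteq> (d, True)}"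
    have fin: "finite (R d)" unfolding R_def using finW by simp
    have "even (card R')"
    proof (rule even_card_fixpoint_free_involution)
      show "finite R'" unfolding R'_def using fin by simp
      fix w assume w: "w \<in> R'"
      then have wW: "w \<in> W" by (simp add: R_def R'_def)
      obtain u p where weq: "w = u @ [p]" using WD(1)[OF wW] by (cases w rule: rev_cases) auto
      have len: "length u = d" using WD(1)[OF wW] weq by simp
      have pd: "p \<noteq> (d, True)" using w weq by (simp add: R'_def)
      have du: "(d, True) \<in> set u" using WD(4)[OF wW] weq pd by auto
      have fp: "fst p \<noteq> d"
      proof
        assume "fst p = d"
        moreover have "d \<in> fst ` set u" using du by force
        ultimately show False using WD(2)[OF wW] weq by simp
      qed
      have gw: "?g w = u @ [flip p]" by (simp add: weq)
      have "u @ [flip p] \<in> W"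
        using WD(2,3)[OF wW] du unfolding weq W_def signed_perms_def by simp
      moreover have "remove_nth d (flag_labels l (u @ [flip p])) = remove_nth d (flag_labels l w)"
        using len by (simp add: remove_last_flag_labels weq)
      moreover have "flip p \<noteq> (d, True)" using fp by (metis fst_conv fst_flip)
      ultimately show "?g w \<in> R'" using w unfolding gw R_def R'_def by simp
      show "?g (?g w) = w" by (simp add: gw weq)
      show "?g w \<noteq> w" unfolding gw by (simp add: weq)
    qed
    moreover have "card (R d) = card R' + card {w \<in> R d. last w = (d, True)}"
    proof -
      have "R d = R' \<union> {w \<in> R d. last w = (d, True)}" by (auto simp: R'_def)
      moreover have "card (R' \<union> {w \<in> R d. last w = (d, True)})
          = card R' + card {w \<in> R d. last w = (d, True)}"
        using fin by (intro card_Un_disjoint) (auto simp: R'_def)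
      ultimately show ?thesis by simp
    qed
    moreover have "bij_betw butlast {w \<in> R d. last w = (d, True)}
        {w \<in> signed_perms d. fan_pattern True (flag_labels l w)}"
    proof (rule bij_betw_byWitness[where f' = "\<lambda>w. w @ [(d, True)]"])
      have ne: "w \<noteq> []" if "w \<in> R d" for w using WD(1)[of w] that by (auto simp: R_def)
      show "\<forall>w\<in>{w \<in> R d. last w = (d, True)}. butlast w @ [(d, True)] = w"
      proof
        fix w assume "w \<in> {w \<in> R d. last w = (d, True)}"
        then show "butlast w @ [(d, True)] = w"
          using append_butlast_last_id[OF ne[of w]] by auto
      qed
      show "butlast ` {w \<in> R d. last w = (d, True)}
          \<subseteq> {w \<in> signed_perms d. fan_pattern True (flag_labels l w)}"
      proof safe
        fix w assume w: "w \<in> R d" "last w = (d, True)"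
        then have wW: "w \<in> W" by (simp add: R_def)
        obtain u where u: "w = u @ [(d, True)]"
          using ne[OF w(1)] w(2) by (cases w rule: rev_cases) auto
        have "d \<notin> fst ` set u" "distinct (map fst u)" "insert d (fst ` set u) = {..<Suc d}"
          using WD(2,3)[OF wW] unfolding u by auto
        then have "fst ` set u = {..<Suc d} - {d}" by blast
        also have "\<dots> = {..<d}" by auto
        finally have "fst ` set u = {..<d}" .
        with \<open>distinct (map fst u)\<close> show "butlast w \<in> signed_perms d"
          by (simp add: signed_perms_def u)
        show "fan_pattern True (flag_labels l (butlast w))"
          using w(1) remove_last_flag_labels[OF WD(1)[OF wW], of l] by (simp add: R_def)
      qed
      show "(\<lambda>w. w @ [(d, True)]) ` {w \<in> signed_perms d. fan_pattern True (flag_labels l w)}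
          \<subseteq> {w \<in> R d. last w = (d, True)}"
      proof safe
        fix w assume w: "w \<in> signed_perms d" "fan_pattern True (flag_labels l w)"
        have "w @ [(d, True)] \<in> W"
          using w(1) by (auto simp: W_def signed_perms_def lessThan_Suc)
        moreover have "remove_nth d (flag_labels l (w @ [(d, True)])) = flag_labels l w"
          using length_signed_perms[OF w(1)] by (simp add: remove_last_flag_labels)
        ultimately show "w @ [(d, True)] \<in> R d" using w(2) by (simp add: R_def)
      qed simp
    qed simp
    then have "card {w \<in> R d. last w = (d, True)} = card {w \<in> signed_perms d. fan_pattern True (flag_labels l w)}"
      by (rule bij_betw_same_card)
    ultimately show ?thesis by simp
  qed
  have "(\<Sum>w\<in>W. card {j. j < Suc d \<and> fan_pattern True (remove_nth j (flag_labels l w))})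
      = (\<Sum>j<Suc d. card (R j))"
  proof -
    have "(\<Sum>w\<in>W. card {j. j < Suc d \<and> fan_pattern True (remove_nth j (flag_labels l w))})
        = (\<Sum>w\<in>W. \<Sum>j<Suc d. if fan_pattern True (remove_nth j (flag_labels l w)) then 1 else 0)"
    proof (intro sum.cong refl)
      fix w
      have "{j. j < Suc d \<and> fan_pattern True (remove_nth j (flag_labels l w))}
          = {..<Suc d} \<inter> {j. fan_pattern True (remove_nth j (flag_labels l w))}" by auto
      then show "card {j. j < Suc d \<and> fan_pattern True (remove_nth j (flag_labels l w))}
          = (\<Sum>j<Suc d. if fan_pattern True (remove_nth j (flag_labels l w)) then 1 else 0)"
        by (simp only: sum.If_cases finite_lessThan) simp
    qed
    also have "\<dots> = (\<Sum>j<Suc d. \<Sum>w\<in>W. if fan_pattern True (remove_nth j (flag_labels l w)) then 1 else 0)"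
      by (rule sum.swap)
    also have "\<dots> = (\<Sum>j<Suc d. card (R j))"
      using finW by (intro sum.cong refl) (simp add: sum.If_cases Int_def R_def)
    finally show ?thesis .
  qed
  moreover have "odd (\<Sum>j<Suc d. card (R j)) \<longleftrightarrow> odd (card (R d))"
  proof -
    have "even (\<Sum>j<d. card (R j))" by (rule dvd_sum) (use swap in simp)
    then show ?thesis by simp
  qed
  moreover have "odd (\<Sum>w\<in>W. card {j. j < Suc d \<and> fan_pattern True (remove_nth j (flag_labels l w))})
      \<longleftrightarrow> odd (card {w \<in> W. fan_pattern True (flag_labels l w) \<or> fan_pattern False (flag_labels l w)})"
  proof -
    have "odd (card {j. j < Suc d \<and> fan_pattern True (remove_nth j (flag_labels l w))})
        \<longleftrightarrow> fan_pattern True (flag_labels l w) \<or> fan_pattern False (flag_labels l w)" if w: "w \<in> W" for w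
    proof -
      have "flag_labels l w \<noteq> []" using WD(1)[OF w] by (auto simp: flag_labels_def)
      then show ?thesis
        using odd_removals_fan_pattern[of "flag_labels l w" True] nocomp[of w] w WD(1)[OF w]
        by (simp add: W_def)
    qed
    then have "{w \<in> W. odd (card {j. j < Suc d \<and> fan_pattern True (remove_nth j (flag_labels l w))})}
        = {w \<in> W. fan_pattern True (flag_labels l w) \<or> fan_pattern False (flag_labels l w)}" by blast
    then show ?thesis by (simp add: even_sum_iff[OF finW])
  qed
  moreover have "card {w \<in> W. fan_pattern True (flag_labels l w) \<or> fan_pattern False (flag_labels l w)}
      = card {w \<in> signed_perms (Suc d). fan_pattern True (flag_labels l w)}"
  proof -
    have fl: "flag_labels l (map flip w) = map uminus (flag_labels l w)"
      if "w \<in> signed_perms (Suc d)" for w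
    proof -
      have "l (set (take (Suc j) (map flip w))) = - l (set (take (Suc j) w))" if "j < Suc d" for j
        using anti[OF setn[OF \<open>w \<in> signed_perms (Suc d)\<close> that]] by (simp add: take_map)
      then show ?thesis using length_signed_perms[OF that] by (simp add: flag_labels_def del: upt_Suc)
    qed
    have fan_neg: "fan_pattern s (map uminus ls) \<longleftrightarrow> fan_pattern (\<not> s) ls"
      if "\<forall>x\<in>set ls. x \<noteq> (0::int)" for s ls
    proof -
      have "insort_key abs (- x) (map uminus xs) = map uminus (insort_key abs x xs)" for x :: int and xs
        by (induct xs) auto
      then have "sort_key abs (map uminus ls) = map uminus (sort_key abs ls)"
        by (induct ls) (simp_all add: sort_key_def)
      moreover have "alternates s (map Not bs) \<longleftrightarrow> alternates (\<not> s) bs" for bs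
        by (induct bs arbitrary: s) auto
      moreover have "map (\<lambda>x. 0 < x) (map uminus xs) = map Not (map (\<lambda>x. 0 < x) xs)"
        if "\<forall>x\<in>set xs. x \<noteq> (0::int)" for xs
        using that by (auto simp: not_less le_less)
      ultimately show ?thesis unfolding fan_pattern_def using that by (simp del: map_map)
    qed
    let ?A = "{w \<in> signed_perms (Suc d). fan_pattern True (flag_labels l w)}"
    have nz: "\<forall>x\<in>set (flag_labels l w). x \<noteq> 0" if "w \<in> signed_perms (Suc d)" for w
      using nocomp[OF that] by force
    have sp: "map flip w \<in> signed_perms (Suc d)" if "w \<in> signed_perms (Suc d)" for w
      using that by (simp add: signed_perms_def image_image)
    have excl: "\<not> (fan_pattern True (flag_labels l w) \<and> fan_pattern False (flag_labels l w))" if "w \<in> W" for w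
    proof -
      have "length (sort_key abs (flag_labels l w)) \<noteq> 0" using WD(1)[OF that] by simp
      then show ?thesis unfolding fan_pattern_def by (cases "sort_key abs (flag_labels l w)") auto
    qed
    have memW: "w \<in> W \<or> map flip w \<in> W" "\<not> (w \<in> W \<and> map flip w \<in> W)"
      if w: "w \<in> signed_perms (Suc d)" for w
    proof -
      have "d \<in> set (map fst w)" using w by (auto simp: signed_perms_def)
      then obtain b where "(d, b) \<in> set w" by auto
      moreover have "(d, True) = flip (d, False)" by (simp add: flip_def)
      ultimately show "w \<in> W \<or> map flip w \<in> W"
        using w sp[OF w] unfolding W_def by (cases b) auto
      show "\<not> (w \<in> W \<and> map flip w \<in> W)"
      proof
        assume "w \<in> W \<and> map flip w \<in> W"
        then obtain p where "(d, True) \<in> set w" "p \<in> set w" "(d, True) = flip p"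
          unfolding W_def by auto
        moreover from this have "fst p = d" "p \<noteq> (d, True)" by (metis fst_flip fst_conv, metis flip_neq)
        moreover have "inj_on fst (set w)" using w by (simp add: signed_perms_def distinct_map)
        ultimately show False using inj_onD[of fst "set w" p "(d, True)"] by simp
      qed
    qed
    have "bij_betw (\<lambda>w. if fan_pattern True (flag_labels l w) then w else map flip w)
       {w \<in> W. fan_pattern True (flag_labels l w) \<or> fan_pattern False (flag_labels l w)} ?A"
    proof (rule bij_betw_byWitness[where f' = "\<lambda>w. if w \<in> W then w else map flip w"])
      show "\<forall>w\<in>{w \<in> W. fan_pattern True (flag_labels l w) \<or> fan_pattern False (flag_labels l w)}.
        (if (if fan_pattern True (flag_labels l w) then w else map flip w) \<in> W
         then if fan_pattern True (flag_labels l w) then w else map flip w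
         else map flip (if fan_pattern True (flag_labels l w) then w else map flip w)) = w"
      proof
        fix w assume w: "w \<in> {w \<in> W. fan_pattern True (flag_labels l w) \<or> fan_pattern False (flag_labels l w)}"
        then have "map flip w \<notin> W" using memW(2)[of w] by (simp add: W_def)
        with w show "(if (if fan_pattern True (flag_labels l w) then w else map flip w) \<in> W
         then if fan_pattern True (flag_labels l w) then w else map flip w
         else map flip (if fan_pattern True (flag_labels l w) then w else map flip w)) = w" by simp
      qed
      show "\<forall>w\<in>?A. (if fan_pattern True (flag_labels l (if w \<in> W then w else map flip w))
           then if w \<in> W then w else map flip w
           else map flip (if w \<in> W then w else map flip w)) = w"
      proof
        fix w assume w: "w \<in> ?A"
        show "(if fan_pattern True (flag_labels l (if w \<in> W then w else map flip w))
           then if w \<in> W then w else map flip w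
           else map flip (if w \<in> W then w else map flip w)) = w"
        proof (cases "w \<in> W")
          case False
          with memW(1) w have m: "map flip w \<in> W" by blast
          have "fan_pattern False (flag_labels l (map flip w))"
            using w fl[of w] fan_neg[OF nz[of w], of False] by simp
          with excl[OF m] have "\<not> fan_pattern True (flag_labels l (map flip w))" by blast
          with False show ?thesis by simp
        qed (use w in simp)
      qed
      show "(\<lambda>w. if fan_pattern True (flag_labels l w) then w else map flip w) `
          {w \<in> W. fan_pattern True (flag_labels l w) \<or> fan_pattern False (flag_labels l w)} \<subseteq> ?A"
      proof (rule image_subsetI)
        fix w assume w: "w \<in> {w \<in> W. fan_pattern True (flag_labels l w) \<or> fan_pattern False (flag_labels l w)}"
        then have sw: "w \<in> signed_perms (Suc d)" by (simp add: W_def)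
        show "(if fan_pattern True (flag_labels l w) then w else map flip w) \<in> ?A"
        proof (cases "fan_pattern True (flag_labels l w)")
          case False
          then have "fan_pattern True (flag_labels l (map flip w))"
            using w fl[OF sw] fan_neg[OF nz[OF sw], of True] by simp
          with False sp[OF sw] show ?thesis by simp
        qed (use sw in simp)
      qed
      show "(\<lambda>w. if w \<in> W then w else map flip w) ` ?A
          \<subseteq> {w \<in> W. fan_pattern True (flag_labels l w) \<or> fan_pattern False (flag_labels l w)}"
      proof (rule image_subsetI)
        fix w assume w: "w \<in> ?A"
        then have sw: "w \<in> signed_perms (Suc d)" by simp
        show "(if w \<in> W then w else map flip w)
          \<in> {w \<in> W. fan_pattern True (flag_labels l w) \<or> fan_pattern False (flag_labels l w)}"
        proof (cases "w \<in> W")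
          case False
          then have "map flip w \<in> W" using memW(1)[OF sw] by blast
          moreover have "fan_pattern False (flag_labels l (map flip w))"
            using w fl[OF sw] fan_neg[OF nz[OF sw], of False] by simp
          ultimately show ?thesis using False by simp
        qed (use w in simp)
      qed
    qed
    then show ?thesis by (rule bij_betw_same_card)
  qed
  ultimately show ?case using last Suc by simp
qed

text \<open>
  A positively alternating flag exists by \<open>octahedral_fan_parity\<close>, and its \<open>n\<close> labels have distinct
  absolute values between \<open>1\<close> and \<open>m\<close>.
\<close>

lemma octahedral_tucker:
  fixes l :: "(nat \<times> bool) set \<Rightarrow> int"
  assumes anti: "\<And>X. X \<in> signed_sets n \<Longrightarrow> l (flip ` X) = - l X"
    and nc: "\<And>X Y. X \<in> signed_sets n \<Longrightarrow> Y \<in> signed_sets n \<Longrightarrow> X \<subseteq> Y \<Longrightarrow> l X \<noteq> - l Y"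
    and bound: "\<And>X. X \<in> signed_sets n \<Longrightarrow> \<bar>l X\<bar> \<le> int m"
  shows "n \<le> m"
proof (cases "n = 0")
  case False
  have "odd (card {w \<in> signed_perms n. fan_pattern True (flag_labels l w)})"
    using octahedral_fan_parity[of n l n] anti nc False by simp
  then obtain w where w: "w \<in> signed_perms n" and f: "fan_pattern True (flag_labels l w)"
    by (cases "{w \<in> signed_perms n. fan_pattern True (flag_labels l w)} = {}") (simp, blast)
  define ys where "ys = sort_key abs (flag_labels l w)"
  have len: "length ys = n" unfolding ys_def using length_signed_perms[OF w] by simp
  have ys_in: "\<exists>X \<in> signed_sets n. x = l X" if "x \<in> set ys" for x
    using that set_take_signed_perm[OF w] length_signed_perms[OF w]
    by (auto simp: ys_def flag_labels_def)
  have ys_pos: "1 \<le> \<bar>x\<bar> \<and> \<bar>x\<bar> \<le> int m" if x: "x \<in> set ys" for x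
  proof -
    obtain X where "X \<in> signed_sets n" "x = l X" using ys_in[OF x] by blast
    then show ?thesis using nc[of X X] bound[of X] by auto
  qed
  have strict: "distinct (map abs zs)"
    if "alternates s (map (\<lambda>x. 0 < x) zs)" "sorted (map abs zs)"
      "\<forall>x\<in>set zs. x \<noteq> 0 \<and> - x \<notin> set zs" for s and zs :: "int list"
    using that
  proof (induction zs arbitrary: s)
    case (Cons x zs)
    then have IH: "distinct (map abs zs)" by auto
    have "\<bar>x\<bar> \<notin> abs ` set zs"
    proof
      assume "\<bar>x\<bar> \<in> abs ` set zs"
      then obtain z where z: "z \<in> set zs" "\<bar>x\<bar> = \<bar>z\<bar>" by auto
      then obtain y ys' where y: "zs = y # ys'" by (cases zs) auto
      have "\<bar>x\<bar> \<le> \<bar>y\<bar>" "\<bar>y\<bar> \<le> \<bar>z\<bar>" using Cons.prems(2) z y by auto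
      then have "\<bar>x\<bar> = \<bar>y\<bar>" using z by linarith
      moreover have "x \<noteq> - y" "x \<noteq> 0" using Cons.prems(3) y by auto
      moreover have "x \<noteq> y" using Cons.prems(1) y by auto
      ultimately show False by linarith
    qed
    with IH show ?case by simp
  qed simp
  have nocomp: "- x \<notin> set ys" if x: "x \<in> set ys" for x
  proof
    assume x': "- x \<in> set ys"
    obtain i j where ij: "i < n" "j < n"
      "x = l (set (take (Suc i) w))" "- x = l (set (take (Suc j) w))"
      using x x' length_signed_perms[OF w] by (auto simp: ys_def flag_labels_def)
    have "set (take (Suc i) w) \<subseteq> set (take (Suc j) w) \<or> set (take (Suc j) w) \<subseteq> set (take (Suc i) w)"
      using set_take_subset_set_take[of "Suc i" "Suc j" w] set_take_subset_set_take[of "Suc j" "Suc i" w]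
      by (meson linear)
    then show False
      using nc[OF set_take_signed_perm[OF w ij(1)] set_take_signed_perm[OF w ij(2)]]
        nc[OF set_take_signed_perm[OF w ij(2)] set_take_signed_perm[OF w ij(1)]] ij
      by auto
  qed
  have "distinct (map abs ys)"
  proof (rule strict)
    show "alternates True (map (\<lambda>x. 0 < x) ys)" using f by (simp add: fan_pattern_def ys_def)
    show "sorted (map abs ys)" by (simp add: ys_def)
    show "\<forall>x\<in>set ys. x \<noteq> 0 \<and> - x \<notin> set ys" using ys_pos nocomp by force
  qed
  then have "card (set (map abs ys)) = n" using len by (simp only: distinct_card length_map)
  moreover have "set (map abs ys) \<subseteq> {1..int m}" using ys_pos by auto
  then have "card (set (map abs ys)) \<le> card {1..int m}" by (intro card_mono) auto
  ultimately show ?thesis by simp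
qed simp

section \<open>Kneser colourings with exceptional sets\<close>

lemma strict_sorted_distinct: "sorted_wrt (<) (xs :: nat list) \<Longrightarrow> distinct xs"
  by (simp add: strict_sorted_iff)

definition alt_words :: "bool \<Rightarrow> (nat \<times> bool) set \<Rightarrow> (nat \<times> bool) list set" where
  "alt_words s X = {zs. set zs \<subseteq> X \<and> sorted_wrt (<) (map fst zs) \<and> alternates s (map snd zs)}"

definition alt_length :: "bool \<Rightarrow> (nat \<times> bool) set \<Rightarrow> nat" where
  "alt_length s X = Max (length ` alt_words s X)"

lemma alt_words_length: "finite X \<Longrightarrow> zs \<in> alt_words s X \<Longrightarrow> length zs \<le> card X"
proof -
  assume X: "finite X" and zs: "zs \<in> alt_words s X"
  have "distinct zs" using zs by (auto simp: alt_words_def strict_sorted_iff distinct_map)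
  then have "length zs = card (set zs)" by (simp add: distinct_card)
  also have "\<dots> \<le> card X" using zs X by (intro card_mono) (auto simp: alt_words_def)
  finally show ?thesis .
qed

lemma alt_length_facts:
  assumes "finite X"
  shows alt_length_ge: "zs \<in> alt_words s X \<Longrightarrow> length zs \<le> alt_length s X"
    and alt_length_attained: "\<exists>zs \<in> alt_words s X. length zs = alt_length s X"
proof -
  have fin: "finite (length ` alt_words s X)"
    by (rule finite_subset[of _ "{..card X}"]) (auto dest: alt_words_length[OF assms])
  have ne: "length ` alt_words s X \<noteq> {}"
    by (auto simp: alt_words_def intro!: exI[of _ "[]"])
  show "length zs \<le> alt_length s X" if "zs \<in> alt_words s X"
    unfolding alt_length_def using that fin by (intro Max_ge) auto
  show "\<exists>zs \<in> alt_words s X. length zs = alt_length s X"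
    using Max_in[OF fin ne] unfolding alt_length_def by auto
qed

lemma alt_length_mono:
  assumes "finite Y" "X \<subseteq> Y" shows "alt_length s X \<le> alt_length s Y"
proof -
  obtain zs where "zs \<in> alt_words s X" "length zs = alt_length s X"
    using alt_length_attained[OF finite_subset[OF assms(2,1)]] by blast
  moreover from this(1) have "zs \<in> alt_words s Y" using assms(2) by (auto simp: alt_words_def)
  ultimately show ?thesis using alt_length_ge[OF assms(1)] by force
qed

lemma alternates_map_Not: "alternates s (map Not bs) \<longleftrightarrow> alternates (\<not> s) bs"
  by (induct bs arbitrary: s) auto

lemma alt_length_flip:
  assumes "finite X" shows "alt_length s (flip ` X) = alt_length (\<not> s) X"
proof -
  have le: "alt_length s Y \<le> alt_length (\<not> s) (flip ` Y)" if Y: "finite Y" for s Y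
  proof -
    obtain zs where zs: "zs \<in> alt_words s Y" "length zs = alt_length s Y"
      using alt_length_attained[OF Y] by blast
    have "snd \<circ> flip = Not \<circ> snd" by (auto simp: fun_eq_iff)
    then have "map snd (map flip zs) = map Not (map snd zs)" by simp
    moreover have "map fst (map flip zs) = map fst zs" by simp
    ultimately have "map flip zs \<in> alt_words (\<not> s) (flip ` Y)"
      using zs(1) alternates_map_Not[of "\<not> s" "map snd zs"] by (auto simp: alt_words_def simp del: map_map)
    then show ?thesis using alt_length_ge[of "flip ` Y" "map flip zs"] Y zs(2) by force
  qed
  have "flip ` flip ` X = X" by (simp add: image_image)
  then show ?thesis using le[of X "\<not> s"] le[of "flip ` X" s] assms by force
qed

text \<open>
  If the longest alternating subsequences of both kinds had equal length, the one with the later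
  first coordinate could be extended by the first element of the other. Hence comparing
  the two lengths is a sign rule for labels that the antipodal map inverts.
\<close>

lemma alt_length_sign_neq:
  assumes "finite X" "X \<noteq> {}" and cons: "\<forall>i. (i, True) \<in> X \<longrightarrow> (i, False) \<notin> X"
  shows "alt_length True X \<noteq> alt_length False X"
proof
  assume eq: "alt_length True X = alt_length False X"
  have longer: False if zs: "zs \<in> alt_words s X" "ys \<in> alt_words (\<not> s) X"
    "length ys = alt_length s X" "zs = z # zs'" "ys = y # ys'" "fst z < fst y" for s z y zs ys zs' ys'
  proof -
    have "z # ys \<in> alt_words s X" using zs by (auto simp: alt_words_def)
    then show False using alt_length_ge[OF assms(1)] zs(3) by force
  qed
  obtain zs where zs: "zs \<in> alt_words True X" "length zs = alt_length True X"
    using alt_length_attained[OF assms(1)] by blast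
  obtain ys where ys: "ys \<in> alt_words False X" "length ys = alt_length False X"
    using alt_length_attained[OF assms(1)] by blast
  obtain p where "p \<in> X" using assms(2) by blast
  then have "[p] \<in> alt_words (snd p) X" by (simp add: alt_words_def)
  from alt_length_ge[OF assms(1) this] have "1 \<le> alt_length (snd p) X" by simp
  then have pos: "1 \<le> alt_length True X" using eq by (cases "snd p") auto
  obtain z zs' where z: "zs = z # zs'" using zs(2) pos by (cases zs) auto
  obtain y ys' where y: "ys = y # ys'" using ys(2) pos eq by (cases ys) auto
  have zX: "z \<in> X" "snd z" and yX: "y \<in> X" "\<not> snd y" using zs(1) ys(1) z y by (auto simp: alt_words_def)
  have "fst z \<noteq> fst y" using zX yX cons by (metis (full_types) prod.collapse)
  then consider "fst z < fst y" | "fst y < fst z" by linarith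
  then show False
    using longer[of zs True ys z zs' y ys'] longer[of ys False zs y ys' z zs'] zs ys eq z y
    by cases auto
qed

text \<open>
  Along the order \<open>\<pi> 0, \<pi> 1, \<dots>\<close> the union of \<open>A\<close> and \<open>B\<close> is met alternately in \<open>A\<close> and in \<open>B\<close>.
\<close>

definition interlaced :: "nat \<Rightarrow> (nat \<Rightarrow> 'a) \<Rightarrow> 'a set \<Rightarrow> 'a set \<Rightarrow> bool" where
  "interlaced n \<pi> A B \<longleftrightarrow> (\<exists>zs s. sorted_wrt (<) (map fst zs) \<and> set (map fst zs) \<subseteq> {..<n}
     \<and> alternates s (map snd zs)
     \<and> A = \<pi> ` fst ` {z \<in> set zs. snd z} \<and> B = \<pi> ` fst ` {z \<in> set zs. \<not> snd z})"

lemma alternates_count: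
  "alternates s bs \<Longrightarrow> length bs = 2 * K \<Longrightarrow> length (filter (\<lambda>b. b = t) bs) = K"
proof (induction K arbitrary: bs)
  case (Suc K)
  then obtain b c cs where bs: "bs = b # c # cs" by (cases bs; cases "tl bs") auto
  have "length (filter (\<lambda>b. b = t) cs) = K" using Suc by (auto simp: bs)
  moreover have "b = (\<not> c)" using Suc.prems by (auto simp: bs)
  ultimately show ?case by (auto simp: bs)
qed simp

lemma card_sign_part:
  fixes zs :: "(nat \<times> bool) list"
  assumes "sorted_wrt (<) (map fst zs)" "alternates s (map snd zs)" "length zs = 2 * K"
    and inj: "inj_on \<pi> (set (map fst zs))"
  shows "card (\<pi> ` fst ` {z \<in> set zs. snd z = t}) = K"
proof -
  have d: "distinct (map fst zs)" by (rule strict_sorted_distinct[OF assms(1)])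
  then have inj1: "inj_on fst (set zs)" and dz: "distinct zs" by (auto simp: distinct_map)
  have "card (\<pi> ` fst ` {z \<in> set zs. snd z = t}) = card (fst ` {z \<in> set zs. snd z = t})"
    by (intro card_image inj_on_subset[OF inj]) auto
  also have "\<dots> = card {z \<in> set zs. snd z = t}"
    by (intro card_image inj_on_subset[OF inj1]) auto
  also have "\<dots> = card (set (filter (\<lambda>z. snd z = t) zs))" by (simp add: set_filter)
  also have "\<dots> = length (filter (\<lambda>z. snd z = t) zs)"
    using dz by (intro distinct_card) simp
  also have "\<dots> = length (filter (\<lambda>b. b = t) (map snd zs))"
    by (simp add: filter_map comp_def)
  also have "\<dots> = K" using assms by (intro alternates_count) auto
  finally show ?thesis .
qed

text \<open>
  Label a signed set by the length of its longest alternating subsequence while this is below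
  \<open>2K\<close>, and by a colour found in its positive or negative part afterwards. A subsequence of
  length \<open>2K\<close> consists of two interlaced \<open>K\<close>-sets, one in each part, and one of them is not
  bad; so a colour exists. There are \<open>2K - 1\<close> lengths and \<open>c\<close> colours.
\<close>

theorem alternation_bound:
  fixes \<pi> :: "nat \<Rightarrow> 'a" and col :: "'a set \<Rightarrow> nat"
  assumes \<pi>: "bij_betw \<pi> {..<n} S" and K: "0 < K"
    and notint: "\<And>A B. A \<in> Bad \<Longrightarrow> B \<in> Bad \<Longrightarrow> \<not> interlaced n \<pi> A B"
    and colc: "\<And>A. A \<subseteq> S \<Longrightarrow> card A = K \<Longrightarrow> A \<notin> Bad \<Longrightarrow> col A < c"
    and proper: "\<And>A B. A \<subseteq> S \<Longrightarrow> card A = K \<Longrightarrow> A \<notin> Bad \<Longrightarrow> B \<subseteq> S \<Longrightarrow> card B = K \<Longrightarrow> B \<notin> Bad \<Longrightarrow>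
        A \<inter> B = {} \<Longrightarrow> col A \<noteq> col B"
  shows "n \<le> c + 2 * K - 1"
proof -
  define part where "part t X = \<pi> ` {i. (i, t) \<in> X}" for t :: bool and X
  define cols where "cols t X = {g. \<exists>A. A \<subseteq> part t X \<and> card A = K \<and> A \<notin> Bad \<and> col A = g}" for t X
  define mx where "mx X = max (alt_length True X) (alt_length False X)" for X
  define g where "g X = (LEAST x. x \<in> cols True X \<union> cols False X)" for X
  \<comment> \<open>Lengths use the absolute values \<open>1, \<dots>, 2K - 1\<close>; colours start at \<open>2K\<close>, so the two kinds never clash.\<close>
  define l :: "(nat \<times> bool) set \<Rightarrow> int" where "l X = (if mx X < 2 * K
      then (if alt_length False X < alt_length True X then int (mx X) else - int (mx X))
      else (if g X \<in> cols True X then int (2 * K + g X) else - int (2 * K + g X)))" for X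
  have inj: "inj_on \<pi> {..<n}" using \<pi> by (simp add: bij_betw_def)
  have sub: "X \<subseteq> {..<n} \<times> UNIV" and fin: "finite X" and ne: "X \<noteq> {}"
    and cons: "\<forall>i. (i, True) \<in> X \<longrightarrow> (i, False) \<notin> X" if "X \<in> signed_sets n" for X
    using that finite_subset[of X "{..<n} \<times> UNIV"] by (auto simp: signed_sets_def)
  have partS: "part t X \<subseteq> S" if "X \<in> signed_sets n" for t X
    using sub[OF that] \<pi> by (auto simp: part_def bij_betw_def)
  have part_disj: "part True X \<inter> part False X = {}" if X: "X \<in> signed_sets n" for X
  proof -
    have "{i. (i, True) \<in> X} \<union> {i. (i, False) \<in> X} \<subseteq> {..<n}" using sub[OF X] by auto
    moreover have "{i. (i, True) \<in> X} \<inter> {i. (i, False) \<in> X} = {}" using cons[OF X] by auto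
    ultimately show ?thesis unfolding part_def
      by (metis inj_on_image_Int[OF inj] Un_subset_iff image_empty)
  qed
  have part_mono: "part t X \<subseteq> part t Y" if "X \<subseteq> Y" for t X Y using that by (auto simp: part_def)
  have part_flip: "part t (flip ` X) = part (\<not> t) X" for t X
  proof -
    have "(i, t) \<in> flip ` X \<longleftrightarrow> (i, \<not> t) \<in> X" for i
      by (auto simp: flip_def image_iff intro!: bexI[of _ "(i, \<not> t)"])
    then show ?thesis by (simp add: part_def)
  qed
  have excl: "\<not> (x \<in> cols True X \<and> x \<in> cols False Y)" "\<not> (x \<in> cols False X \<and> x \<in> cols True Y)"
    if X: "X \<in> signed_sets n" and Y: "Y \<in> signed_sets n" and XY: "X \<subseteq> Y" for x X Y
  proof -
    have False if A: "A \<subseteq> part t X" "card A = K" "A \<notin> Bad" "col A = x"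
      and B: "B \<subseteq> part (\<not> t) Y" "card B = K" "B \<notin> Bad" "col B = x" for t A B
    proof -
      have "A \<inter> B = {}" using A(1) B(1) part_mono[OF XY, of t] part_disj[OF Y] by (cases t) auto
      moreover have "A \<subseteq> S" "B \<subseteq> S" using A(1) B(1) partS X Y by blast+
      ultimately show False using proper[of A B] A B by simp
    qed
    note no_pair = this
    have "\<not> (x \<in> cols t X \<and> x \<in> cols (\<not> t) Y)" for t
    proof
      assume "x \<in> cols t X \<and> x \<in> cols (\<not> t) Y"
      then obtain A B where "A \<subseteq> part t X" "card A = K" "A \<notin> Bad" "col A = x"
        "B \<subseteq> part (\<not> t) Y" "card B = K" "B \<notin> Bad" "col B = x"
        unfolding cols_def mem_Collect_eq by metis
      then show False by (rule no_pair)
    qed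
    from this[of True] this[of False]
    show "\<not> (x \<in> cols True X \<and> x \<in> cols False Y)" "\<not> (x \<in> cols False X \<and> x \<in> cols True Y)"
      by simp_all
  qed
  have cols_bound: "x < c" if "x \<in> cols t X" "X \<in> signed_sets n" for x t X
  proof -
    obtain A where A: "A \<subseteq> part t X" "card A = K" "A \<notin> Bad" "col A = x"
      using \<open>x \<in> cols t X\<close> unfolding cols_def mem_Collect_eq by metis
    have "A \<subseteq> S" by (rule subset_trans[OF A(1) partS[OF \<open>X \<in> signed_sets n\<close>]])
    from colc[OF this A(2,3)] show ?thesis using A(4) by simp
  qed
  have cols_ne: "g X \<in> cols True X \<union> cols False X" if X: "X \<in> signed_sets n" and m: "2 * K \<le> mx X" for X
  proof -
    obtain s where "2 * K \<le> alt_length s X" using m unfolding mx_def by (metis max_def)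
    then obtain ws where ws: "ws \<in> alt_words s X" "2 * K \<le> length ws"
      using alt_length_attained[OF fin[OF X]] by metis
    define zs where "zs = take (2 * K) ws"
    have alt_take: "alternates s bs \<Longrightarrow> alternates s (take m bs)" for s bs m
      by (induct bs arbitrary: s m) (auto simp: take_Cons split: nat.split)
    have zs: "sorted_wrt (<) (map fst zs)" "alternates s (map snd zs)" "length zs = 2 * K" "set zs \<subseteq> X"
      using ws alt_take set_take_subset[of "2 * K" ws]
      by (auto simp: zs_def alt_words_def sorted_wrt_take simp flip: take_map)
    have dom: "set (map fst zs) \<subseteq> {..<n}" using zs(4) sub[OF X] by auto
    have c: "card (\<pi> ` fst ` {z \<in> set zs. snd z = t}) = K" for t
      by (rule card_sign_part[OF zs(1-3)]) (rule inj_on_subset[OF inj dom])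
    have p: "\<pi> ` fst ` {z \<in> set zs. snd z = t} \<subseteq> part t X" for t
      using zs(4) by (auto simp: part_def)
    have "interlaced n \<pi> (\<pi> ` fst ` {z \<in> set zs. snd z}) (\<pi> ` fst ` {z \<in> set zs. \<not> snd z})"
      unfolding interlaced_def using zs dom by blast
    then have "\<pi> ` fst ` {z \<in> set zs. snd z = True} \<notin> Bad \<or> \<pi> ` fst ` {z \<in> set zs. snd z = False} \<notin> Bad"
      using notint by auto
    then have "\<exists>x. x \<in> cols True X \<union> cols False X"
      unfolding cols_def using c p by blast
    then show ?thesis unfolding g_def by (rule LeastI_ex)
  qed
  have "n \<le> c + 2 * K - 1"
  proof (rule octahedral_tucker[of n l])
    fix X assume X: "X \<in> signed_sets n"
    have fX: "alt_length t (flip ` X) = alt_length (\<not> t) X" for t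
      by (rule alt_length_flip[OF fin[OF X]])
    have cf: "cols t (flip ` X) = cols (\<not> t) X" for t by (simp add: cols_def part_flip)
    have mf: "mx (flip ` X) = mx X" by (simp add: mx_def fX max.commute)
    have gf: "g (flip ` X) = g X" by (simp add: g_def cf Un_commute)
    have ltneq: "alt_length True X \<noteq> alt_length False X"
      by (rule alt_length_sign_neq[OF fin[OF X] ne[OF X] cons[OF X]])
    show "l (flip ` X) = - l X"
    proof (cases "mx X < 2 * K")
      case True
      then show ?thesis unfolding l_def mf using ltneq by (auto simp: fX)
    next
      case False
      then have "g X \<in> cols True X \<union> cols False X" using cols_ne[OF X] by simp
      then show ?thesis unfolding l_def mf gf using False excl[OF X X order_refl, of "g X"]
        by (auto simp: cf)
    qed
    have "g X < c" if "\<not> mx X < 2 * K" using cols_ne[OF X] that cols_bound[OF _ X] by auto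
    then show "\<bar>l X\<bar> \<le> int (c + 2 * K - 1)" unfolding l_def using K by auto
  next
    fix X Y assume X: "X \<in> signed_sets n" and Y: "Y \<in> signed_sets n" and XY: "X \<subseteq> Y"
    have neX: "alt_length True X \<noteq> alt_length False X"
      by (rule alt_length_sign_neq[OF fin[OF X] ne[OF X] cons[OF X]])
    have neY: "alt_length True Y \<noteq> alt_length False Y"
      by (rule alt_length_sign_neq[OF fin[OF Y] ne[OF Y] cons[OF Y]])
    have mono: "alt_length t X \<le> alt_length t Y" for t by (rule alt_length_mono[OF fin[OF Y] XY])
    show "l X \<noteq> - l Y"
    proof
      assume eq: "l X = - l Y"
      consider "mx X < 2 * K" "mx Y < 2 * K" | "mx X < 2 * K" "\<not> mx Y < 2 * K"
        | "\<not> mx X < 2 * K" "mx Y < 2 * K" | "\<not> mx X < 2 * K" "\<not> mx Y < 2 * K" by blast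
      then show False
      proof cases
        \<comment> \<open>Equal maxima with opposite leading signs contradict monotonicity of both lengths.\<close>
        case 1
        then show False using eq neX neY mono[of True] mono[of False]
          unfolding l_def mx_def by (auto simp: max_def split: if_splits)
      next
        case 2
        then show False using eq unfolding l_def by (auto split: if_splits)
      next
        case 3
        then show False using eq unfolding l_def by (auto split: if_splits)
      next
        case 4
        have "g X \<in> cols True X \<union> cols False X" "g Y \<in> cols True Y \<union> cols False Y"
          using cols_ne[OF X] cols_ne[OF Y] 4 by simp_all
        moreover have "g X = g Y" using 4 eq K unfolding l_def by (auto split: if_splits)
        ultimately show False using 4 eq K excl[OF X Y XY, of "g X"]
          unfolding l_def by (auto split: if_splits)
      qed
    qed
  qed
  then show ?thesis .
qed

fun altbits :: "bool \<Rightarrow> nat \<Rightarrow> bool list" where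
  "altbits s 0 = []"
| "altbits s (Suc n) = s # altbits (\<not> s) n"

lemma alternates_eq_altbits: "alternates s bs \<Longrightarrow> bs = altbits s (length bs)"
  by (induct bs arbitrary: s) auto

lemma card_interlaced_splits:
  assumes inj: "inj_on \<pi> {..<n}"
  shows "card {A. A \<subseteq> M \<and> interlaced n \<pi> A (M - A)} \<le> 2"
proof -
  define L where "L = sorted_list_of_set {i. i < n \<and> \<pi> i \<in> M}"
  define h where "h s = \<pi> ` fst ` {z \<in> set (zip L (altbits s (length L))). snd z}" for s
  have "{A. A \<subseteq> M \<and> interlaced n \<pi> A (M - A)} \<subseteq> h ` UNIV"
  proof safe
    fix A assume A: "A \<subseteq> M" "interlaced n \<pi> A (M - A)"
    then obtain zs s where zs: "sorted_wrt (<) (map fst zs)" "set (map fst zs) \<subseteq> {..<n}"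
      "alternates s (map snd zs)" "A = \<pi> ` fst ` {z \<in> set zs. snd z}"
      "M - A = \<pi> ` fst ` {z \<in> set zs. \<not> snd z}" unfolding interlaced_def by blast
    have M: "M = \<pi> ` set (map fst zs)"
    proof -
      have "M = A \<union> (M - A)" using A(1) by blast
      also have "\<dots> = \<pi> ` fst ` ({z \<in> set zs. snd z} \<union> {z \<in> set zs. \<not> snd z})"
        unfolding image_Un using zs(4,5) by simp
      also have "{z \<in> set zs. snd z} \<union> {z \<in> set zs. \<not> snd z} = set zs" by blast
      finally show ?thesis by simp
    qed
    have "{i. i < n \<and> \<pi> i \<in> M} = set (map fst zs)"
    proof (intro equalityI subsetI)
      fix i assume "i \<in> {i. i < n \<and> \<pi> i \<in> M}"
      then obtain j where "i < n" "j \<in> set (map fst zs)" "\<pi> i = \<pi> j" unfolding M by blast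
      then show "i \<in> set (map fst zs)" using inj zs(2) by (auto dest: inj_onD)
    next
      fix i assume "i \<in> set (map fst zs)"
      then show "i \<in> {i. i < n \<and> \<pi> i \<in> M}" using zs(2) unfolding M by blast
    qed
    then have L: "L = map fst zs"
      unfolding L_def using zs(1) sorted_list_of_set.idem_if_sorted_distinct
      by (metis strict_sorted_iff)
    moreover have "map snd zs = altbits s (length L)"
      using alternates_eq_altbits[OF zs(3)] L by simp
    ultimately have "zs = zip L (altbits s (length L))" by (metis zip_map_fst_snd)
    then show "A \<in> h ` UNIV" using zs(4) unfolding h_def by blast
  qed
  then have "card {A. A \<subseteq> M \<and> interlaced n \<pi> A (M - A)} \<le> card (h ` (UNIV :: bool set))"
    by (intro card_mono) auto
  also have "\<dots> \<le> 2" using card_image_le[of "UNIV :: bool set" h] by (simp add: card_UNIV_bool)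
  finally show ?thesis .
qed

text \<open>
  Linear orders of \<open>S\<close> as extensional bijections, so that they form a finite set.
\<close>

definition orders :: "nat \<Rightarrow> 'a set \<Rightarrow> (nat \<Rightarrow> 'a) set" where
  "orders n S = {\<pi> \<in> {..<n} \<rightarrow>\<^sub>E S. bij_betw \<pi> {..<n} S}"

lemma finite_orders: "finite S \<Longrightarrow> finite (orders n S)"
  unfolding orders_def by (rule finite_subset[of _ "{..<n} \<rightarrow>\<^sub>E S"]) (auto intro: finite_PiE)

text \<open>
  A permutation of \<open>S\<close> that carries \<open>A\<close> to \<open>A'\<close> and \<open>B\<close> to \<open>B'\<close> carries orders to orders.
\<close>

lemma interlaced_orders_mono:
  assumes S: "finite S" "A \<union> B \<subseteq> S" "A' \<union> B' \<subseteq> S" "A \<inter> B = {}" "A' \<inter> B' = {}"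
    "A \<union> B = A' \<union> B'" "card A = card A'" "card B = card B'"
  shows "card {\<pi> \<in> orders n S. interlaced n \<pi> A B} \<le> card {\<pi> \<in> orders n S. interlaced n \<pi> A' B'}"
proof -
  have fin: "finite A" "finite A'" "finite B" "finite B'" using S by (auto intro: finite_subset)
  obtain f where f: "bij_betw f A A'" using finite_same_card_bij[OF fin(1,2) S(7)] by blast
  obtain h where h: "bij_betw h B B'" using finite_same_card_bij[OF fin(3,4) S(8)] by blast
  define \<tau> where "\<tau> x = (if x \<in> A then f x else if x \<in> B then h x else x)" for x
  have \<tau>A: "bij_betw \<tau> A A'"
    using f by (rule bij_betw_cong[THEN iffD1, rotated]) (simp add: \<tau>_def)
  have \<tau>B: "bij_betw \<tau> B B'"
    using h by (rule bij_betw_cong[THEN iffD1, rotated]) (use S(4) in \<open>auto simp: \<tau>_def\<close>)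
  have \<tau>R: "bij_betw \<tau> (S - (A \<union> B)) (S - (A' \<union> B'))"
    unfolding S(6)[symmetric]
    by (rule bij_betw_cong[THEN iffD1, rotated, OF bij_betw_id]) (auto simp: \<tau>_def)
  have "bij_betw \<tau> (A \<union> B) (A' \<union> B')" by (rule bij_betw_combine[OF \<tau>A \<tau>B S(5)])
  then have "bij_betw \<tau> (A \<union> B \<union> (S - (A \<union> B))) (A' \<union> B' \<union> (S - (A' \<union> B')))"
    by (rule bij_betw_combine[OF _ \<tau>R]) blast
  moreover have "A \<union> B \<union> (S - (A \<union> B)) = S" "A' \<union> B' \<union> (S - (A' \<union> B')) = S" using S by blast+
  ultimately have \<tau>: "bij_betw \<tau> S S" by simp
  define \<Phi> where "\<Phi> \<pi> = (\<lambda>i\<in>{..<n}. \<tau> (\<pi> i))" for \<pi> :: "nat \<Rightarrow> 'a"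
  show ?thesis
  proof (rule card_inj_on_le[where f = \<Phi>])
    show "finite {\<pi> \<in> orders n S. interlaced n \<pi> A' B'}" using finite_orders[OF S(1)] by simp
    show "inj_on \<Phi> {\<pi> \<in> orders n S. interlaced n \<pi> A B}"
    proof (rule inj_onI)
      fix \<pi> \<rho> assume a: "\<pi> \<in> {\<pi> \<in> orders n S. interlaced n \<pi> A B}"
        "\<rho> \<in> {\<pi> \<in> orders n S. interlaced n \<pi> A B}" "\<Phi> \<pi> = \<Phi> \<rho>"
      show "\<pi> = \<rho>"
      proof (rule PiE_ext[where k = "{..<n}" and s = "\<lambda>_. S"])
        fix i assume i: "i \<in> {..<n}"
        have "\<tau> (\<pi> i) = \<tau> (\<rho> i)" using fun_cong[OF a(3), of i] i by (simp add: \<Phi>_def)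
        moreover have "\<pi> i \<in> S" "\<rho> i \<in> S" using a i by (auto simp: orders_def)
        ultimately show "\<pi> i = \<rho> i" using \<tau> by (auto simp: bij_betw_def dest: inj_onD)
      qed (use a in \<open>auto simp: orders_def\<close>)
    qed
    show "\<Phi> ` {\<pi> \<in> orders n S. interlaced n \<pi> A B} \<subseteq> {\<pi> \<in> orders n S. interlaced n \<pi> A' B'}"
    proof (rule image_subsetI)
      fix \<pi> assume p: "\<pi> \<in> {\<pi> \<in> orders n S. interlaced n \<pi> A B}"
      then have bp: "bij_betw \<pi> {..<n} S" by (simp add: orders_def)
      have "bij_betw (\<tau> \<circ> \<pi>) {..<n} S" by (rule bij_betw_trans[OF bp \<tau>])
      then have bP: "bij_betw (\<Phi> \<pi>) {..<n} S"
        by (rule bij_betw_cong[THEN iffD1, rotated]) (simp add: \<Phi>_def)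
      then have "\<Phi> \<pi> \<in> orders n S"
        unfolding orders_def by (auto simp: \<Phi>_def bij_betw_def)
      moreover obtain zs s where zs: "sorted_wrt (<) (map fst zs)" "set (map fst zs) \<subseteq> {..<n}"
        "alternates s (map snd zs)" "A = \<pi> ` fst ` {z \<in> set zs. snd z}"
        "B = \<pi> ` fst ` {z \<in> set zs. \<not> snd z}" using p unfolding interlaced_def by blast
      have im: "\<Phi> \<pi> ` fst ` Z = \<tau> ` \<pi> ` fst ` Z" if "Z \<subseteq> set zs" for Z
        unfolding image_image using zs(2) that by (intro image_cong) (auto simp: \<Phi>_def)
      have "A' = \<Phi> \<pi> ` fst ` {z \<in> set zs. snd z}" "B' = \<Phi> \<pi> ` fst ` {z \<in> set zs. \<not> snd z}"
        using im[of "{z \<in> set zs. snd z}"] im[of "{z \<in> set zs. \<not> snd z}"] zs(4,5) \<tau>A \<tau>B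
        by (auto simp: bij_betw_def)
      then have "interlaced n (\<Phi> \<pi>) A' B'" unfolding interlaced_def using zs(1-3) by blast
      ultimately show "\<Phi> \<pi> \<in> {\<pi> \<in> orders n S. interlaced n \<pi> A' B'}" by simp
    qed
  qed
qed

text \<open>
  Each order interlaces at most two of the \<open>2K choose K\<close> splittings of \<open>A \<union> B\<close> into \<open>K\<close>-sets, and by
  symmetry all splittings are interlaced by equally many orders.
\<close>

lemma card_interlaced_orders:
  assumes S: "finite S" "A \<subseteq> S" "B \<subseteq> S" "A \<inter> B = {}" "card A = K" "card B = K"
  shows "card {\<pi> \<in> orders n S. interlaced n \<pi> A B} * ((2 * K) choose K) \<le> 2 * card (orders n S)"
proof -
  define M where "M = A \<union> B"
  have fin: "finite M" "finite A" "finite B" using S by (auto simp: M_def intro: finite_subset)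
  have cM: "card M = 2 * K" unfolding M_def using S fin by (simp add: card_Un_disjoint)
  define Q where "Q = {A'. A' \<subseteq> M \<and> card A' = K}"
  have finQ: "finite Q" using fin by (simp add: Q_def)
  have cQ: "card Q = (2 * K) choose K" unfolding Q_def using n_subsets[OF fin(1)] cM by simp
  have "card {\<pi> \<in> orders n S. interlaced n \<pi> A B} * ((2 * K) choose K)
      = (\<Sum>A'\<in>Q. card {\<pi> \<in> orders n S. interlaced n \<pi> A B})" by (simp add: cQ)
  also have "\<dots> \<le> (\<Sum>A'\<in>Q. card {\<pi> \<in> orders n S. interlaced n \<pi> A' (M - A')})"
  proof (rule sum_mono)
    fix A' assume A': "A' \<in> Q"
    then have "card (M - A') = K"
      using card_Diff_subset[of A' M] fin cM by (auto simp: Q_def intro: finite_subset)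
    then show "card {\<pi> \<in> orders n S. interlaced n \<pi> A B}
        \<le> card {\<pi> \<in> orders n S. interlaced n \<pi> A' (M - A')}"
      using S A' by (intro interlaced_orders_mono) (auto simp: M_def Q_def)
  qed
  also have "\<dots> = (\<Sum>A'\<in>Q. \<Sum>\<pi>\<in>orders n S. if interlaced n \<pi> A' (M - A') then 1 else 0)"
    using finite_orders[OF S(1)] by (simp add: sum.If_cases Int_def)
  also have "\<dots> = (\<Sum>\<pi>\<in>orders n S. \<Sum>A'\<in>Q. if interlaced n \<pi> A' (M - A') then 1 else 0)"
    by (rule sum.swap)
  also have "\<dots> \<le> (\<Sum>\<pi>\<in>orders n S. 2)"
  proof (rule sum_mono)
    fix \<pi> assume "\<pi> \<in> orders n S"
    then have inj: "inj_on \<pi> {..<n}" by (simp add: orders_def bij_betw_def)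
    have "(\<Sum>A'\<in>Q. if interlaced n \<pi> A' (M - A') then 1 else 0)
        = card {A' \<in> Q. interlaced n \<pi> A' (M - A')}"
      using finQ by (simp add: sum.If_cases Int_def)
    also have "\<dots> \<le> card {A'. A' \<subseteq> M \<and> interlaced n \<pi> A' (M - A')}"
      using fin by (intro card_mono) (auto simp: Q_def)
    also have "\<dots> \<le> 2" by (rule card_interlaced_splits[OF inj])
    finally show "(\<Sum>A'\<in>Q. if interlaced n \<pi> A' (M - A') then 1 else 0) \<le> (2 :: nat)" .
  qed
  finally show ?thesis by simp
qed

lemma exists_order_without_interlaced_pair:
  assumes S: "finite S" "card S = n" and Bad: "\<And>A. A \<in> Bad \<Longrightarrow> A \<subseteq> S \<and> card A = K"
    and few: "2 * card Bad ^ 2 < (2 * K) choose K" and K: "0 < K"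
  shows "\<exists>\<pi>. bij_betw \<pi> {..<n} S \<and> (\<forall>A\<in>Bad. \<forall>B\<in>Bad. \<not> interlaced n \<pi> A B)"
proof (rule ccontr)
  assume neg: "\<not> ?thesis"
  have finB: "finite Bad" by (rule finite_subset[of _ "Pow S"]) (use Bad S in auto)
  \<comment> \<open>Interlaced sets are disjoint, so intersecting pairs of bad sets are harmless.\<close>
  have disj: "A \<inter> B = {}" if "interlaced n \<pi> A B" "inj_on \<pi> {..<n}" for \<pi> :: "nat \<Rightarrow> 'a" and A B
  proof -
    from that(1) obtain zs s where zs: "sorted_wrt (<) (map fst zs)" "set (map fst zs) \<subseteq> {..<n}"
      "alternates s (map snd zs)"
      "A = \<pi> ` fst ` {z \<in> set zs. snd z}" "B = \<pi> ` fst ` {z \<in> set zs. \<not> snd z}"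
      unfolding interlaced_def by blast
    have "inj_on (\<pi> \<circ> fst) (set zs)"
    proof (rule comp_inj_on)
      show "inj_on fst (set zs)" using strict_sorted_distinct[OF zs(1)] by (simp add: distinct_map)
      show "inj_on \<pi> (fst ` set zs)" using that(2) zs(2) by (auto intro: inj_on_subset)
    qed
    then have im: "(\<pi> \<circ> fst) ` Z \<inter> (\<pi> \<circ> fst) ` W = {}" if "Z \<subseteq> set zs" "W \<subseteq> set zs" "Z \<inter> W = {}" for Z W
      using inj_on_image_Int[of "\<pi> \<circ> fst" "set zs" Z W] that by simp
    show ?thesis unfolding zs(4,5) image_comp by (rule im) auto
  qed
  have "card (orders n S) * ((2 * K) choose K)
      \<le> (\<Sum>(A, B)\<in>Bad \<times> Bad. card {\<pi> \<in> orders n S. interlaced n \<pi> A B}) * ((2 * K) choose K)"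
  proof (rule mult_right_mono)
    have "orders n S \<subseteq> (\<Union>(A, B)\<in>Bad \<times> Bad. {\<pi> \<in> orders n S. interlaced n \<pi> A B})"
    proof
      fix \<pi> assume \<pi>: "\<pi> \<in> orders n S"
      then obtain A B where "A \<in> Bad" "B \<in> Bad" "interlaced n \<pi> A B"
        using neg unfolding orders_def by blast
      with \<pi> show "\<pi> \<in> (\<Union>(A, B)\<in>Bad \<times> Bad. {\<pi> \<in> orders n S. interlaced n \<pi> A B})" by blast
    qed
    then have "card (orders n S) \<le> card (\<Union>(A, B)\<in>Bad \<times> Bad. {\<pi> \<in> orders n S. interlaced n \<pi> A B})"
      using finB finite_orders[OF S(1)] by (intro card_mono) auto
    also have "\<dots> \<le> (\<Sum>(A, B)\<in>Bad \<times> Bad. card {\<pi> \<in> orders n S. interlaced n \<pi> A B})"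
      using card_UN_le[of "Bad \<times> Bad" "\<lambda>(A, B). {\<pi> \<in> orders n S. interlaced n \<pi> A B}"] finB
      by (simp add: case_prod_unfold)
    finally show "card (orders n S) \<le> \<dots>" .
  qed simp
  also have "\<dots> \<le> (\<Sum>(A, B)\<in>Bad \<times> Bad. 2 * card (orders n S))"
    unfolding sum_distrib_right
  proof (rule sum_mono, clarify)
    fix A B assume AB: "A \<in> Bad" "B \<in> Bad"
    show "card {\<pi> \<in> orders n S. interlaced n \<pi> A B} * ((2 * K) choose K) \<le> 2 * card (orders n S)"
    proof (cases "A \<inter> B = {}")
      case True
      then show ?thesis using Bad AB by (intro card_interlaced_orders[OF S(1)]) auto
    next
      case False
      then have "{\<pi> \<in> orders n S. interlaced n \<pi> A B} = {}"
        using disj by (auto simp: orders_def bij_betw_def)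
      then show ?thesis by (simp only: card.empty mult_zero_left zero_le)
    qed
  qed
  also have "\<dots> = card (orders n S) * (2 * card Bad ^ 2)"
    by (simp add: power2_eq_square card_cartesian_product)
  finally have le: "card (orders n S) * ((2 * K) choose K) \<le> card (orders n S) * (2 * card Bad ^ 2)" .
  obtain \<pi> where "bij_betw \<pi> {..<n} S"
    using ex_bij_betw_nat_finite[OF S(1)] S(2) by (auto simp: atLeast0LessThan)
  then have "restrict \<pi> {..<n} \<in> orders n S"
    unfolding orders_def by (auto simp: bij_betw_def inj_on_restrict_eq cong: image_cong)
  then have "0 < card (orders n S)" using finite_orders[OF S(1)] by (auto simp: card_gt_0_iff)
  with le few show False by simp
qed

text \<open>
  With no bad sets this is the Lovasz bound up to an additive one. The number
  of bad sets allowed is about \<open>2 ^ K\<close>: there are \<open>card Bad ^ 2\<close> pairs, and each is interlaced in a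
  fraction \<open>2 / (2K choose K)\<close> of the orders.
\<close>

theorem kneser_with_few_bad_sets:
  fixes col :: "'a set \<Rightarrow> 'c"
  assumes S: "finite S" and K: "0 < K" and C: "finite C"
    and Bad: "\<And>A. A \<in> Bad \<Longrightarrow> A \<subseteq> S \<and> card A = K"
    and few: "2 * card Bad ^ 2 < (2 * K) choose K"
    and col: "\<And>A. A \<subseteq> S \<Longrightarrow> card A = K \<Longrightarrow> A \<notin> Bad \<Longrightarrow> col A \<in> C"
    and proper: "\<And>A B. A \<subseteq> S \<Longrightarrow> card A = K \<Longrightarrow> A \<notin> Bad \<Longrightarrow> B \<subseteq> S \<Longrightarrow> card B = K \<Longrightarrow> B \<notin> Bad \<Longrightarrow>
        A \<inter> B = {} \<Longrightarrow> col A \<noteq> col B"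
  shows "card S \<le> card C + 2 * K - 1"
proof -
  obtain h where h: "bij_betw h C {..<card C}"
    using ex_bij_betw_finite_nat[OF C] by (auto simp: atLeast0LessThan)
  obtain \<pi> where \<pi>: "bij_betw \<pi> {..<card S} S" "\<forall>A\<in>Bad. \<forall>B\<in>Bad. \<not> interlaced (card S) \<pi> A B"
    using exists_order_without_interlaced_pair[OF S refl Bad few K] by blast
  show ?thesis
  proof (rule alternation_bound[where col = "\<lambda>A. h (col A)", OF \<pi>(1) K])
    show "\<not> interlaced (card S) \<pi> A B" if "A \<in> Bad" "B \<in> Bad" for A B using \<pi>(2) that by blast
    show "h (col A) < card C" if "A \<subseteq> S" "card A = K" "A \<notin> Bad" for A
      using h col[OF that] by (auto simp: bij_betw_def)
    show "h (col A) \<noteq> h (col B)" if "A \<subseteq> S" "card A = K" "A \<notin> Bad"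
      "B \<subseteq> S" "card B = K" "B \<notin> Bad" "A \<inter> B = {}" for A B
      using proper[OF that] col[OF that(1-3)] col[OF that(4-6)] h
      by (auto simp: bij_betw_def dest: inj_onD)
  qed
qed

section \<open>Uniformly random subsets and families of bounded size\<close>

definition prb :: "'e set \<Rightarrow> ('e set \<Rightarrow> bool) \<Rightarrow> real" where
  "prb U P = measure_pmf.prob (pmf_of_set (Pow U)) {E. P E}"

lemma prb_eq_card:
  assumes "finite U" shows "prb U P = real (card {E \<in> Pow U. P E}) / 2 ^ card U"
proof -
  have "Pow U \<inter> {E. P E} = {E \<in> Pow U. P E}" by blast
  then show ?thesis
    unfolding prb_def using assms by (subst measure_pmf_of_set) (auto simp: card_Pow)
qed

lemma prb_mono:
  assumes "finite U" "\<And>E. E \<subseteq> U \<Longrightarrow> P E \<Longrightarrow> Q E" shows "prb U P \<le> prb U Q"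
proof -
  have "card {E \<in> Pow U. P E} \<le> card {E \<in> Pow U. Q E}"
    using assms by (intro card_mono) auto
  then show ?thesis unfolding prb_eq_card[OF assms(1)] by (simp add: divide_right_mono)
qed

lemma prb_Bex_le:
  assumes "finite I" shows "prb U (\<lambda>E. \<exists>i\<in>I. P i E) \<le> (\<Sum>i\<in>I. prb U (P i))"
proof -
  have "{E. \<exists>i\<in>I. P i E} = (\<Union>i\<in>I. {E. P i E})" by blast
  then show ?thesis unfolding prb_def
    using measure_pmf.finite_measure_subadditive_finite[of I "\<lambda>i. {E. P i E}"] assms by simp
qed

lemma prb_disj_le: "prb U (\<lambda>E. P E \<or> Q E) \<le> prb U P + prb U Q"
proof -
  have "{E. P E \<or> Q E} = {E. P E} \<union> {E. Q E}" by blast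
  then show ?thesis unfolding prb_def by (simp add: measure_Un_le)
qed

lemma prb_Not: "prb U (\<lambda>E. \<not> P E) = 1 - prb U P"
proof -
  have "{E. \<not> P E} = space (measure_pmf (pmf_of_set (Pow U))) - {E. P E}" by auto
  then show ?thesis unfolding prb_def by (simp only: measure_pmf.prob_compl sets_measure_pmf UNIV_I)
qed

lemma prb_nonneg [simp]: "0 \<le> prb U P" and prb_le_1 [simp]: "prb U P \<le> 1"
  by (simp_all add: prb_def)

lemma prb_avoid:
  assumes U: "finite U" and W: "W \<subseteq> U" shows "prb U (\<lambda>E. W \<inter> E = {}) = (1 / 2) ^ card W"
proof -
  have "{E \<in> Pow U. W \<inter> E = {}} = Pow (U - W)" by blast
  moreover have "card U = card (U - W) + card W"
    using card_Diff_subset[OF finite_subset[OF W U] W] card_mono[OF U W] by simp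
  ultimately show ?thesis
    unfolding prb_eq_card[OF U] using U by (simp add: card_Pow power_add power_one_over field_simps)
qed

text \<open>
  The traces of a random subset on \<open>J\<close> and on the complement of \<open>J\<close> are independent.
\<close>

lemma prb_conj_indep:
  assumes U: "finite U"
    and P: "\<And>E. E \<subseteq> U \<Longrightarrow> P E \<longleftrightarrow> P (E \<inter> J)" and Q: "\<And>E. E \<subseteq> U \<Longrightarrow> Q E \<longleftrightarrow> Q (E - J)"
  shows "prb U (\<lambda>E. P E \<and> Q E) = prb U P * prb U Q"
proof -
  define a where "a = card {E \<in> Pow (U \<inter> J). P E}"
  define b where "b = card {E \<in> Pow (U - J). Q E}"
  have count: "card {E \<in> Pow U. P' E \<and> Q' E} = card {E \<in> Pow (U \<inter> J). P' E} * card {E \<in> Pow (U - J). Q' E}"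
    if P': "\<And>E. E \<subseteq> U \<Longrightarrow> P' E \<longleftrightarrow> P' (E \<inter> J)" and Q': "\<And>E. E \<subseteq> U \<Longrightarrow> Q' E \<longleftrightarrow> Q' (E - J)" for P' Q'
  proof -
    have "bij_betw (\<lambda>E. (E \<inter> J, E - J)) {E \<in> Pow U. P' E \<and> Q' E}
        ({E \<in> Pow (U \<inter> J). P' E} \<times> {E \<in> Pow (U - J). Q' E})"
    proof (rule bij_betw_byWitness[where f' = "\<lambda>(X, Y). X \<union> Y"])
      show "(\<lambda>E. (E \<inter> J, E - J)) ` {E \<in> Pow U. P' E \<and> Q' E}
          \<subseteq> {E \<in> Pow (U \<inter> J). P' E} \<times> {E \<in> Pow (U - J). Q' E}"
      proof (rule image_subsetI)
        fix E assume "E \<in> {E \<in> Pow U. P' E \<and> Q' E}"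
        then show "(E \<inter> J, E - J) \<in> {E \<in> Pow (U \<inter> J). P' E} \<times> {E \<in> Pow (U - J). Q' E}"
          using P'[of E] Q'[of E] by auto
      qed
      show "(\<lambda>(X, Y). X \<union> Y) ` ({E \<in> Pow (U \<inter> J). P' E} \<times> {E \<in> Pow (U - J). Q' E})
          \<subseteq> {E \<in> Pow U. P' E \<and> Q' E}"
      proof clarify
        fix X Y assume XY: "X \<subseteq> U \<inter> J" "P' X" "Y \<subseteq> U - J" "Q' Y"
        then have s: "X \<union> Y \<subseteq> U" "(X \<union> Y) \<inter> J = X" "(X \<union> Y) - J = Y" by blast+
        show "X \<union> Y \<in> Pow U \<and> P' (X \<union> Y) \<and> Q' (X \<union> Y)"
          using P'[OF s(1)] Q'[OF s(1)] s XY by simp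
      qed
    qed auto
    then show ?thesis by (simp add: bij_betw_same_card card_cartesian_product)
  qed
  have cU: "card U = card (U \<inter> J) + card (U - J)"
    by (rule card_Int_Diff[OF U])
  have T: "card {E. E \<in> Pow X} = 2 ^ card X" if "finite X" for X :: "'a set"
    using that by (simp only: Collect_mem_eq card_Pow)
  have "card {E \<in> Pow U. P E \<and> Q E} = a * b"
    unfolding a_def b_def by (rule count[of P Q]) (erule P, erule Q)
  moreover have "card {E \<in> Pow U. P E \<and> True} = a * card {E \<in> Pow (U - J). True}"
    unfolding a_def by (rule count[of P "\<lambda>_. True"]) (erule P, simp)
  then have "card {E \<in> Pow U. P E} = a * 2 ^ card (U - J)" using U by (simp only: T finite_Diff simp_thms)
  moreover have "card {E \<in> Pow U. True \<and> Q E} = card {E \<in> Pow (U \<inter> J). True} * b"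
    unfolding b_def by (rule count[of "\<lambda>_. True" Q]) (simp, erule Q)
  then have "card {E \<in> Pow U. Q E} = 2 ^ card (U \<inter> J) * b" using U by (simp only: T finite_Int simp_thms)
  ultimately show ?thesis unfolding prb_eq_card[OF U] cU by (simp add: power_add)
qed

lemma prb_Ball_indep:
  assumes U: "finite U" and I: "finite I"
    and disj: "\<And>i j. i \<in> I \<Longrightarrow> j \<in> I \<Longrightarrow> i \<noteq> j \<Longrightarrow> J i \<inter> J j = {}"
    and P: "\<And>i E. i \<in> I \<Longrightarrow> E \<subseteq> U \<Longrightarrow> P i E \<longleftrightarrow> P i (E \<inter> J i)"
  shows "prb U (\<lambda>E. \<forall>i\<in>I. P i E) = (\<Prod>i\<in>I. prb U (P i))"
  using I disj P
proof (induction I)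
  case empty
  then show ?case by (simp add: prb_def)
next
  case (insert i I)
  have "prb U (\<lambda>E. \<forall>i\<in>insert i I. P i E) = prb U (\<lambda>E. P i E \<and> (\<forall>j\<in>I. P j E))" by simp
  also have "\<dots> = prb U (P i) * prb U (\<lambda>E. \<forall>j\<in>I. P j E)"
  proof (rule prb_conj_indep[OF U, where J = "J i"])
    fix E assume E: "E \<subseteq> U"
    show "P i E \<longleftrightarrow> P i (E \<inter> J i)" using insert.prems(2)[of i E] E by simp
    have "P j E \<longleftrightarrow> P j (E - J i)" if j: "j \<in> I" for j
    proof -
      have "J i \<inter> J j = {}" using insert.prems(1)[of i j] insert.hyps(2) j by auto
      then have "(E - J i) \<inter> J j = E \<inter> J j" by blast
      moreover have "E - J i \<subseteq> U" using E by blast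
      ultimately show ?thesis
        using insert.prems(2)[of j E] insert.prems(2)[of j "E - J i"] E j by simp
    qed
    then show "(\<forall>j\<in>I. P j E) \<longleftrightarrow> (\<forall>j\<in>I. P j (E - J i))" by blast
  qed
  also have "prb U (\<lambda>E. \<forall>j\<in>I. P j E) = (\<Prod>j\<in>I. prb U (P j))"
    using insert by (intro insert.IH) auto
  finally show ?case using insert.hyps by simp
qed

lemma prb_some_block_avoided:
  assumes U: "finite U" and I: "finite I"
    and disj: "\<And>i j. i \<in> I \<Longrightarrow> j \<in> I \<Longrightarrow> i \<noteq> j \<Longrightarrow> W i \<inter> W j = {}"
    and W: "\<And>i. i \<in> I \<Longrightarrow> W i \<subseteq> U"
  shows "prb U (\<lambda>E. \<exists>i\<in>I. W i \<inter> E = {}) = 1 - (\<Prod>i\<in>I. 1 - (1 / 2) ^ card (W i))"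
proof -
  have "prb U (\<lambda>E. \<forall>i\<in>I. W i \<inter> E \<noteq> {}) = (\<Prod>i\<in>I. prb U (\<lambda>E. W i \<inter> E \<noteq> {}))"
    by (rule prb_Ball_indep[OF U I, where J = W]) (use disj in auto)
  also have "\<dots> = (\<Prod>i\<in>I. 1 - (1 / 2) ^ card (W i))"
    using W by (intro prod.cong refl) (simp add: prb_Not prb_avoid[OF U])
  finally have "prb U (\<lambda>E. \<not> (\<exists>i\<in>I. W i \<inter> E = {})) = (\<Prod>i\<in>I. 1 - (1 / 2) ^ card (W i))" by simp
  then show ?thesis unfolding prb_Not by simp
qed

lemma binomial_le_power: "(n choose r) \<le> n ^ r"
  by (cases "r \<le> n") (simp_all add: binomial_le_pow binomial_eq_0)

text \<open>
  A set with \<open>N + 1\<close> elements arises from a set with \<open>N\<close> elements by one insertion.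
\<close>

lemma card_small_subsets_le:
  assumes "finite V" shows "card {X. X \<subseteq> V \<and> card X \<le> N} \<le> (card V + 1) ^ N"
proof (induction N)
  case 0
  have "{X. X \<subseteq> V \<and> card X \<le> 0} = {{}}" using assms by (auto dest: finite_subset)
  then show ?case by simp
next
  case (Suc N)
  let ?F = "{X. X \<subseteq> V \<and> card X \<le> N}"
  have fin: "finite ?F" using assms by simp
  have "{X. X \<subseteq> V \<and> card X \<le> Suc N} \<subseteq> ?F \<union> (\<lambda>(X, v). insert v X) ` (?F \<times> V)"
  proof
    fix X assume X: "X \<in> {X. X \<subseteq> V \<and> card X \<le> Suc N}"
    show "X \<in> ?F \<union> (\<lambda>(X, v). insert v X) ` (?F \<times> V)"
    proof (cases "card X \<le> N")
      case False
      with X obtain v where v: "v \<in> X" by (metis card.empty equals0I le0 mem_Collect_eq)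
      have "finite X" using X assms finite_subset by blast
      then have "(X - {v}, v) \<in> ?F \<times> V" "X = insert v (X - {v})" using X v by auto
      then have "X \<in> (\<lambda>(X, v). insert v X) ` (?F \<times> V)" by (metis (no_types, lifting) case_prod_conv image_eqI)
      then show ?thesis by blast
    qed (use X in auto)
  qed
  then have "card {X. X \<subseteq> V \<and> card X \<le> Suc N} \<le> card (?F \<union> (\<lambda>(X, v). insert v X) ` (?F \<times> V))"
    using fin assms by (intro card_mono) auto
  also have "\<dots> \<le> card ?F + card (?F \<times> V)"
    using card_Un_le[of ?F] card_image_le[of "?F \<times> V" "\<lambda>(X, v). insert v X"] fin assms
    by (meson add_left_mono finite_SigmaI order_trans)
  also have "\<dots> = card ?F * (card V + 1)" by (simp add: card_cartesian_product)
  also have "\<dots> \<le> (card V + 1) ^ N * (card V + 1)" by (rule mult_right_mono[OF Suc.IH]) simp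
  finally show ?case by (simp add: mult.commute)
qed

section \<open>Deleting centres of star-shaped colour classes\<close>

definition ksubsets :: "'a set \<Rightarrow> nat \<Rightarrow> 'a set set" where
  "ksubsets S k = {A. A \<subseteq> S \<and> card A = k}"

lemma finite_ksubsets: "finite S \<Longrightarrow> finite (ksubsets S k)"
  by (simp add: ksubsets_def)

lemma card_ksubsets: "finite S \<Longrightarrow> card (ksubsets S k) = card S choose k"
  by (simp add: ksubsets_def n_subsets)

text \<open>
  A colour all of whose sets pass through \<open>x\<close> disappears when \<open>x\<close> is deleted, so the deletion costs
  one point and gains one colour. The process ends since the colours run out.
\<close>

lemma star_reduction:
  assumes "finite V" "finite C" "card C + m \<le> card V" "\<And>A. A \<in> ksubsets V k \<Longrightarrow> f A \<in> C"
  shows "\<exists>S C'. S \<subseteq> V \<and> C' \<subseteq> C \<and> card C' + m \<le> card S \<and> (\<forall>A\<in>ksubsets S k. f A \<in> C')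
    \<and> (\<forall>i\<in>C'. \<forall>x\<in>S. \<exists>A\<in>ksubsets S k. f A = i \<and> x \<notin> A)"
  using assms
proof (induction "card C" arbitrary: V C)
  case 0
  then show ?case by (intro exI[of _ V] exI[of _ C]) auto
next
  case (Suc c)
  show ?case
  proof (cases "\<forall>i\<in>C. \<forall>x\<in>V. \<exists>A\<in>ksubsets V k. f A = i \<and> x \<notin> A")
    case True
    then show ?thesis using Suc.prems by (intro exI[of _ V] exI[of _ C]) auto
  next
    case False
    then obtain i x where ix: "i \<in> C" "x \<in> V" "\<forall>A\<in>ksubsets V k. f A = i \<longrightarrow> x \<in> A" by blast
    have "\<exists>S C'. S \<subseteq> V - {x} \<and> C' \<subseteq> C - {i} \<and> card C' + m \<le> card S \<and> (\<forall>A\<in>ksubsets S k. f A \<in> C')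
      \<and> (\<forall>i\<in>C'. \<forall>x\<in>S. \<exists>A\<in>ksubsets S k. f A = i \<and> x \<notin> A)"
    proof (rule Suc.hyps(1))
      show "c = card (C - {i})" using Suc.hyps(2) ix(1) Suc.prems(2) by simp
      show "card (C - {i}) + m \<le> card (V - {x})"
        using Suc.prems(1-3) ix(1,2) Suc.hyps(2) by simp
      show "f A \<in> C - {i}" if "A \<in> ksubsets (V - {x}) k" for A
      proof -
        have "A \<in> ksubsets V k" "x \<notin> A" using that by (auto simp: ksubsets_def)
        then show ?thesis using ix(3) Suc.prems(4) by auto
      qed
    qed (use Suc.prems in auto)
    then obtain S C' where "S \<subseteq> V - {x}" "C' \<subseteq> C - {i}" "card C' + m \<le> card S"
      "\<forall>A\<in>ksubsets S k. f A \<in> C'" "\<forall>i\<in>C'. \<forall>x\<in>S. \<exists>A\<in>ksubsets S k. f A = i \<and> x \<notin> A" by blast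
    then show ?thesis by (intro exI[of _ S] exI[of _ C']) blast
  qed
qed

section \<open>Small ground sets\<close>

definition cross :: "'a set \<times> 'a set \<Rightarrow> 'a set set" where
  "cross w = {{A, B} | A B. A \<in> fst w \<and> B \<in> snd w}"

text \<open>
  The traces left by two disjoint \<open>(k + 5)\<close>-sets of the same popular colour: in each of them,
  \<open>s\<close> subsets of size \<open>k\<close> of that colour. Recording only \<open>s\<close> subsets keeps the number of blocks
  small compared with \<open>2 ^ (s\<^sup>2)\<close>.
\<close>

definition mono_blocks :: "'a set \<Rightarrow> nat \<Rightarrow> nat \<Rightarrow> ('a set set \<times> 'a set set) set" where
  "mono_blocks S k s = {(X, Y). \<exists>P Q. P \<in> ksubsets S (k + 5) \<and> Q \<in> ksubsets S (k + 5) \<and> P \<inter> Q = {}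
     \<and> X \<subseteq> ksubsets P k \<and> card X = s \<and> Y \<subseteq> ksubsets Q k \<and> card Y = s}"

lemma card_cross:
  assumes S: "finite S" and k: "0 < k" and w: "w \<in> mono_blocks S k s"
  shows "card (cross w) = s ^ 2"
proof -
  obtain X Y P Q where w_eq: "w = (X, Y)" and PQ: "P \<in> ksubsets S (k + 5)" "Q \<in> ksubsets S (k + 5)"
    "P \<inter> Q = {}" "X \<subseteq> ksubsets P k" "card X = s" "Y \<subseteq> ksubsets Q k" "card Y = s"
    using w unfolding mono_blocks_def by blast
  have "inj_on (\<lambda>(A, B). {A, B}) (X \<times> Y)"
  proof (rule inj_onI, clarify)
    fix A B A' B' assume AB: "A \<in> X" "B \<in> Y" "A' \<in> X" "B' \<in> Y" "{A, B} = {A', B'}"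
    have "A \<noteq> B'"
    proof
      assume "A = B'"
      then have "A \<in> ksubsets P k" "A \<in> ksubsets Q k" using AB(1,4) PQ(4,6) by blast+
      then have "A \<subseteq> P \<inter> Q" "card A = k" by (simp_all add: ksubsets_def)
      then show False using PQ(3) k by simp
    qed
    then show "A = A' \<and> B = B'" using AB(5) by (metis doubleton_eq_iff)
  qed
  moreover have "cross w = (\<lambda>(A, B). {A, B}) ` (X \<times> Y)"
    unfolding cross_def w_eq by auto
  ultimately show ?thesis using PQ by (simp add: card_image card_cartesian_product power2_eq_square)
qed

lemma finite_mono_blocks:
  assumes "finite S" shows "finite (mono_blocks S k s)"
proof (rule finite_subset)
  show "mono_blocks S k s \<subseteq> Pow (Pow S) \<times> Pow (Pow S)"
    unfolding mono_blocks_def ksubsets_def by blast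
qed (use assms in simp)

text \<open>
  The choice of the two \<open>(k + 5)\<close>-sets costs \<open>T ^ (k + 5)\<close> each; after it, a \<open>k\<close>-subset costs only
  \<open>(k + 5) ^ 5\<close> and no power of \<open>T\<close>.
\<close>

lemma card_mono_blocks_le:
  assumes S: "finite S" "card S \<le> T"
  shows "card (mono_blocks S k s) \<le> (T ^ (k + 5) * ((k + 5) ^ 5) ^ s) ^ 2"
proof -
  let ?Z = "\<Union>P\<in>ksubsets S (k + 5). {X. X \<subseteq> ksubsets P k \<and> card X = s}"
  have finP: "finite P" if "P \<in> ksubsets S (k + 5)" for P
    using that S(1) by (auto simp: ksubsets_def intro: finite_subset)
  have finZ: "finite ?Z" using finite_ksubsets[OF S(1)] finite_ksubsets[OF finP] by auto
  have "card ?Z \<le> (\<Sum>P\<in>ksubsets S (k + 5). card {X. X \<subseteq> ksubsets P k \<and> card X = s})"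
    by (rule card_UN_le[OF finite_ksubsets[OF S(1)]])
  also have "\<dots> \<le> (\<Sum>P\<in>ksubsets S (k + 5). ((k + 5) ^ 5) ^ s)"
  proof (rule sum_mono)
    fix P assume P: "P \<in> ksubsets S (k + 5)"
    have "card {X. X \<subseteq> ksubsets P k \<and> card X = s} = card (ksubsets P k) choose s"
      by (rule n_subsets[OF finite_ksubsets[OF finP[OF P]]])
    also have "card (ksubsets P k) = (k + 5) choose k"
      using P by (simp add: card_ksubsets[OF finP[OF P]]) (simp add: ksubsets_def)
    also have "(k + 5) choose k = (k + 5) choose 5" using binomial_symmetric[of k "k + 5"] by simp
    also have "((k + 5) choose 5) choose s \<le> ((k + 5) choose 5) ^ s" by (rule binomial_le_power)
    also have "\<dots> \<le> ((k + 5) ^ 5) ^ s" by (intro power_mono binomial_le_power) simp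
    finally show "card {X. X \<subseteq> ksubsets P k \<and> card X = s} \<le> ((k + 5) ^ 5) ^ s" .
  qed
  also have "\<dots> = card (ksubsets S (k + 5)) * ((k + 5) ^ 5) ^ s" by simp
  also have "card (ksubsets S (k + 5)) \<le> T ^ (k + 5)"
    unfolding card_ksubsets[OF S(1)]
    by (rule order_trans[OF binomial_le_power power_mono[OF S(2)]]) simp
  finally have Z: "card ?Z \<le> T ^ (k + 5) * ((k + 5) ^ 5) ^ s" by simp
  have "card (mono_blocks S k s) \<le> card (?Z \<times> ?Z)"
    using finZ by (intro card_mono) (auto simp: mono_blocks_def)
  also have "\<dots> = card ?Z ^ 2" by (simp add: card_cartesian_product power2_eq_square)
  also have "\<dots> \<le> (T ^ (k + 5) * ((k + 5) ^ 5) ^ s) ^ 2" by (rule power_mono[OF Z]) simp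
  finally show ?thesis .
qed

lemma card_ksubsets_containing_le:
  assumes S: "finite S" and A: "card A = k" "finite A"
  shows "card {P \<in> ksubsets S (k + r). A \<subseteq> P} \<le> card S ^ r"
proof -
  have "card {P \<in> ksubsets S (k + r). A \<subseteq> P} \<le> card (ksubsets S r)"
  proof (rule card_inj_on_le[where f = "\<lambda>P. P - A"])
    show "inj_on (\<lambda>P. P - A) {P \<in> ksubsets S (k + r). A \<subseteq> P}"
      by (rule inj_onI) blast
    show "(\<lambda>P. P - A) ` {P \<in> ksubsets S (k + r). A \<subseteq> P} \<subseteq> ksubsets S r"
      using A by (auto simp: ksubsets_def card_Diff_subset)
  qed (rule finite_ksubsets[OF S])
  also have "\<dots> \<le> card S ^ r" by (simp add: card_ksubsets[OF S] binomial_le_power)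
  finally show ?thesis .
qed

text \<open>
  What a colouring with too few colours leaves behind when its reduced ground set is small. Unlike
  colourings, these configurations are few enough for a union bound.
\<close>

definition low_event :: "nat \<Rightarrow> nat \<Rightarrow> nat \<Rightarrow> nat \<Rightarrow> nat \<Rightarrow> nat set set set \<Rightarrow> bool" where
  "low_event n k T s M E \<longleftrightarrow> (\<exists>S\<in>{S. S \<subseteq> {1..n} \<and> card S \<le> T}.
     \<exists>W\<in>{W. W \<subseteq> mono_blocks S k s \<and> card W = M \<and>
       (\<forall>v\<in>W. \<forall>w\<in>W. v \<noteq> w \<longrightarrow> cross v \<inter> cross w = {})}. (\<Union>w\<in>W. cross w) \<inter> E = {})"

text \<open>
  Every \<open>(k + 5)\<close>-set has a colour shared by \<open>s\<close> of its \<open>k\<close>-subsets, by the pigeonhole principle.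
  Take a maximal edge-disjoint system \<open>W\<close> of blocks from disjoint \<open>(k + 5)\<close>-sets of equal colour,
  and call a \<open>(k + 5)\<close>-set bad if it contains a \<open>k\<close>-set that occurs in \<open>W\<close>. Any further
  monochromatic disjoint pair would share an edge with \<open>W\<close>, which makes both of its
  members bad; so the popular colours are proper on the other sets. If \<open>W\<close> had fewer than \<open>M\<close>
  blocks, the bad sets would be too few to lower the number of colours.
\<close>

lemma colouring_small_ground_set:
  fixes E :: "nat set set set" and f :: "nat set \<Rightarrow> 'c"
  assumes S: "finite S" "card S \<le> T" and C: "finite C" "card C + 2 * k + 11 \<le> card S"
    and f: "\<And>A. A \<in> ksubsets S k \<Longrightarrow> f A \<in> C"
    and indep: "\<And>A B. A \<in> ksubsets S k \<Longrightarrow> B \<in> ksubsets S k \<Longrightarrow> A \<inter> B = {} \<Longrightarrow> f A = f B \<Longrightarrow> {A, B} \<notin> E"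
    and s: "0 < s" "s * T \<le> (k + 5) choose 5"
    and M: "2 * (M * (2 * s * T ^ 5)) ^ 2 < (2 * (k + 5)) choose (k + 5)"
  shows "\<exists>W \<subseteq> mono_blocks S k s. card W = M \<and> (\<forall>v\<in>W. \<forall>w\<in>W. v \<noteq> w \<longrightarrow> cross v \<inter> cross w = {})
     \<and> (\<Union>w\<in>W. cross w) \<inter> E = {}"
proof -
  define K where "K = k + 5"
  have finP: "finite P" if "P \<in> ksubsets S j" for P j
    using that S(1) by (auto simp: ksubsets_def intro: finite_subset)
  have subP: "ksubsets P k \<subseteq> ksubsets S k" if "P \<in> ksubsets S K" for P
    using that by (auto simp: ksubsets_def)
  have "\<exists>i\<in>C. \<exists>X. X \<subseteq> {A \<in> ksubsets P k. f A = i} \<and> card X = s" if P: "P \<in> ksubsets S K" for P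
  proof (rule ccontr)
    assume neg: "\<not> ?thesis"
    have fin: "finite (ksubsets P k)" by (rule finite_ksubsets[OF finP[OF P]])
    have lt: "card {A \<in> ksubsets P k. f A = i} \<le> s - 1" if "i \<in> C" for i
    proof (rule ccontr)
      assume "\<not> ?thesis"
      then have "s \<le> card {A \<in> ksubsets P k. f A = i}" by simp
      from obtain_subset_with_card_n[OF this]
      obtain X where "X \<subseteq> {A \<in> ksubsets P k. f A = i}" "card X = s" by blast
      with neg \<open>i \<in> C\<close> show False by blast
    qed
    have "(k + 5) choose 5 = card (ksubsets P k)"
      using P binomial_symmetric[of k "k + 5"]
      by (simp add: card_ksubsets[OF finP[OF P]]) (simp add: ksubsets_def K_def)
    also have "ksubsets P k = (\<Union>i\<in>C. {A \<in> ksubsets P k. f A = i})"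
      using f subP[OF P] by blast
    also have "card \<dots> \<le> (\<Sum>i\<in>C. card {A \<in> ksubsets P k. f A = i})" by (rule card_UN_le[OF C(1)])
    also have "\<dots> \<le> (\<Sum>i\<in>C. s - 1)" by (rule sum_mono) (rule lt)
    also have "\<dots> = card C * (s - 1)" by simp
    also have "\<dots> \<le> T * (s - 1)" using S C by (intro mult_right_mono) auto
    finally have le: "(k + 5) choose 5 \<le> T * (s - 1)" .
    have "0 < (k + 5) choose 5" by simp
    moreover from this le have "0 < T" by (cases T) auto
    then have "T * (s - 1) < s * T" using s(1) by (simp add: mult.commute[of s])
    ultimately show False using le s(2) by linarith
  qed
  then have "\<forall>P\<in>ksubsets S K. \<exists>p. fst p \<in> C \<and> snd p \<subseteq> {A \<in> ksubsets P k. f A = fst p} \<and> card (snd p) = s"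
    by (metis fst_conv snd_conv)
  from bchoice[OF this] obtain h where h: "\<forall>P\<in>ksubsets S K. fst (h P) \<in> C
      \<and> snd (h P) \<subseteq> {A \<in> ksubsets P k. f A = fst (h P)} \<and> card (snd (h P)) = s" by blast
  define g where "g P = fst (h P)" for P
  define X where "X P = snd (h P)" for P
  have gX: "g P \<in> C" "X P \<subseteq> {A \<in> ksubsets P k. f A = g P}" "card (X P) = s"
    if "P \<in> ksubsets S K" for P
    using bspec[OF h that] by (simp_all add: g_def X_def)
  define BP where "BP = {(P, Q). P \<in> ksubsets S K \<and> Q \<in> ksubsets S K \<and> P \<inter> Q = {} \<and> g P = g Q}"
  define W0 where "W0 = (\<lambda>(P, Q). (X P, X Q)) ` BP"
  have W0_blocks: "W0 \<subseteq> mono_blocks S k s"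
  proof
    fix w assume "w \<in> W0"
    then obtain P Q where PQ: "w = (X P, X Q)" "P \<in> ksubsets S K" "Q \<in> ksubsets S K" "P \<inter> Q = {}"
      by (auto simp: W0_def BP_def)
    have "X P \<subseteq> ksubsets P k" "X Q \<subseteq> ksubsets Q k" using gX(2)[OF PQ(2)] gX(2)[OF PQ(3)] by blast+
    then show "w \<in> mono_blocks S k s"
      using PQ gX(3)[OF PQ(2)] gX(3)[OF PQ(3)] unfolding mono_blocks_def K_def by blast
  qed
  have W0_E: "cross w \<inter> E = {}" if w: "w \<in> W0" for w
  proof -
    obtain P Q where PQ: "w = (X P, X Q)" "P \<in> ksubsets S K" "Q \<in> ksubsets S K" "P \<inter> Q = {}" "g P = g Q"
      using w by (auto simp: W0_def BP_def)
    have "{A, B} \<notin> E" if AB: "A \<in> X P" "B \<in> X Q" for A B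
    proof (rule indep)
      have A: "A \<in> ksubsets P k" "f A = g P" and B: "B \<in> ksubsets Q k" "f B = g Q"
        using AB gX(2)[OF PQ(2)] gX(2)[OF PQ(3)] by blast+
      show "A \<in> ksubsets S k" "B \<in> ksubsets S k"
        using A(1) B(1) subP[OF PQ(2)] subP[OF PQ(3)] by blast+
      show "f A = f B" using A(2) B(2) PQ(5) by simp
      have "A \<subseteq> P" "B \<subseteq> Q" using A(1) B(1) by (simp_all add: ksubsets_def)
      then show "A \<inter> B = {}" using PQ(4) by blast
    qed
    then show ?thesis unfolding cross_def PQ(1) by auto
  qed
  have finW0: "finite W0" by (rule finite_subset[OF W0_blocks finite_mono_blocks[OF S(1)]])
  \<comment> \<open>Edge-disjoint systems of blocks, ordered by inclusion.\<close>
  define Fam where "Fam = {W. W \<subseteq> W0 \<and> (\<forall>v\<in>W. \<forall>w\<in>W. v \<noteq> w \<longrightarrow> cross v \<inter> cross w = {})}"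
  have finFam: "finite Fam" by (rule finite_subset[of _ "Pow W0"]) (use finW0 in \<open>auto simp: Fam_def\<close>)
  have neFam: "Fam \<noteq> {}" unfolding Fam_def by blast
  obtain W where W: "W \<in> Fam" "\<And>V. V \<in> Fam \<Longrightarrow> W \<subseteq> V \<Longrightarrow> W = V"
    using finite_has_maximal[OF finFam neFam] by blast
  have finW: "finite W" using W(1) finW0 by (auto simp: Fam_def intro: finite_subset)
  have "M \<le> card W"
  proof (rule ccontr)
    assume less: "\<not> M \<le> card W"
    define Bad where "Bad = {P \<in> ksubsets S K. \<exists>w\<in>W. \<exists>A\<in>fst w \<union> snd w. A \<subseteq> P}"
    have blk: "finite (fst w \<union> snd w) \<and> card (fst w \<union> snd w) \<le> 2 * s \<and> fst w \<union> snd w \<subseteq> ksubsets S k"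
      if w: "w \<in> W" for w
    proof -
      have "w \<in> W0" using w W(1) by (auto simp: Fam_def)
      then obtain P Q where PQ: "w = (X P, X Q)" "P \<in> ksubsets S K" "Q \<in> ksubsets S K"
        by (auto simp: W0_def BP_def)
      have sub: "X P \<union> X Q \<subseteq> ksubsets S k"
        using gX(2)[OF PQ(2)] gX(2)[OF PQ(3)] subP[OF PQ(2)] subP[OF PQ(3)] by blast
      moreover have "card (X P \<union> X Q) \<le> 2 * s"
        using card_Un_le[of "X P" "X Q"] gX(3) PQ by simp
      ultimately show ?thesis using PQ(1) finite_subset[OF sub finite_ksubsets[OF S(1)]] by simp
    qed
    have "card Bad \<le> card W * (2 * s * T ^ 5)"
    proof -
      have "Bad = (\<Union>w\<in>W. \<Union>A\<in>fst w \<union> snd w. {P \<in> ksubsets S K. A \<subseteq> P})" by (auto simp: Bad_def)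
      also have "card \<dots> \<le> (\<Sum>w\<in>W. card (\<Union>A\<in>fst w \<union> snd w. {P \<in> ksubsets S K. A \<subseteq> P}))"
        by (rule card_UN_le[OF finW])
      also have "\<dots> \<le> (\<Sum>w\<in>W. 2 * s * T ^ 5)"
      proof (rule sum_mono)
        fix w assume w: "w \<in> W"
        have "card (\<Union>A\<in>fst w \<union> snd w. {P \<in> ksubsets S K. A \<subseteq> P})
            \<le> (\<Sum>A\<in>fst w \<union> snd w. card {P \<in> ksubsets S K. A \<subseteq> P})"
          using blk[OF w] by (intro card_UN_le) simp
        also have "\<dots> \<le> (\<Sum>A\<in>fst w \<union> snd w. T ^ 5)"
        proof (rule sum_mono)
          fix A assume "A \<in> fst w \<union> snd w"
          then have A: "A \<in> ksubsets S k" using blk[OF w] by blast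
          have "card {P \<in> ksubsets S K. A \<subseteq> P} \<le> card S ^ 5"
            unfolding K_def by (rule card_ksubsets_containing_le[OF S(1)])
              (use A finP[OF A] in \<open>auto simp: ksubsets_def\<close>)
          also have "\<dots> \<le> T ^ 5" by (rule power_mono[OF S(2)]) simp
          finally show "card {P \<in> ksubsets S K. A \<subseteq> P} \<le> T ^ 5" .
        qed
        also have "\<dots> = card (fst w \<union> snd w) * T ^ 5" by simp
        also have "\<dots> \<le> 2 * s * T ^ 5" using blk[OF w] by (intro mult_right_mono) auto
        finally show "card (\<Union>A\<in>fst w \<union> snd w. {P \<in> ksubsets S K. A \<subseteq> P}) \<le> 2 * s * T ^ 5" .
      qed
      also have "\<dots> = card W * (2 * s * T ^ 5)" by simp
      finally show ?thesis .
    qed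
    also have "\<dots> \<le> M * (2 * s * T ^ 5)" using less by (intro mult_right_mono) auto
    finally have cBad: "card Bad \<le> M * (2 * s * T ^ 5)" .
    have "card S \<le> card C + 2 * K - 1"
    proof (rule kneser_with_few_bad_sets[where col = g, OF S(1) _ C(1)])
      show "0 < K" by (simp add: K_def)
      show "A \<subseteq> S \<and> card A = K" if "A \<in> Bad" for A using that by (auto simp: Bad_def ksubsets_def)
      have "2 * card Bad ^ 2 \<le> 2 * (M * (2 * s * T ^ 5)) ^ 2"
        using cBad by (intro mult_left_mono power_mono) auto
      then show "2 * (card Bad)\<^sup>2 < 2 * K choose K" unfolding K_def using M by (rule le_less_trans)
      show "g P \<in> C" if "P \<subseteq> S" "card P = K" for P
        using gX(1) that by (simp add: ksubsets_def)
      show "g P \<noteq> g Q" if PQ: "P \<subseteq> S" "card P = K" "P \<notin> Bad" "Q \<subseteq> S" "card Q = K" "Q \<notin> Bad"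
        "P \<inter> Q = {}" for P Q
      proof
        assume eq: "g P = g Q"
        have P: "P \<in> ksubsets S K" and Q: "Q \<in> ksubsets S K" using PQ by (auto simp: ksubsets_def)
        define w where "w = (X P, X Q)"
        have w0: "w \<in> W0" using P Q PQ(7) eq by (auto simp: w_def W0_def BP_def)
        have notin: "A \<notin> fst v \<union> snd v" if "v \<in> W" "A \<in> X P" for v A
          using that PQ(3) P gX(2)[OF P] by (auto simp: Bad_def ksubsets_def)
        have disj: "cross v \<inter> cross w = {}" if v: "v \<in> W" for v
        proof (rule ccontr)
          assume "cross v \<inter> cross w \<noteq> {}"
          then obtain e where e: "e \<in> cross v" "e \<in> cross w" by blast
          obtain A B where AB: "e = {A, B}" "A \<in> X P" using e(2) by (auto simp: cross_def w_def)
          obtain A' B' where AB': "e = {A', B'}" "A' \<in> fst v" "B' \<in> snd v"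
            using e(1) by (auto simp: cross_def)
          have "A = A' \<or> A = B'" using AB(1) AB'(1) by (metis doubleton_eq_iff)
          then have "A \<in> fst v \<union> snd v" using AB' by blast
          with notin[OF v AB(2)] show False by blast
        qed
        have "insert w W \<in> Fam"
          using W(1) w0 disj unfolding Fam_def by (auto simp: Int_commute)
        then have "w \<in> W" using W(2)[of "insert w W"] by blast
        moreover obtain A where "A \<in> X P" using gX(3)[OF P] s(1) by fastforce
        ultimately show False using notin[of w A] by (simp add: w_def)
      qed
    qed
    then show False using C(2) by (simp add: K_def)
  qed
  from obtain_subset_with_card_n[OF this] obtain V where V: "V \<subseteq> W" "card V = M" by blast
  have "V \<subseteq> mono_blocks S k s" using V(1) W(1) W0_blocks by (auto simp: Fam_def)
  moreover have "\<forall>v\<in>V. \<forall>w\<in>V. v \<noteq> w \<longrightarrow> cross v \<inter> cross w = {}"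
    using V(1) W(1) unfolding Fam_def by blast
  moreover have "(\<Union>w\<in>V. cross w) \<inter> E = {}"
  proof -
    have "cross w \<inter> E = {}" if "w \<in> V" for w
    proof (rule W0_E)
      show "w \<in> W0" using that V(1) W(1) by (auto simp: Fam_def)
    qed
    then show ?thesis by auto
  qed
  ultimately show ?thesis using V(2) by blast
qed

text \<open>
  Union bound: \<open>(n + 1) ^ T\<close> ground sets, and \<open>M\<close> blocks, whose \<open>M * s\<^sup>2\<close> edges are distinct.
\<close>

lemma prb_low_event_le:
  assumes k: "0 < k"
  shows "prb (kneser_edges n k) (low_event n k T s M)
    \<le> real (n + 1) ^ T * (real ((T ^ (k + 5) * ((k + 5) ^ 5) ^ s) ^ 2) * (1 / 2) ^ (s ^ 2)) ^ M"
proof -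
  let ?U = "kneser_edges n k"
  let ?B = "(T ^ (k + 5) * ((k + 5) ^ 5) ^ s) ^ 2"
  let ?SS = "{S. S \<subseteq> {1..n} \<and> card S \<le> T}"
  let ?WW = "\<lambda>S. {W. W \<subseteq> mono_blocks S k s \<and> card W = M \<and>
       (\<forall>v\<in>W. \<forall>w\<in>W. v \<noteq> w \<longrightarrow> cross v \<inter> cross w = {})}"
  have U: "finite ?U" by (rule finite_kneser_edges)
  have finS: "finite S" if "S \<in> ?SS" for S using that by (auto intro: finite_subset)
  have one: "prb ?U (\<lambda>E. (\<Union>w\<in>W. cross w) \<inter> E = {}) = (1 / 2) ^ (M * s ^ 2)"
    if S: "S \<in> ?SS" and W: "W \<in> ?WW S" for S W
  proof -
    have Wsub: "W \<subseteq> mono_blocks S k s" and Wcard: "card W = M"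
      and Wdisj: "\<forall>v\<in>W. \<forall>w\<in>W. v \<noteq> w \<longrightarrow> cross v \<inter> cross w = {}"
      using W unfolding mem_Collect_eq by blast+
    have fin: "finite W" by (rule finite_subset[OF Wsub finite_mono_blocks[OF finS[OF S]]])
    have "cross w \<subseteq> ?U" if w: "w \<in> W" for w
    proof
      fix e assume "e \<in> cross w"
      then obtain A B where AB: "e = {A, B}" "A \<in> fst w" "B \<in> snd w" by (auto simp: cross_def)
      have "w \<in> mono_blocks S k s" using w Wsub by blast
      then obtain X Y P Q where w_eq: "w = (X, Y)" and PQ0: "P \<in> ksubsets S (k + 5)"
        "Q \<in> ksubsets S (k + 5)" "P \<inter> Q = {}" "X \<subseteq> ksubsets P k" "Y \<subseteq> ksubsets Q k"
        unfolding mono_blocks_def by blast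
      then have PQ: "P \<subseteq> S" "Q \<subseteq> S" "P \<inter> Q = {}" "fst w \<subseteq> ksubsets P k" "snd w \<subseteq> ksubsets Q k"
        by (simp_all add: ksubsets_def)
      have "A \<in> ksubsets P k" "B \<in> ksubsets Q k" using AB(2,3) PQ(4,5) by blast+
      then have A: "A \<subseteq> P" "card A = k" "B \<subseteq> Q" "card B = k" by (simp_all add: ksubsets_def)
      have "A \<in> kneser_verts n k" "B \<in> kneser_verts n k"
        using A PQ(1,2) S by (auto simp: kneser_verts_def)
      moreover have "A \<inter> B = {}" using A PQ by blast
      moreover from this have "A \<noteq> B" using A k by auto
      ultimately show "e \<in> ?U" unfolding kneser_edges_def AB(1) by blast
    qed
    then have sub: "(\<Union>w\<in>W. cross w) \<subseteq> ?U" by blast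
    have "card (\<Union>w\<in>W. cross w) = (\<Sum>w\<in>W. card (cross w))"
    proof (rule card_UN_disjoint[OF fin])
      show "\<forall>w\<in>W. finite (cross w)" using sub finite_subset[OF _ U] by blast
    qed (use Wdisj in blast)
    also have "\<dots> = (\<Sum>w\<in>W. s ^ 2)"
      using Wsub card_cross[OF finS[OF S] k] by (intro sum.cong) auto
    also have "\<dots> = M * s ^ 2" using Wcard by simp
    finally show ?thesis using prb_avoid[OF U sub] by simp
  qed
  have "prb ?U (low_event n k T s M)
      \<le> (\<Sum>S\<in>?SS. prb ?U (\<lambda>E. \<exists>W\<in>?WW S. (\<Union>w\<in>W. cross w) \<inter> E = {}))"
    unfolding low_event_def by (rule prb_Bex_le) simp
  also have "\<dots> \<le> (\<Sum>S\<in>?SS. real ?B ^ M * (1 / 2) ^ (M * s ^ 2))"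
  proof (rule sum_mono)
    fix S assume S: "S \<in> ?SS"
    have finB: "finite (mono_blocks S k s)" by (rule finite_mono_blocks[OF finS[OF S]])
    have finWW: "finite (?WW S)" by (rule finite_subset[of _ "Pow (mono_blocks S k s)"]) (use finB in auto)
    have "prb ?U (\<lambda>E. \<exists>W\<in>?WW S. (\<Union>w\<in>W. cross w) \<inter> E = {})
        \<le> (\<Sum>W\<in>?WW S. prb ?U (\<lambda>E. (\<Union>w\<in>W. cross w) \<inter> E = {}))"
      by (rule prb_Bex_le[OF finWW])
    also have "\<dots> = (\<Sum>W\<in>?WW S. (1 / 2) ^ (M * s ^ 2))"
      by (intro sum.cong refl one[OF S])
    also have "\<dots> = real (card (?WW S)) * (1 / 2) ^ (M * s ^ 2)" by simp
    also have "\<dots> \<le> real ?B ^ M * (1 / 2) ^ (M * s ^ 2)"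
    proof (rule mult_right_mono)
      have "card (?WW S) \<le> card {W. W \<subseteq> mono_blocks S k s \<and> card W = M}"
        using finB by (intro card_mono) auto
      also have "\<dots> = card (mono_blocks S k s) choose M" by (rule n_subsets[OF finB])
      also have "\<dots> \<le> card (mono_blocks S k s) ^ M" by (rule binomial_le_power)
      also have "\<dots> \<le> ?B ^ M"
        using S by (intro power_mono card_mono_blocks_le finS) auto
      finally have "card (?WW S) \<le> ?B ^ M" .
      then show "real (card (?WW S)) \<le> real ?B ^ M"
        by (simp only: of_nat_power[symmetric] of_nat_le_iff)
    qed simp
    finally show "prb ?U (\<lambda>E. \<exists>W\<in>?WW S. (\<Union>w\<in>W. cross w) \<inter> E = {}) \<le> real ?B ^ M * (1 / 2) ^ (M * s ^ 2)" .
  qed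
  also have "\<dots> = real (card ?SS) * (real ?B ^ M * (1 / 2) ^ (M * s ^ 2))" by simp
  also have "\<dots> \<le> real (n + 1) ^ T * (real ?B ^ M * (1 / 2) ^ (M * s ^ 2))"
  proof (rule mult_right_mono)
    have "card ?SS \<le> (n + 1) ^ T" using card_small_subsets_le[of "{1..n}" T] by simp
    then show "real (card ?SS) \<le> real (n + 1) ^ T"
      by (simp only: of_nat_power[symmetric] of_nat_le_iff)
  qed simp
  also have "real ?B ^ M * (1 / 2) ^ (M * s ^ 2) = (real ?B * (1 / 2) ^ (s ^ 2)) ^ M"
    by (simp only: power_mult_distrib power_mult[symmetric] mult.commute[of M])
  finally show ?thesis .
qed

section \<open>Large ground sets\<close>

definition near_centre :: "nat \<Rightarrow> 'a set set \<Rightarrow> 'a \<Rightarrow> bool" where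
  "near_centre D F x \<longleftrightarrow> card {A \<in> F. x \<notin> A} < D"

text \<open>
  The members of \<open>\<G>\<close> that are adjacent to \<open>A\<close> in the Kneser graph.
\<close>

definition misses :: "'a set set \<Rightarrow> 'a set \<Rightarrow> 'a set set" where
  "misses \<G> A = {B \<in> \<G>. A \<inter> B = {}}"

text \<open>
  A set \<open>A\<close> can extend the colour class only if its edges to \<open>misses \<G> A\<close> are absent.
\<close>

definition fingerprint :: "nat \<Rightarrow> 'a \<Rightarrow> 'a set set \<Rightarrow> 'a set set \<Rightarrow> bool" where
  "fingerprint D x0 \<G> \<P> \<longleftrightarrow> (\<forall>A. (\<forall>Z\<in>\<P>. \<not> Z \<subseteq> A)
     \<longrightarrow> misses \<G> A \<noteq> {} \<and> (x0 \<in> A \<or> D \<le> card (misses \<G> A)))"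

text \<open>
  The two alternatives for a colour class: it lies above a few small sets, or it has a fingerprint.
\<close>

definition describes ::
  "'a set \<Rightarrow> nat \<Rightarrow> nat \<Rightarrow> 'a set set \<Rightarrow> 'a \<Rightarrow> 'a set set \<Rightarrow> 'a set set \<Rightarrow> 'a set set \<Rightarrow> bool" where
  "describes S k D F x0 \<G> \<P> \<Y> \<longleftrightarrow> \<G> \<subseteq> F \<and> card \<G> \<le> 3 * k * D ^ 2
     \<and> \<P> \<subseteq> ksubsets S 2 \<and> card \<P> \<le> 2 * k ^ 2 * D ^ 2 \<and> \<Y> \<subseteq> ksubsets S k \<and> card \<Y> \<le> 2 * D
     \<and> ((\<forall>A\<in>F. \<exists>Z\<in>\<P> \<union> \<Y>. Z \<subseteq> A) \<or> (x0 \<in> S \<and> fingerprint D x0 \<G> \<P>))"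

lemma two_centre_container:
  assumes "finite F" "near_centre D F x" "near_centre D F y"
  shows "\<exists>\<Y> \<subseteq> F. card \<Y> \<le> 2 * D \<and> (\<forall>A\<in>F. {x, y} \<subseteq> A \<or> A \<in> \<Y>)"
proof (intro exI[of _ "{A \<in> F. x \<notin> A} \<union> {A \<in> F. y \<notin> A}"] conjI)
  show "card ({A \<in> F. x \<notin> A} \<union> {A \<in> F. y \<notin> A}) \<le> 2 * D"
    using card_Un_le[of "{A \<in> F. x \<notin> A}" "{A \<in> F. y \<notin> A}"] assms(2,3)
    unfolding near_centre_def by linarith
qed auto

text \<open>
  Let only \<open>x0\<close> be a near centre, if any point is. Collect \<open>D\<close> members of \<open>F\<close>, then for every point
  \<open>x \<noteq> x0\<close> that they cover \<open>D\<close> members avoiding \<open>x\<close>, and one member avoiding \<open>x0\<close>. A set \<open>A\<close> that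
  contains \<open>x\<close> and meets a member chosen for \<open>x\<close> contains a pair of points, which is put
  into \<open>\<P>\<close>; so a set \<open>A\<close> that contains no pair from \<open>\<P>\<close> is disjoint from the whole group chosen for
  one of its points, or from the initial group.
\<close>

lemma one_centre_container:
  assumes S: "finite S" "2 \<le> card S" and F: "F \<subseteq> ksubsets S k"
    and nonstar: "\<And>x. x \<in> S \<Longrightarrow> \<exists>A\<in>F. x \<notin> A"
    and x0: "x0 \<in> S" "\<And>x. x \<in> S \<Longrightarrow> x \<noteq> x0 \<Longrightarrow> \<not> near_centre D F x" and D: "0 < D"
  shows "\<exists>\<G> \<P>. \<G> \<subseteq> F \<and> card \<G> \<le> D + k * D * D + 1 \<and> \<P> \<subseteq> ksubsets S 2
    \<and> card \<P> \<le> k * D * (k * D) + k \<and> fingerprint D x0 \<G> \<P>"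
proof -
  have finF: "finite F" by (rule finite_subset[OF F finite_ksubsets[OF S(1)]])
  have cardA: "card A = k" and subA: "A \<subseteq> S" and finA: "finite A" if "A \<in> F" for A
  proof -
    have A: "A \<in> ksubsets S k" using F that by blast
    then show "card A = k" "A \<subseteq> S" by (simp_all add: ksubsets_def)
    then show "finite A" using S(1) finite_subset by blast
  qed
  have card_Union: "card (\<Union>\<G>) \<le> k * D" if "\<G> \<subseteq> F" "card \<G> = D" for \<G>
  proof -
    have "card (\<Union>\<G>) \<le> sum card \<G>" by (rule card_Union_le_sum_card)
    also have "\<dots> = (\<Sum>A\<in>\<G>. k)" using that(1) cardA by (intro sum.cong refl) blast
    finally show ?thesis using that(2) by (simp add: mult.commute)
  qed
  have many: "\<exists>\<G>. \<G> \<subseteq> {A \<in> F. x \<notin> A} \<and> card \<G> = D" if x: "x \<in> S" "x \<noteq> x0" for x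
  proof -
    have "D \<le> card {A \<in> F. x \<notin> A}" using x0(2)[OF x] by (simp add: near_centre_def)
    from obtain_subset_with_card_n[OF this] show ?thesis by blast
  qed
  have "\<exists>x\<in>S. x \<noteq> x0"
  proof (rule ccontr)
    assume "\<not> ?thesis"
    then have "S \<subseteq> {x0}" by blast
    then have "card S \<le> card {x0}" by (rule card_mono[rotated]) simp
    then show False using S(2) by simp
  qed
  then obtain \<G>0 where \<G>0: "\<G>0 \<subseteq> F" "card \<G>0 = D" using many by blast
  define V where "V = \<Union>\<G>0 - {x0}"
  have VS: "V \<subseteq> S" using \<G>0(1) subA by (auto simp: V_def)
  have finV: "finite V" by (rule finite_subset[OF VS S(1)])
  have cV: "card V \<le> k * D"
  proof -
    have "finite (\<Union>\<G>0)" using \<G>0(1) subA by (intro finite_subset[OF _ S(1)]) blast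
    then have "card V \<le> card (\<Union>\<G>0)" unfolding V_def by (intro card_mono) auto
    then show ?thesis using card_Union[OF \<G>0] by linarith
  qed
  have "\<forall>x\<in>V. \<exists>\<G>. \<G> \<subseteq> {A \<in> F. x \<notin> A} \<and> card \<G> = D"
    using many VS by (auto simp: V_def)
  from bchoice[OF this] obtain G where
    G: "\<forall>x\<in>V. G x \<subseteq> {A \<in> F. x \<notin> A} \<and> card (G x) = D" by blast
  \<comment> \<open>The sets through \<open>x0\<close> may meet every other chosen member, but not this one.\<close>
  obtain B where B: "B \<in> F" "x0 \<notin> B" using nonstar[OF x0(1)] by blast
  define \<G> where "\<G> = \<G>0 \<union> (\<Union>x\<in>V. G x) \<union> {B}"
  define \<P> where "\<P> = (\<lambda>(x, z). {x, z}) ` (SIGMA x:V. \<Union>(G x)) \<union> (\<lambda>z. {x0, z}) ` B"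
  have GF: "G x \<subseteq> F" if "x \<in> V" for x using G that by blast
  have \<G>F: "\<G> \<subseteq> F" using \<G>0(1) GF B(1) unfolding \<G>_def by blast
  have fin\<G>: "finite \<G>" by (rule finite_subset[OF \<G>F finF])
  have fin_UG: "finite (\<Union>(G x))" if "x \<in> V" for x
    using GF[OF that] subA by (intro finite_subset[OF _ S(1)]) blast
  have c\<G>: "card \<G> \<le> D + k * D * D + 1"
  proof -
    have "card (\<Union>x\<in>V. G x) \<le> (\<Sum>x\<in>V. card (G x))" by (rule card_UN_le[OF finV])
    also have "\<dots> = (\<Sum>x\<in>V. D)" using G by (intro sum.cong refl) blast
    also have "\<dots> \<le> k * D * D" using cV by simp
    finally have "card (\<Union>x\<in>V. G x) \<le> k * D * D" .
    moreover have "card \<G> \<le> card \<G>0 + card (\<Union>x\<in>V. G x) + card {B}"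
      unfolding \<G>_def using card_Un_le[of "\<G>0 \<union> (\<Union>x\<in>V. G x)" "{B}"] card_Un_le[of \<G>0 "\<Union>x\<in>V. G x"]
      by linarith
    ultimately show ?thesis using \<G>0(2) by simp
  qed
  have c\<P>: "card \<P> \<le> k * D * (k * D) + k"
  proof -
    have "card ((\<lambda>(x, z). {x, z}) ` (SIGMA x:V. \<Union>(G x))) \<le> card (SIGMA x:V. \<Union>(G x))"
      using finV fin_UG by (intro card_image_le finite_SigmaI) auto
    also have "\<dots> = (\<Sum>x\<in>V. card (\<Union>(G x)))" using finV fin_UG by (intro card_SigmaI) auto
    also have "\<dots> \<le> (\<Sum>x\<in>V. k * D)"
    proof (rule sum_mono)
      fix x assume x: "x \<in> V"
      have "card (G x) = D" using G x by blast
      with GF[OF x] show "card (\<Union>(G x)) \<le> k * D" by (rule card_Union)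
    qed
    also have "\<dots> \<le> k * D * (k * D)" using cV by simp
    finally have "card ((\<lambda>(x, z). {x, z}) ` (SIGMA x:V. \<Union>(G x))) \<le> k * D * (k * D)" .
    moreover have "card ((\<lambda>z. {x0, z}) ` B) \<le> k"
      using card_image_le[OF finA[OF B(1)], of "\<lambda>z. {x0, z}"] cardA[OF B(1)] by simp
    ultimately show ?thesis unfolding \<P>_def
      using card_Un_le[of "(\<lambda>(x, z). {x, z}) ` (SIGMA x:V. \<Union>(G x))" "(\<lambda>z. {x0, z}) ` B"] by linarith
  qed
  have pair: "{x, z} \<in> ksubsets S 2" if "x \<in> S" "z \<in> S" "x \<noteq> z" for x z
    using that by (simp add: ksubsets_def)
  have \<P>2: "\<P> \<subseteq> ksubsets S 2"
  proof
    fix Z assume "Z \<in> \<P>"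
    then have "(\<exists>x z. Z = {x, z} \<and> x \<in> V \<and> z \<in> \<Union>(G x)) \<or> (\<exists>z. Z = {x0, z} \<and> z \<in> B)"
      unfolding \<P>_def by auto
    then consider x z where "Z = {x, z}" "x \<in> V" "z \<in> \<Union>(G x)" | z where "Z = {x0, z}" "z \<in> B"
      by blast
    then show "Z \<in> ksubsets S 2"
    proof cases
      case 1
      then obtain A where A: "A \<in> G x" "z \<in> A" by blast
      have "A \<in> F" "x \<notin> A" using A(1) 1(2) G by blast+
      then show ?thesis unfolding 1(1) using A(2) 1(2) VS subA by (intro pair) auto
    next
      case 2
      have "z \<in> S" using 2(2) subA[OF B(1)] by blast
      moreover have "x0 \<noteq> z" using 2(2) B(2) by blast
      ultimately show ?thesis unfolding 2(1) using x0(1) by (intro pair) auto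
    qed
  qed
  have many_misses: "D \<le> card (misses \<G> A)"
    if "\<G>1 \<subseteq> \<G>" "card \<G>1 = D" "\<Union>\<G>1 \<inter> A = {}" for A \<G>1
  proof -
    have "\<G>1 \<subseteq> misses \<G> A" using that(1,3) unfolding misses_def by blast
    then have "card \<G>1 \<le> card (misses \<G> A)"
      using fin\<G> by (intro card_mono) (simp add: misses_def)
    then show ?thesis using that(2) by simp
  qed
  have main: "misses \<G> A \<noteq> {} \<and> (x0 \<in> A \<or> D \<le> card (misses \<G> A))"
    if A: "\<forall>Z\<in>\<P>. \<not> Z \<subseteq> A" for A
  proof (cases "x0 \<in> A")
    case True
    have "A \<inter> B = {}"
    proof (rule ccontr)
      assume "A \<inter> B \<noteq> {}"
      then obtain z where "z \<in> A" "z \<in> B" by blast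
      then have "{x0, z} \<in> \<P>" "{x0, z} \<subseteq> A" using True by (auto simp: \<P>_def)
      then show False using A by blast
    qed
    then have "B \<in> misses \<G> A" by (simp add: misses_def \<G>_def)
    then show ?thesis using True by blast
  next
    case False
    have "D \<le> card (misses \<G> A)"
    proof (cases "\<Union>\<G>0 \<inter> A = {}")
      case True
      show ?thesis by (rule many_misses[OF _ \<G>0(2) True]) (auto simp: \<G>_def)
    next
      case not_disj: False
      then obtain x where x: "x \<in> A" "x \<in> \<Union>\<G>0" by blast
      then have xV: "x \<in> V" using False by (auto simp: V_def)
      have "\<Union>(G x) \<inter> A = {}"
      proof (rule ccontr)
        assume "\<Union>(G x) \<inter> A \<noteq> {}"
        then obtain z where z: "z \<in> \<Union>(G x)" "z \<in> A" by blast
        have "(x, z) \<in> (SIGMA x:V. \<Union>(G x))" using xV z(1) by blast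
        then have "{x, z} \<in> \<P>" unfolding \<P>_def by (intro UnI1 image_eqI[of _ _ "(x, z)"]) auto
        moreover have "{x, z} \<subseteq> A" using x z by blast
        ultimately show False using A by blast
      qed
      moreover have "G x \<subseteq> \<G>" using xV by (auto simp: \<G>_def)
      moreover have "card (G x) = D" using G xV by blast
      ultimately show ?thesis by (intro many_misses)
    qed
    moreover from this have "misses \<G> A \<noteq> {}" using D by auto
    ultimately show ?thesis by blast
  qed
  then have "fingerprint D x0 \<G> \<P>" unfolding fingerprint_def by blast
  then show ?thesis using \<G>F c\<G> \<P>2 c\<P> by blast
qed

text \<open>
  With two near centres \<open>x\<close>, \<open>y\<close> the class lies above \<open>{x, y}\<close> except for a few sets, and it is
  described by the pair and the exceptions; otherwise \<open>one_centre_container\<close> provides a fingerprint.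
\<close>

lemma colour_class_container:
  assumes S: "finite S" "2 \<le> card S" and F: "F \<subseteq> ksubsets S k"
    and nonstar: "\<And>x. x \<in> S \<Longrightarrow> \<exists>A\<in>F. x \<notin> A" and D: "0 < D" and k: "0 < k"
  shows "\<exists>x0 \<G> \<P> \<Y>. describes S k D F x0 \<G> \<P> \<Y>"
proof (cases "\<exists>x y. x \<in> S \<and> y \<in> S \<and> x \<noteq> y \<and> near_centre D F x \<and> near_centre D F y")
  case True
  then obtain x y where xy: "x \<in> S" "y \<in> S" "x \<noteq> y" "near_centre D F x" "near_centre D F y" by blast
  have finF: "finite F" by (rule finite_subset[OF F finite_ksubsets[OF S(1)]])
  obtain \<Y> where \<Y>: "\<Y> \<subseteq> F" "card \<Y> \<le> 2 * D" "\<forall>A\<in>F. {x, y} \<subseteq> A \<or> A \<in> \<Y>"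
    using two_centre_container[OF finF xy(4,5)] by blast
  have "card {{x, y}} \<le> 2 * k ^ 2 * D ^ 2" using k D by (simp add: Suc_le_eq)
  moreover have "{{x, y}} \<subseteq> ksubsets S 2" using xy by (simp add: ksubsets_def)
  moreover have "\<forall>A\<in>F. \<exists>Z\<in>{{x, y}} \<union> \<Y>. Z \<subseteq> A" using \<Y>(3) by blast
  moreover have "\<Y> \<subseteq> ksubsets S k" using \<Y>(1) F by blast
  ultimately have "describes S k D F x {} {{x, y}} \<Y>"
    unfolding describes_def using \<Y>(2) by simp
  then show ?thesis by blast
next
  case False
  have "S \<noteq> {}" using S(2) by auto
  have "\<exists>x0\<in>S. \<forall>x\<in>S. x \<noteq> x0 \<longrightarrow> \<not> near_centre D F x"
  proof (cases "\<exists>x0\<in>S. near_centre D F x0")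
    case True
    with False show ?thesis by blast
  next
    case no: False
    with \<open>S \<noteq> {}\<close> show ?thesis by blast
  qed
  then obtain x0 where x0: "x0 \<in> S" "\<And>x. x \<in> S \<Longrightarrow> x \<noteq> x0 \<Longrightarrow> \<not> near_centre D F x" by blast
  have "\<exists>\<G> \<P>. \<G> \<subseteq> F \<and> card \<G> \<le> D + k * D * D + 1 \<and> \<P> \<subseteq> ksubsets S 2
    \<and> card \<P> \<le> k * D * (k * D) + k \<and> fingerprint D x0 \<G> \<P>"
    by (rule one_centre_container[OF S F nonstar x0 D])
  then obtain \<G> \<P> where G: "\<G> \<subseteq> F" "card \<G> \<le> D + k * D * D + 1" "\<P> \<subseteq> ksubsets S 2"
    "card \<P> \<le> k * D * (k * D) + k" "fingerprint D x0 \<G> \<P>" by blast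
  have "1 \<le> k * D ^ 2" "D \<le> k * D ^ 2" "k * D * D = k * D ^ 2"
    using k D by (simp_all add: Suc_le_eq power2_eq_square)
  then have b1: "card \<G> \<le> 3 * k * D ^ 2" using G(2) by linarith
  have "k \<le> k ^ 2 * D ^ 2" "k * D * (k * D) = k ^ 2 * D ^ 2"
    using k D by (simp_all add: power2_eq_square)
  then have b2: "card \<P> \<le> 2 * k ^ 2 * D ^ 2" using G(4) by linarith
  have "describes S k D F x0 \<G> \<P> {}"
    unfolding describes_def using G(1,3,5) b1 b2 x0(1) by simp
  then show ?thesis by blast
qed

text \<open>
  \<open>\<BB>\<close> consists of the families \<open>\<G>\<close> of the colour classes with a fingerprint, and \<open>\<X>\<close> of all pairs
  and exceptional sets to be avoided. The number \<open>2k\<close> leaves room for the colours whose near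
  centre lies in \<open>A\<close>; there are at most \<open>k\<close> of them on average.
\<close>

definition typical :: "'a set \<Rightarrow> nat \<Rightarrow> nat \<Rightarrow> 'a set set set \<Rightarrow> 'a set set \<Rightarrow> 'a set set" where
  "typical S k D \<BB> \<X> = {A \<in> ksubsets S k. (\<forall>Z\<in>\<X>. \<not> Z \<subseteq> A) \<and> A \<notin> \<Union>\<BB>
     \<and> (\<forall>\<G>\<in>\<BB>. misses \<G> A \<noteq> {}) \<and> card {\<G> \<in> \<BB>. card (misses \<G> A) < D} \<le> 2 * k}"

text \<open>
  The possible choices of \<open>\<BB>\<close>, coming from disjoint colour classes.
\<close>

definition families :: "'a set \<Rightarrow> nat \<Rightarrow> nat \<Rightarrow> 'a set set set set" where
  "families S k D = {\<BB>. \<BB> \<subseteq> {\<G>. \<G> \<subseteq> ksubsets S k \<and> card \<G> \<le> 3 * k * D ^ 2} \<and> card \<BB> \<le> card S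
     \<and> (\<forall>\<G>\<in>\<BB>. \<forall>\<H>\<in>\<BB>. \<G> \<noteq> \<H> \<longrightarrow> \<G> \<inter> \<H> = {})}"

lemma card_ksubsets_above_le:
  assumes S: "finite S" and Z: "Z \<in> ksubsets S j" and j: "j \<le> k"
  shows "card {A \<in> ksubsets S k. Z \<subseteq> A} \<le> (card S - j) choose (k - j)"
proof -
  have Z': "Z \<subseteq> S" "card Z = j" "finite Z" using Z S by (auto simp: ksubsets_def intro: finite_subset)
  have "card {A \<in> ksubsets S k. Z \<subseteq> A} \<le> card (ksubsets (S - Z) (k - j))"
  proof (rule card_inj_on_le[where f = "\<lambda>A. A - Z"])
    show "inj_on (\<lambda>A. A - Z) {A \<in> ksubsets S k. Z \<subseteq> A}" by (rule inj_onI) blast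
    show "(\<lambda>A. A - Z) ` {A \<in> ksubsets S k. Z \<subseteq> A} \<subseteq> ksubsets (S - Z) (k - j)"
      using Z' by (auto simp: ksubsets_def card_Diff_subset)
  qed (simp add: finite_ksubsets S)
  also have "\<dots> = (card S - j) choose (k - j)"
    using Z' S by (simp add: card_ksubsets card_Diff_subset)
  finally show ?thesis .
qed

text \<open>
  Markov's inequality: a random \<open>k\<close>-set contains the centres \<open>x0 i\<close> of at most \<open>k\<close> indices on average.
\<close>

lemma card_heavy_centres_le:
  fixes x0 :: "'i \<Rightarrow> 'a"
  assumes S: "finite S" and I: "finite I" "card I \<le> card S" and x0: "\<And>i. i \<in> I \<Longrightarrow> x0 i \<in> S" and k: "0 < k"
  shows "2 * card {A \<in> ksubsets S k. 2 * k < card {i \<in> I. x0 i \<in> A}} \<le> card S choose k"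
proof -
  let ?H = "{A \<in> ksubsets S k. 2 * k < card {i \<in> I. x0 i \<in> A}}"
  have fin: "finite (ksubsets S k)" by (rule finite_ksubsets[OF S])
  have "card ?H * (2 * k) \<le> (\<Sum>A\<in>?H. card {i \<in> I. x0 i \<in> A})"
    using sum_bounded_below[of ?H "2 * k" "\<lambda>A. card {i \<in> I. x0 i \<in> A}"] by simp
  also have "\<dots> \<le> (\<Sum>A\<in>ksubsets S k. card {i \<in> I. x0 i \<in> A})"
    using fin by (intro sum_mono2) auto
  also have "\<dots> = (\<Sum>A\<in>ksubsets S k. \<Sum>i\<in>I. if x0 i \<in> A then 1 else 0)"
    using I(1) by (simp add: sum.If_cases Int_def)
  also have "\<dots> = (\<Sum>i\<in>I. \<Sum>A\<in>ksubsets S k. if x0 i \<in> A then 1 else 0)" by (rule sum.swap)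
  also have "\<dots> = (\<Sum>i\<in>I. card {A \<in> ksubsets S k. {x0 i} \<subseteq> A})"
    using fin by (simp add: sum.If_cases Int_def)
  also have "\<dots> \<le> (\<Sum>i\<in>I. (card S - 1) choose (k - 1))"
    using x0 k by (intro sum_mono card_ksubsets_above_le[OF S]) (auto simp: ksubsets_def)
  also have "\<dots> \<le> card S * ((card S - 1) choose (k - 1))" using I(2) by simp
  also have "\<dots> = k * (card S choose k)"
    using times_binomial_minus1_eq[OF k, of "card S"] by simp
  finally show ?thesis using k by (simp add: mult.commute mult.left_commute)
qed

text \<open>
  Half of the \<open>k\<close>-sets may contain too many near centres, and a quarter may contain a pair or
  exceptional set, or belong to one of the families; the rest is typical. A class without a
  fingerprint lies above \<open>\<X>\<close>, so the class of a typical set has one, and as the class is independent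
  the set has no edge to the members of its family that it misses.
\<close>

lemma colouring_large_ground_set:
  fixes E :: "'a set set set" and f :: "'a set \<Rightarrow> 'c"
  assumes S: "finite S" "2 \<le> card S" and C: "finite C" "card C \<le> card S" and D: "0 < D" and k: "2 \<le> k"
    and f: "\<And>A. A \<in> ksubsets S k \<Longrightarrow> f A \<in> C"
    and nonstar: "\<And>i x. i \<in> C \<Longrightarrow> x \<in> S \<Longrightarrow> \<exists>A\<in>ksubsets S k. f A = i \<and> x \<notin> A"
    and indep: "\<And>A B. A \<in> ksubsets S k \<Longrightarrow> B \<in> ksubsets S k \<Longrightarrow> A \<inter> B = {} \<Longrightarrow> f A = f B \<Longrightarrow> {A, B} \<notin> E"
    and few: "4 * (card S * (2 * k ^ 2 * D ^ 2) * ((card S - 2) choose (k - 2)) + card S * (2 * D)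
      + card S * (3 * k * D ^ 2)) \<le> card S choose k"
  shows "\<exists>\<BB> \<X>. \<BB> \<in> families S k D \<and> \<X> \<subseteq> Pow S \<and> card \<X> \<le> card S * (2 * k ^ 2 * D ^ 2 + 2 * D)
    \<and> card S choose k \<le> 4 * card (typical S k D \<BB> \<X>)
    \<and> (\<forall>A\<in>typical S k D \<BB> \<X>. \<exists>\<G>\<in>\<BB>. (\<lambda>B. {A, B}) ` misses \<G> A \<inter> E = {})"
proof -
  define F where "F i = {A \<in> ksubsets S k. f A = i}" for i
  have fin: "finite (ksubsets S j)" for j by (rule finite_ksubsets[OF S(1)])
  have "\<forall>i\<in>C. \<exists>p. describes S k D (F i) (fst p) (fst (snd p)) (fst (snd (snd p))) (snd (snd (snd p)))"
  proof
    fix i assume i: "i \<in> C"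
    have "\<exists>x0 \<G> \<P> \<Y>. describes S k D (F i) x0 \<G> \<P> \<Y>"
    proof (rule colour_class_container[OF S _ _ D])
      show "F i \<subseteq> ksubsets S k" by (auto simp: F_def)
      show "\<exists>A\<in>F i. x \<notin> A" if "x \<in> S" for x using nonstar[OF i that] by (auto simp: F_def)
    qed (use k in simp)
    then obtain x0 \<G> \<P> \<Y> where "describes S k D (F i) x0 \<G> \<P> \<Y>" by blast
    then show "\<exists>p. describes S k D (F i) (fst p) (fst (snd p)) (fst (snd (snd p))) (snd (snd (snd p)))"
      by (intro exI[of _ "(x0, \<G>, \<P>, \<Y>)"]) simp
  qed
  from bchoice[OF this] obtain p where p: "\<forall>i\<in>C. describes S k D (F i) (fst (p i))
    (fst (snd (p i))) (fst (snd (snd (p i)))) (snd (snd (snd (p i))))" by blast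
  define x0 where "x0 i = fst (p i)" for i
  define \<G> where "\<G> i = fst (snd (p i))" for i
  define \<P> where "\<P> i = fst (snd (snd (p i)))" for i
  define \<Y> where "\<Y> i = snd (snd (snd (p i)))" for i
  have q: "\<G> i \<subseteq> F i" "card (\<G> i) \<le> 3 * k * D ^ 2" "\<P> i \<subseteq> ksubsets S 2"
    "card (\<P> i) \<le> 2 * k ^ 2 * D ^ 2" "\<Y> i \<subseteq> ksubsets S k" "card (\<Y> i) \<le> 2 * D"
    "(\<forall>A\<in>F i. \<exists>Z\<in>\<P> i \<union> \<Y> i. Z \<subseteq> A) \<or> (x0 i \<in> S \<and> fingerprint D (x0 i) (\<G> i) (\<P> i))"
    if i: "i \<in> C" for i
    using bspec[OF p i] unfolding describes_def x0_def \<G>_def \<P>_def \<Y>_def by (blast+)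
  define C1 where "C1 = {i \<in> C. \<not> (\<forall>A\<in>F i. \<exists>Z\<in>\<P> i \<union> \<Y> i. Z \<subseteq> A)}"
  have C1C: "C1 \<subseteq> C" by (auto simp: C1_def)
  have finC1: "finite C1" by (rule finite_subset[OF C1C C(1)])
  have cC1: "card C1 \<le> card S" using card_mono[OF C(1) C1C] C(2) by linarith
  have r: "x0 i \<in> S" "\<And>A. \<forall>Z\<in>\<P> i. \<not> Z \<subseteq> A \<Longrightarrow> misses (\<G> i) A \<noteq> {} \<and> (x0 i \<in> A \<or> D \<le> card (misses (\<G> i) A))"
    if i: "i \<in> C1" for i
    using q(7)[of i] i unfolding C1_def fingerprint_def by (blast+)
  define \<BB> where "\<BB> = \<G> ` C1"
  define \<X> where "\<X> = (\<Union>i\<in>C. \<P> i) \<union> (\<Union>i\<in>C. \<Y> i)"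
  have FF: "F i \<inter> F j = {}" if "i \<noteq> j" for i j using that by (auto simp: F_def)
  have FS: "F i \<subseteq> ksubsets S k" for i by (auto simp: F_def)
  have fam: "\<BB> \<in> families S k D"
    unfolding families_def mem_Collect_eq
  proof (intro conjI ballI impI)
    show "\<BB> \<subseteq> {\<G>. \<G> \<subseteq> ksubsets S k \<and> card \<G> \<le> 3 * k * D ^ 2}"
    proof
      fix \<H> assume "\<H> \<in> \<BB>"
      then obtain i where i: "i \<in> C" "\<H> = \<G> i" using C1C by (auto simp: \<BB>_def)
      then show "\<H> \<in> {\<G>. \<G> \<subseteq> ksubsets S k \<and> card \<G> \<le> 3 * k * D ^ 2}"
        using q(1,2)[OF i(1)] FS[of i] by simp
    qed
    show "card \<BB> \<le> card S" unfolding \<BB>_def using card_image_le[OF finC1, of \<G>] cC1 by linarith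
    fix \<H> \<H>' assume "\<H> \<in> \<BB>" "\<H>' \<in> \<BB>" "\<H> \<noteq> \<H>'"
    then obtain i j where ij: "i \<in> C" "j \<in> C" "\<H> = \<G> i" "\<H>' = \<G> j" "i \<noteq> j"
      using C1C by (auto simp: \<BB>_def)
    then show "\<H> \<inter> \<H>' = {}" using q(1)[OF ij(1)] q(1)[OF ij(2)] FF[OF ij(5)] by blast
  qed
  have U\<P>: "card (\<Union>i\<in>C. \<P> i) \<le> card S * (2 * k ^ 2 * D ^ 2)"
  proof -
    have "card (\<Union>i\<in>C. \<P> i) \<le> (\<Sum>i\<in>C. card (\<P> i))" by (rule card_UN_le[OF C(1)])
    also have "\<dots> \<le> (\<Sum>i\<in>C. 2 * k ^ 2 * D ^ 2)" by (rule sum_mono) (rule q(4))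
    also have "\<dots> \<le> card S * (2 * k ^ 2 * D ^ 2)" using C(2) by simp
    finally show ?thesis .
  qed
  have U\<Y>: "card (\<Union>i\<in>C. \<Y> i) \<le> card S * (2 * D)"
  proof -
    have "card (\<Union>i\<in>C. \<Y> i) \<le> (\<Sum>i\<in>C. card (\<Y> i))" by (rule card_UN_le[OF C(1)])
    also have "\<dots> \<le> (\<Sum>i\<in>C. 2 * D)" by (rule sum_mono) (rule q(6))
    also have "\<dots> \<le> card S * (2 * D)" using C(2) by simp
    finally show ?thesis .
  qed
  have c\<X>: "card \<X> \<le> card S * (2 * k ^ 2 * D ^ 2 + 2 * D)"
    unfolding \<X>_def distrib_left using card_Un_le[of "\<Union>i\<in>C. \<P> i" "\<Union>i\<in>C. \<Y> i"] U\<P> U\<Y> by linarith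
  have \<X>S: "\<X> \<subseteq> Pow S"
  proof
    fix Z assume "Z \<in> \<X>"
    then obtain i where "i \<in> C" "Z \<in> \<P> i \<or> Z \<in> \<Y> i" by (auto simp: \<X>_def)
    then have "Z \<in> ksubsets S 2 \<or> Z \<in> ksubsets S k" using q(3,5)[of i] by blast
    then show "Z \<in> Pow S" by (auto simp: ksubsets_def)
  qed
  \<comment> \<open>The four reasons for being atypical: too many near centres (\<open>H\<close>), a pair (\<open>N1\<close>), an exceptional set, membership in a family.\<close>
  define H where "H = {A \<in> ksubsets S k. 2 * k < card {i \<in> C1. x0 i \<in> A}}"
  define N1 where "N1 = (\<Union>Z\<in>(\<Union>i\<in>C. \<P> i). {A \<in> ksubsets S k. Z \<subseteq> A})"
  have cH: "2 * card H \<le> card S choose k"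
    unfolding H_def by (rule card_heavy_centres_le[OF S(1) finC1 cC1 r(1)]) (use k in simp_all)
  have P2: "(\<Union>i\<in>C. \<P> i) \<subseteq> ksubsets S 2" using q(3) by blast
  have cN1: "card N1 \<le> card S * (2 * k ^ 2 * D ^ 2) * ((card S - 2) choose (k - 2))"
  proof -
    have "card N1 \<le> (\<Sum>Z\<in>(\<Union>i\<in>C. \<P> i). card {A \<in> ksubsets S k. Z \<subseteq> A})"
      unfolding N1_def by (rule card_UN_le[OF finite_subset[OF P2 fin]])
    also have "\<dots> \<le> (\<Sum>Z\<in>(\<Union>i\<in>C. \<P> i). (card S - 2) choose (k - 2))"
      using P2 k by (intro sum_mono card_ksubsets_above_le[OF S(1)]) blast+
    also have "\<dots> = card (\<Union>i\<in>C. \<P> i) * ((card S - 2) choose (k - 2))" by simp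
    also have "\<dots> \<le> card S * (2 * k ^ 2 * D ^ 2) * ((card S - 2) choose (k - 2))"
      by (rule mult_right_mono[OF U\<P>]) simp
    finally show ?thesis .
  qed
  have cN3: "card (\<Union>\<BB>) \<le> card S * (3 * k * D ^ 2)"
  proof -
    have "card (\<Union>\<BB>) = card (\<Union>i\<in>C1. \<G> i)" by (simp add: \<BB>_def)
    also have "\<dots> \<le> (\<Sum>i\<in>C1. card (\<G> i))" by (rule card_UN_le[OF finC1])
    also have "\<dots> \<le> (\<Sum>i\<in>C1. 3 * k * D ^ 2)" using q(2) C1C by (intro sum_mono) blast
    also have "\<dots> \<le> card S * (3 * k * D ^ 2)" using cC1 by simp
    finally show ?thesis .
  qed
  have cover: "ksubsets S k \<subseteq> typical S k D \<BB> \<X> \<union> H \<union> N1 \<union> (\<Union>i\<in>C. \<Y> i) \<union> \<Union>\<BB>"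
  proof
    fix A assume A: "A \<in> ksubsets S k"
    show "A \<in> typical S k D \<BB> \<X> \<union> H \<union> N1 \<union> (\<Union>i\<in>C. \<Y> i) \<union> \<Union>\<BB>"
    proof (rule ccontr)
      assume neg: "\<not> ?thesis"
      have noP: "\<forall>Z\<in>\<P> i. \<not> Z \<subseteq> A" if i: "i \<in> C" for i
      proof (intro ballI notI)
        fix Z assume "Z \<in> \<P> i" "Z \<subseteq> A"
        then have "A \<in> N1" unfolding N1_def using i A by blast
        with neg show False by blast
      qed
      have noY: "\<forall>Z\<in>\<Y> i. \<not> Z \<subseteq> A" if i: "i \<in> C" for i
      proof (intro ballI notI)
        fix Z assume Z: "Z \<in> \<Y> i" "Z \<subseteq> A"
        have "Z \<in> ksubsets S k" by (rule subsetD[OF q(5)[OF i] Z(1)])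
        moreover have "finite A" using A S(1) by (auto simp: ksubsets_def intro: finite_subset)
        ultimately have "Z = A" using Z(2) A by (intro card_subset_eq) (auto simp: ksubsets_def)
        with Z(1) i neg show False by blast
      qed
      have "\<forall>Z\<in>\<X>. \<not> Z \<subseteq> A" unfolding \<X>_def using noP noY by blast
      moreover have "A \<notin> \<Union>\<BB>" using neg by blast
      moreover have "\<forall>\<H>\<in>\<BB>. misses \<H> A \<noteq> {}"
        unfolding \<BB>_def using r(2) noP C1C by blast
      moreover have "card {\<H> \<in> \<BB>. card (misses \<H> A) < D} \<le> 2 * k"
      proof -
        have "{\<H> \<in> \<BB>. card (misses \<H> A) < D} \<subseteq> \<G> ` {i \<in> C1. x0 i \<in> A}"
        proof
          fix \<H> assume "\<H> \<in> {\<H> \<in> \<BB>. card (misses \<H> A) < D}"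
          then obtain i where i: "i \<in> C1" "\<H> = \<G> i" "card (misses (\<G> i) A) < D"
            by (auto simp: \<BB>_def)
          have "i \<in> C" using i(1) C1C by blast
          then have "x0 i \<in> A" using r(2)[OF i(1) noP] i(3) by force
          then show "\<H> \<in> \<G> ` {i \<in> C1. x0 i \<in> A}" using i(1,2) by blast
        qed
        then have "card {\<H> \<in> \<BB>. card (misses \<H> A) < D} \<le> card (\<G> ` {i \<in> C1. x0 i \<in> A})"
          using finC1 by (intro card_mono) auto
        also have "\<dots> \<le> card {i \<in> C1. x0 i \<in> A}" using finC1 by (intro card_image_le) simp
        also have "\<dots> \<le> 2 * k"
        proof (rule ccontr)
          assume "\<not> ?thesis"
          then have "A \<in> H" using A by (simp add: H_def)
          with neg show False by blast
        qed
        finally show ?thesis .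
      qed
      ultimately have "A \<in> typical S k D \<BB> \<X>" using A by (simp add: typical_def)
      with neg show False by blast
    qed
  qed
  have "card S choose k = card (ksubsets S k)" by (simp add: card_ksubsets S(1))
  also have "\<dots> \<le> card (typical S k D \<BB> \<X> \<union> H \<union> N1 \<union> (\<Union>i\<in>C. \<Y> i) \<union> \<Union>\<BB>)"
  proof (rule card_mono[OF _ cover])
    have "\<Union>\<BB> \<subseteq> ksubsets S k" using fam by (auto simp: families_def)
    moreover have "(\<Union>i\<in>C. \<Y> i) \<subseteq> ksubsets S k" using q(5) by blast
    ultimately have "typical S k D \<BB> \<X> \<union> H \<union> N1 \<union> (\<Union>i\<in>C. \<Y> i) \<union> \<Union>\<BB> \<subseteq> ksubsets S k"
      unfolding typical_def H_def N1_def by blast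
    then show "finite (typical S k D \<BB> \<X> \<union> H \<union> N1 \<union> (\<Union>i\<in>C. \<Y> i) \<union> \<Union>\<BB>)"
      by (rule finite_subset) (rule fin)
  qed
  also have "\<dots> \<le> card (typical S k D \<BB> \<X>) + card H + card N1 + card (\<Union>i\<in>C. \<Y> i) + card (\<Union>\<BB>)"
    by (intro order_trans[OF card_Un_le] add_right_mono order_refl)
  finally have total: "card S choose k
      \<le> card (typical S k D \<BB> \<X>) + card H + card N1 + card (\<Union>i\<in>C. \<Y> i) + card (\<Union>\<BB>)" .
  have "c \<le> 4 * t" if "c \<le> t + h + n1 + y + b" "2 * h \<le> c" "n1 \<le> a1" "y \<le> a2" "b \<le> a3"
    "4 * (a1 + a2 + a3) \<le> c" for c t h n1 y b a1 a2 a3 :: nat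
    using that by simp
  from this[OF total cH cN1 U\<Y> cN3 few]
  have "card S choose k \<le> 4 * card (typical S k D \<BB> \<X>)" .
  moreover have "\<forall>A\<in>typical S k D \<BB> \<X>. \<exists>\<H>\<in>\<BB>. (\<lambda>B. {A, B}) ` misses \<H> A \<inter> E = {}"
  proof
    fix A assume A: "A \<in> typical S k D \<BB> \<X>"
    then have Ak: "A \<in> ksubsets S k" and noZ: "\<forall>Z\<in>\<X>. \<not> Z \<subseteq> A" by (simp_all add: typical_def)
    have i: "f A \<in> C" by (rule f[OF Ak])
    have "A \<in> F (f A)" using Ak by (simp add: F_def)
    moreover have "\<not> (\<exists>Z\<in>\<P> (f A) \<union> \<Y> (f A). Z \<subseteq> A)" using noZ i unfolding \<X>_def by blast
    ultimately have "f A \<in> C1" unfolding C1_def using i by blast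
    then have "\<G> (f A) \<in> \<BB>" by (simp add: \<BB>_def)
    moreover have "(\<lambda>B. {A, B}) ` misses (\<G> (f A)) A \<inter> E = {}"
    proof -
      have "{A, B} \<notin> E" if B: "B \<in> misses (\<G> (f A)) A" for B
      proof -
        have "B \<in> F (f A)" "A \<inter> B = {}" using B q(1)[OF i] by (auto simp: misses_def)
        then show ?thesis using indep[OF Ak, of B] by (simp add: F_def)
      qed
      then show ?thesis by blast
    qed
    ultimately show "\<exists>\<H>\<in>\<BB>. (\<lambda>B. {A, B}) ` misses \<H> A \<inter> E = {}" by blast
  qed
  ultimately show ?thesis using fam \<X>S c\<X> by blast
qed

text \<open>
  Up to \<open>m\<close> of the factors are only known to be at least one half; the others are so close to
  \<open>1\<close> that by Bernoulli's inequality their product is at least one half.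
\<close>

lemma prod_block_bound:
  fixes d :: "'a \<Rightarrow> nat"
  assumes B: "finite B" and pos: "\<And>b. b \<in> B \<Longrightarrow> 1 \<le> d b"
    and low: "card {b \<in> B. d b < D} \<le> m" and D: "2 * card B \<le> 2 ^ D"
  shows "(1 / 2) ^ (m + 1) \<le> (\<Prod>b\<in>B. 1 - (1 / 2 :: real) ^ d b)"
proof -
  define L where "L = {b \<in> B. d b < D}"
  have L: "L \<subseteq> B" "finite L" using B by (auto simp: L_def)
  have le1: "(1 / 2 :: real) ^ j \<le> 1" for j by (simp add: power_le_one)
  have "(1 / 2 :: real) ^ m \<le> (1 / 2) ^ card L"
    using low by (intro power_decreasing) (auto simp: L_def)
  also have "\<dots> = (\<Prod>b\<in>L. 1 / 2)" by simp
  also have "\<dots> \<le> (\<Prod>b\<in>L. 1 - (1 / 2) ^ d b)"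
  proof (rule prod_mono)
    fix b assume "b \<in> L"
    then have "1 \<le> d b" using pos L(1) by blast
    then have "(1 / 2 :: real) ^ d b \<le> (1 / 2) ^ 1" by (intro power_decreasing) auto
    then show "0 \<le> (1 / 2 :: real) \<and> 1 / 2 \<le> 1 - (1 / 2 :: real) ^ d b" by simp
  qed
  finally have 1: "(1 / 2 :: real) ^ m \<le> (\<Prod>b\<in>L. 1 - (1 / 2) ^ d b)" .
  have "(1 / 2 :: real) \<le> 1 + real (card (B - L)) * (- ((1 / 2) ^ D))"
  proof -
    have "card (B - L) \<le> card B" using B by (intro card_mono) auto
    then have "2 * card (B - L) \<le> 2 ^ D" using D by linarith
    then have "real (2 * card (B - L)) \<le> real (2 ^ D)" by (rule of_nat_mono)
    then show ?thesis by (simp add: power_one_over field_simps)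
  qed
  also have "\<dots> \<le> (1 + - ((1 / 2) ^ D)) ^ card (B - L)"
    by (rule Bernoulli_inequality) (simp add: le1)
  also have "\<dots> = (\<Prod>b\<in>B - L. 1 - (1 / 2) ^ D)" by simp
  also have "\<dots> \<le> (\<Prod>b\<in>B - L. 1 - (1 / 2) ^ d b)"
  proof (rule prod_mono)
    fix b assume "b \<in> B - L"
    then have "D \<le> d b" by (auto simp: L_def not_less)
    then have "(1 / 2 :: real) ^ d b \<le> (1 / 2) ^ D" by (intro power_decreasing) auto
    then show "0 \<le> 1 - (1 / 2 :: real) ^ D \<and> 1 - (1 / 2 :: real) ^ D \<le> 1 - (1 / 2) ^ d b"
      using le1[of D] by simp
  qed
  finally have 2: "(1 / 2 :: real) \<le> (\<Prod>b\<in>B - L. 1 - (1 / 2) ^ d b)" .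
  have "(1 / 2 :: real) ^ (m + 1) = (1 / 2) ^ m * (1 / 2)" by simp
  also have "\<dots> \<le> (\<Prod>b\<in>L. 1 - (1 / 2) ^ d b) * (\<Prod>b\<in>B - L. 1 - (1 / 2) ^ d b)"
    by (rule mult_mono[OF 1 2]) (auto intro!: prod_nonneg simp: le1)
  also have "\<dots> = (\<Prod>b\<in>B. 1 - (1 / 2) ^ d b)"
    using prod.subset_diff[OF L(1) B, of "\<lambda>b. 1 - (1 / 2 :: real) ^ d b"] by (simp add: mult.commute)
  finally show ?thesis .
qed

text \<open>
  The families are disjoint, so the edges between a fixed \<open>A\<close> and different families are
  independent. Since \<open>A\<close> is in none of the families, different typical sets see different edges.
\<close>

lemma prb_typical_le:
  assumes S: "S \<subseteq> {1..n}" and k: "0 < k" and \<BB>: "\<BB> \<in> families S k D" and D: "2 * card S \<le> 2 ^ D"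
  shows "prb (kneser_edges n k) (\<lambda>E. \<forall>A\<in>typical S k D \<BB> \<X>. \<exists>\<G>\<in>\<BB>. (\<lambda>B. {A, B}) ` misses \<G> A \<inter> E = {})
    \<le> (1 - (1 / 2) ^ (2 * k + 1)) ^ card (typical S k D \<BB> \<X>)"
proof -
  let ?U = "kneser_edges n k" and ?T = "typical S k D \<BB> \<X>"
  have U: "finite ?U" by (rule finite_kneser_edges)
  have finS: "finite S" by (rule finite_subset[OF S]) simp
  have finK: "finite (ksubsets S k)" by (rule finite_ksubsets[OF finS])
  have finT: "finite ?T" by (rule finite_subset[OF _ finK]) (auto simp: typical_def)
  have \<BB>sub: "\<G> \<subseteq> ksubsets S k" if "\<G> \<in> \<BB>" for \<G> using \<BB> that by (auto simp: families_def)
  have \<BB>card: "card \<BB> \<le> card S" using \<BB> by (simp add: families_def)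
  have \<BB>disj: "\<G> \<inter> \<H> = {}" if "\<G> \<in> \<BB>" "\<H> \<in> \<BB>" "\<G> \<noteq> \<H>" for \<G> \<H>
    using \<BB> that by (simp add: families_def)
  have fin\<BB>: "finite \<BB>"
    by (rule finite_subset[of _ "Pow (ksubsets S k)"]) (use \<BB>sub finK in auto)
  have one: "prb ?U (\<lambda>E. \<exists>\<G>\<in>\<BB>. (\<lambda>B. {A, B}) ` misses \<G> A \<inter> E = {}) \<le> 1 - (1 / 2) ^ (2 * k + 1)"
    if A: "A \<in> ?T" for A
  proof -
    have Ak: "A \<in> ksubsets S k" using A by (simp add: typical_def)
    have finm: "finite (misses \<G> A)" if "\<G> \<in> \<BB>" for \<G>
      by (rule finite_subset[OF _ finK]) (use \<BB>sub[OF that] in \<open>auto simp: misses_def\<close>)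
    have inj: "inj_on (\<lambda>B. {A, B}) X" for X by (auto simp: inj_on_def doubleton_eq_iff)
    have cardW: "card ((\<lambda>B. {A, B}) ` misses \<G> A) = card (misses \<G> A)" for \<G>
      by (rule card_image[OF inj])
    have "prb ?U (\<lambda>E. \<exists>\<G>\<in>\<BB>. (\<lambda>B. {A, B}) ` misses \<G> A \<inter> E = {})
        = 1 - (\<Prod>\<G>\<in>\<BB>. 1 - (1 / 2) ^ card ((\<lambda>B. {A, B}) ` misses \<G> A))"
    proof (rule prb_some_block_avoided[OF U fin\<BB>])
      fix \<G> \<H> assume gh: "\<G> \<in> \<BB>" "\<H> \<in> \<BB>" "\<G> \<noteq> \<H>"
      have "misses \<G> A \<inter> misses \<H> A = {}" using \<BB>disj[OF gh] by (auto simp: misses_def)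
      then show "(\<lambda>B. {A, B}) ` misses \<G> A \<inter> (\<lambda>B. {A, B}) ` misses \<H> A = {}"
        using inj_on_image_Int[OF inj[of UNIV], of "misses \<G> A" "misses \<H> A"] by simp
    next
      fix \<G> assume g: "\<G> \<in> \<BB>"
      show "(\<lambda>B. {A, B}) ` misses \<G> A \<subseteq> ?U"
      proof (rule image_subsetI)
        fix B assume "B \<in> misses \<G> A"
        then have B: "B \<in> ksubsets S k" "A \<inter> B = {}" using \<BB>sub[OF g] by (auto simp: misses_def)
        have "A \<noteq> {}" using Ak k by (auto simp: ksubsets_def)
        then have "A \<noteq> B" using B(2) by blast
        moreover have "A \<in> kneser_verts n k" "B \<in> kneser_verts n k"
          using Ak B(1) S by (auto simp: ksubsets_def kneser_verts_def)
        ultimately show "{A, B} \<in> ?U" unfolding kneser_edges_def using B(2) by blast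
      qed
    qed
    also have "\<dots> = 1 - (\<Prod>\<G>\<in>\<BB>. 1 - (1 / 2) ^ card (misses \<G> A))" by (simp only: cardW)
    also have "\<dots> \<le> 1 - (1 / 2) ^ (2 * k + 1)"
    proof -
      have "(1 / 2) ^ (2 * k + 1) \<le> (\<Prod>\<G>\<in>\<BB>. 1 - (1 / 2 :: real) ^ card (misses \<G> A))"
      proof (rule prod_block_bound[OF fin\<BB>])
        show "1 \<le> card (misses \<G> A)" if "\<G> \<in> \<BB>" for \<G>
          using A that finm[OF that] by (auto simp: typical_def Suc_le_eq card_gt_0_iff)
        show "card {\<G> \<in> \<BB>. card (misses \<G> A) < D} \<le> 2 * k" using A by (simp add: typical_def)
        show "2 * card \<BB> \<le> 2 ^ D" using \<BB>card D by linarith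
      qed
      then show ?thesis by linarith
    qed
    finally show ?thesis .
  qed
  have "prb ?U (\<lambda>E. \<forall>A\<in>?T. \<exists>\<G>\<in>\<BB>. (\<lambda>B. {A, B}) ` misses \<G> A \<inter> E = {})
      = (\<Prod>A\<in>?T. prb ?U (\<lambda>E. \<exists>\<G>\<in>\<BB>. (\<lambda>B. {A, B}) ` misses \<G> A \<inter> E = {}))"
  proof (rule prb_Ball_indep[OF U finT, where J = "\<lambda>A. (\<lambda>B. {A, B}) ` \<Union>\<BB>"])
    fix A A' assume AA: "A \<in> ?T" "A' \<in> ?T" "A \<noteq> A'"
    have notin: "X \<notin> \<Union>\<BB>" if "X \<in> ?T" for X
      using that unfolding typical_def mem_Collect_eq by (elim conjE)
    show "(\<lambda>B. {A, B}) ` \<Union>\<BB> \<inter> (\<lambda>B. {A', B}) ` \<Union>\<BB> = {}"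
    proof (intro equals0I, elim IntE imageE)
      fix e B B' assume e: "e = {A, B}" "e = {A', B'}" "B \<in> \<Union>\<BB>" "B' \<in> \<Union>\<BB>"
      have "{A, B} = {A', B'}" using e(1,2) by (rule subst)
      then have "A = B'" using AA(3) unfolding doubleton_eq_iff by (elim disjE conjE) simp_all
      with e(4) notin[OF AA(1)] show False by (simp only: simp_thms)
    qed
  next
    fix A E
    have sub: "(\<lambda>B. {A, B}) ` misses \<G> A \<subseteq> (\<lambda>B. {A, B}) ` \<Union>\<BB>" if "\<G> \<in> \<BB>" for \<G>
      using that by (intro image_mono) (auto simp: misses_def)
    have int: "W \<inter> E = {} \<longleftrightarrow> W \<inter> (E \<inter> J) = {}" if "W \<subseteq> J" for W J :: "nat set set set"
      using that by blast
    show "(\<exists>\<G>\<in>\<BB>. (\<lambda>B. {A, B}) ` misses \<G> A \<inter> E = {})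
        \<longleftrightarrow> (\<exists>\<G>\<in>\<BB>. (\<lambda>B. {A, B}) ` misses \<G> A \<inter> (E \<inter> (\<lambda>B. {A, B}) ` \<Union>\<BB>) = {})"
      using int[OF sub] by (intro bex_cong refl)
  qed
  also have "\<dots> \<le> (\<Prod>A\<in>?T. 1 - (1 / 2) ^ (2 * k + 1))"
    by (rule prod_mono) (use one in auto)
  finally show ?thesis by simp
qed

text \<open>
  What a colouring with too few colours leaves behind when its reduced ground set is large: each
  typical set could still be coloured on its own, which happens independently for different sets.
  The parameter \<open>D\<close> may depend on the size of the ground set.
\<close>

definition high_event :: "nat \<Rightarrow> nat \<Rightarrow> nat \<Rightarrow> (nat \<Rightarrow> nat) \<Rightarrow> nat set set set \<Rightarrow> bool" where
  "high_event n k T D E \<longleftrightarrow> (\<exists>S\<in>{S. S \<subseteq> {1..n} \<and> T < card S}. \<exists>\<BB>\<in>families S k (D (card S)).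
     \<exists>\<X>\<in>{\<X>. \<X> \<subseteq> Pow S \<and> card \<X> \<le> card S * (2 * k ^ 2 * D (card S) ^ 2 + 2 * D (card S))
       \<and> card S choose k \<le> 4 * card (typical S k (D (card S)) \<BB> \<X>)}.
     \<forall>A\<in>typical S k (D (card S)) \<BB> \<X>. \<exists>\<G>\<in>\<BB>. (\<lambda>B. {A, B}) ` misses \<G> A \<inter> E = {})"

text \<open>
  A bound for the number of pairs \<open>(\<BB>, \<X>)\<close> on a ground set of size \<open>y\<close>; every set of points is
  counted as one of \<open>2 ^ y\<close> subsets.
\<close>

definition data_count :: "nat \<Rightarrow> nat \<Rightarrow> nat \<Rightarrow> nat" where
  "data_count y k d = ((2 ^ y + 1) ^ (3 * k * d ^ 2) + 1) ^ y * (2 ^ y + 1) ^ (y * (2 * k ^ 2 * d ^ 2 + 2 * d))"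

lemma card_families_le:
  assumes S: "finite S"
  shows "finite (families S k D)"
    and "card (families S k D) \<le> ((2 ^ card S + 1) ^ (3 * k * D ^ 2) + 1) ^ card S"
proof -
  let ?V = "{\<G>. \<G> \<subseteq> ksubsets S k \<and> card \<G> \<le> 3 * k * D ^ 2}"
  have finK: "finite (ksubsets S k)" by (rule finite_ksubsets[OF S])
  have finV: "finite ?V" by (rule finite_subset[of _ "Pow (ksubsets S k)"]) (use finK in auto)
  have "card (ksubsets S k) \<le> card (Pow S)"
    using S by (intro card_mono) (auto simp: ksubsets_def)
  then have "card (ksubsets S k) + 1 \<le> 2 ^ card S + 1" using S by (simp add: card_Pow)
  then have "(card (ksubsets S k) + 1) ^ (3 * k * D ^ 2) \<le> (2 ^ card S + 1) ^ (3 * k * D ^ 2)"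
    by (rule power_mono) simp
  then have V: "card ?V + 1 \<le> (2 ^ card S + 1) ^ (3 * k * D ^ 2) + 1"
    using card_small_subsets_le[OF finK, of "3 * k * D ^ 2"] by linarith
  have sub: "families S k D \<subseteq> {\<BB>. \<BB> \<subseteq> ?V \<and> card \<BB> \<le> card S}" by (auto simp: families_def)
  have finVV: "finite {\<BB>. \<BB> \<subseteq> ?V \<and> card \<BB> \<le> card S}"
    by (rule finite_subset[of _ "Pow ?V"]) (use finV in auto)
  show "finite (families S k D)" by (rule finite_subset[OF sub finVV])
  have "card (families S k D) \<le> card {\<BB>. \<BB> \<subseteq> ?V \<and> card \<BB> \<le> card S}" by (rule card_mono[OF finVV sub])
  also have "\<dots> \<le> (card ?V + 1) ^ card S" by (rule card_small_subsets_le[OF finV])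
  also have "\<dots> \<le> ((2 ^ card S + 1) ^ (3 * k * D ^ 2) + 1) ^ card S" by (rule power_mono[OF V]) simp
  finally show "card (families S k D) \<le> ((2 ^ card S + 1) ^ (3 * k * D ^ 2) + 1) ^ card S" .
qed

text \<open>
  The bound \<open>n ^ (- y - 2)\<close> per ground set absorbs the \<open>n choose y\<close> ground sets of size \<open>y\<close> and
  leaves \<open>1 / n\<^sup>2\<close> for each size.
\<close>

lemma prb_high_event_le:
  assumes k: "0 < k" and n: "0 < n"
    and D: "\<And>y. T < y \<Longrightarrow> y \<le> n \<Longrightarrow> 2 * y \<le> 2 ^ D y"
    and small: "\<And>y. T < y \<Longrightarrow> y \<le> n \<Longrightarrow>
      real (data_count y k (D y)) * (1 - (1 / 2) ^ (2 * k + 1)) ^ ((y choose k) div 4) \<le> (1 / real n) ^ (y + 2)"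
  shows "prb (kneser_edges n k) (high_event n k T D) \<le> (real n + 1) / real n ^ 2"
proof -
  let ?U = "kneser_edges n k"
  let ?SS = "{S. S \<subseteq> {1..n} \<and> T < card S}"
  let ?XX = "\<lambda>S \<BB>. {\<X>. \<X> \<subseteq> Pow S \<and> card \<X> \<le> card S * (2 * k ^ 2 * D (card S) ^ 2 + 2 * D (card S))
       \<and> card S choose k \<le> 4 * card (typical S k (D (card S)) \<BB> \<X>)}"
  let ?P = "\<lambda>S \<BB> \<X> E. \<forall>A\<in>typical S k (D (card S)) \<BB> \<X>. \<exists>\<G>\<in>\<BB>. (\<lambda>B. {A, B}) ` misses \<G> A \<inter> E = {}"
  let ?q = "1 - (1 / 2 :: real) ^ (2 * k + 1)"
  have q: "0 \<le> ?q" "?q \<le> 1"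
  proof -
    have "(1 / 2 :: real) ^ (2 * k + 1) \<le> 1" by (rule power_le_one) auto
    then show "0 \<le> ?q" by linarith
    have "0 \<le> (1 / 2 :: real) ^ (2 * k + 1)" by (rule zero_le_power) simp
    then show "?q \<le> 1" by linarith
  qed
  have div4: "c div 4 \<le> t" if "c \<le> 4 * t" for c t :: nat using that by linarith
  have finSS: "finite ?SS" by (rule finite_subset[of _ "Pow {1..n}"]) auto
  have SS: "finite S" "card S \<le> n" "T < card S" "S \<subseteq> {1..n}" if "S \<in> ?SS" for S
    using that card_mono[of "{1..n}" S] by (auto intro: finite_subset)
  have one: "prb ?U (\<lambda>E. \<exists>\<BB>\<in>families S k (D (card S)). \<exists>\<X>\<in>?XX S \<BB>. ?P S \<BB> \<X> E) \<le> (1 / real n) ^ (card S + 2)"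
    if S: "S \<in> ?SS" for S
  proof -
    let ?d = "D (card S)"
    let ?c = "?q ^ ((card S choose k) div 4)"
    let ?x = "(2 ^ card S + 1) ^ (card S * (2 * k ^ 2 * ?d ^ 2 + 2 * ?d)) :: nat"
    have finP: "finite (Pow S)" using SS(1)[OF S] by simp
    have c0: "0 \<le> ?c" by (rule zero_le_power[OF q(1)])
    have inner: "prb ?U (\<lambda>E. \<exists>\<X>\<in>?XX S \<BB>. ?P S \<BB> \<X> E) \<le> real ?x * ?c"
      if B: "\<BB> \<in> families S k ?d" for \<BB>
    proof -
      have finX: "finite (?XX S \<BB>)" by (rule finite_subset[of _ "Pow (Pow S)"]) (use finP in auto)
      have "prb ?U (\<lambda>E. \<exists>\<X>\<in>?XX S \<BB>. ?P S \<BB> \<X> E) \<le> (\<Sum>\<X>\<in>?XX S \<BB>. prb ?U (?P S \<BB> \<X>))"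
        by (rule prb_Bex_le[OF finX])
      also have "\<dots> \<le> (\<Sum>\<X>\<in>?XX S \<BB>. ?c)"
      proof (rule sum_mono)
        fix \<X> assume "\<X> \<in> ?XX S \<BB>"
        then have "card S choose k \<le> 4 * card (typical S k ?d \<BB> \<X>)" by blast
        then have le: "(card S choose k) div 4 \<le> card (typical S k ?d \<BB> \<X>)" by (rule div4)
        have "prb ?U (?P S \<BB> \<X>) \<le> ?q ^ card (typical S k ?d \<BB> \<X>)"
          by (rule prb_typical_le[OF SS(4)[OF S] k B D[OF SS(3)[OF S] SS(2)[OF S]]])
        also have "\<dots> \<le> ?c" by (rule power_decreasing[OF le q])
        finally show "prb ?U (?P S \<BB> \<X>) \<le> ?c" .
      qed
      also have "\<dots> = real (card (?XX S \<BB>)) * ?c" by simp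
      also have "\<dots> \<le> real ?x * ?c"
      proof (rule mult_right_mono)
        have "card (?XX S \<BB>) \<le> card {\<X>. \<X> \<subseteq> Pow S \<and> card \<X> \<le> card S * (2 * k ^ 2 * ?d ^ 2 + 2 * ?d)}"
        proof (rule card_mono)
          show "finite {\<X>. \<X> \<subseteq> Pow S \<and> card \<X> \<le> card S * (2 * k ^ 2 * ?d ^ 2 + 2 * ?d)}"
            by (rule finite_subset[of _ "Pow (Pow S)"]) (use finP in auto)
        qed auto
        also have "\<dots> \<le> ?x" using card_small_subsets_le[OF finP] SS(1)[OF S] by (simp add: card_Pow)
        finally show "real (card (?XX S \<BB>)) \<le> real ?x" by (rule of_nat_mono)
      qed (rule c0)
      finally show ?thesis .
    qed
    have "prb ?U (\<lambda>E. \<exists>\<BB>\<in>families S k ?d. \<exists>\<X>\<in>?XX S \<BB>. ?P S \<BB> \<X> E)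
        \<le> (\<Sum>\<BB>\<in>families S k ?d. prb ?U (\<lambda>E. \<exists>\<X>\<in>?XX S \<BB>. ?P S \<BB> \<X> E))"
      by (rule prb_Bex_le[OF card_families_le(1)[OF SS(1)[OF S]]])
    also have "\<dots> \<le> (\<Sum>\<BB>\<in>families S k ?d. real ?x * ?c)" by (rule sum_mono) (rule inner)
    also have "\<dots> = real (card (families S k ?d)) * (real ?x * ?c)" by simp
    also have "\<dots> \<le> real (((2 ^ card S + 1) ^ (3 * k * ?d ^ 2) + 1) ^ card S) * (real ?x * ?c)"
      by (intro mult_right_mono of_nat_mono card_families_le(2)[OF SS(1)[OF S]]
          mult_nonneg_nonneg c0 of_nat_0_le_iff)
    also have "\<dots> = real (data_count (card S) k ?d) * ?c"
      unfolding data_count_def of_nat_mult by (simp only: mult.assoc)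
    also have "\<dots> \<le> (1 / real n) ^ (card S + 2)" by (rule small[OF SS(3)[OF S] SS(2)[OF S]])
    finally show ?thesis .
  qed
  have "prb ?U (high_event n k T D)
      \<le> (\<Sum>S\<in>?SS. prb ?U (\<lambda>E. \<exists>\<BB>\<in>families S k (D (card S)). \<exists>\<X>\<in>?XX S \<BB>. ?P S \<BB> \<X> E))"
    unfolding high_event_def by (rule prb_Bex_le[OF finSS])
  also have "\<dots> \<le> (\<Sum>S\<in>?SS. (1 / real n) ^ (card S + 2))" by (rule sum_mono) (rule one)
  also have "\<dots> \<le> (\<Sum>S\<in>Pow {1..n}. (1 / real n) ^ (card S + 2))"
    by (rule sum_mono2) auto
  also have "\<dots> = (\<Sum>y\<in>{..n}. \<Sum>S\<in>{S \<in> Pow {1..n}. card S = y}. (1 / real n) ^ (card S + 2))"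
  proof (rule sum.group[symmetric])
    show "card ` Pow {1..n} \<subseteq> {..n}"
      using card_mono[of "{1..n}"] by (auto simp: image_subset_iff)
  qed auto
  also have "\<dots> = (\<Sum>y\<in>{..n}. real (n choose y) * (1 / real n) ^ (y + 2))"
  proof (rule sum.cong[OF refl])
    fix y
    have "{S \<in> Pow {1..n}. card S = y} = {S. S \<subseteq> {1..n} \<and> card S = y}" by blast
    then have "card {S \<in> Pow {1..n}. card S = y} = n choose y" using n_subsets[of "{1..n}" y] by simp
    then show "(\<Sum>S\<in>{S \<in> Pow {1..n}. card S = y}. (1 / real n) ^ (card S + 2))
        = real (n choose y) * (1 / real n) ^ (y + 2)" by simp
  qed
  also have "\<dots> \<le> (\<Sum>y\<in>{..n}. 1 / real n ^ 2)"
  proof (rule sum_mono)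
    fix y
    have "real (n choose y) \<le> real n ^ y"
      using binomial_le_power[of n y] by (simp only: of_nat_power[symmetric] of_nat_le_iff)
    then have "real (n choose y) * (1 / real n) ^ (y + 2) \<le> real n ^ y * (1 / real n) ^ (y + 2)"
      by (rule mult_right_mono) simp
    also have "\<dots> = 1 / real n ^ 2" using n by (simp add: power_add power_one_over power2_eq_square)
    finally show "real (n choose y) * (1 / real n) ^ (y + 2) \<le> 1 / real n ^ 2" .
  qed
  also have "\<dots> = (real n + 1) / real n ^ 2" by simp
  finally show ?thesis .
qed

section \<open>Choice of parameters\<close>

lemma real_divide_minus_div_le: "real a / real b - real (a div b) \<le> 1"
proof (cases "b = 0")
  case False
  then have "real (a mod b) / real b \<le> 1" by (simp add: pos_divide_le_eq less_imp_le)
  then show ?thesis using of_nat_of_nat_div_aux[of a b, where 'a = real] by linarith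
qed simp

lemma half_power_eq_powr: "(1 / 2 :: real) ^ m = 2 powr (- real m)"
  by (simp only: powr_minus powr_realpow[OF zero_less_numeral] power_one_over inverse_eq_divide)

text \<open>
  The exponent \<open>17/4\<close> lies strictly between \<open>4\<close>, below which the pairs of points avoided by typical
  sets would become too frequent, and \<open>9/2\<close>, above which the popularity \<open>(k + 5 choose 5) / T\<close>
  would drop below the square root of \<open>k\<close>, as needed against the \<open>k ^ O(k)\<close> choices for a block.
\<close>

definition size_threshold :: "nat \<Rightarrow> nat" where
  "size_threshold k = nat \<lfloor>real k powr (17 / 4)\<rfloor>"

definition popularity :: "nat \<Rightarrow> nat" where
  "popularity k = ((k + 5) choose 5) div size_threshold k"

text \<open>
  The polynomial factor is generous; any fixed power would do that makes the number of bad sets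
  smaller than \<open>2 ^ k\<close>.
\<close>

definition block_count :: "nat \<Rightarrow> nat" where
  "block_count k = 2 ^ k div k ^ 27"

definition miss_count :: "nat \<Rightarrow> nat" where
  "miss_count y = nat \<lceil>log 2 (2 * real y)\<rceil>"

lemma size_threshold_le:
  assumes "1 \<le> k"
  shows "real (size_threshold k) \<le> real k powr (17 / 4)" and "size_threshold k \<le> k ^ 5"
    and "1 \<le> size_threshold k"
proof -
  have k1: "1 \<le> real k" using assms by simp
  have ge1: "1 \<le> real k powr (17 / 4)" by (rule ge_one_powr_ge_zero[OF k1]) simp
  show le: "real (size_threshold k) \<le> real k powr (17 / 4)"
    unfolding size_threshold_def using ge1 by simp
  have "real k powr (17 / 4) \<le> real k powr 5" using k1 by (intro powr_mono) auto
  also have "real k powr 5 = real (k ^ 5)" using k1 by simp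
  finally have "real (size_threshold k) \<le> real (k ^ 5)" using le by linarith
  then show "size_threshold k \<le> k ^ 5" by (simp only: of_nat_le_iff)
  have "1 \<le> \<lfloor>real k powr (17 / 4)\<rfloor>" using ge1 by simp
  then show "1 \<le> size_threshold k" unfolding size_threshold_def by linarith
qed

lemma popularity_ge:
  assumes "1 \<le> k" shows "real k powr (3 / 4) / 3125 - 1 \<le> real (popularity k)"
proof -
  note T = size_threshold_le[OF assms]
  have k0: "0 < real k" using assms by simp
  have "real k powr (3 / 4) = real k powr 5 / real k powr (17 / 4)"
    by (subst powr_diff[symmetric]) simp
  then have "real k powr (3 / 4) / 3125 = (real k powr 5 / 3125) / real k powr (17 / 4)"
    by simp
  also have "\<dots> = (real k / 5) ^ 5 / real k powr (17 / 4)" using k0 by (simp add: power_divide)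
  also have "\<dots> \<le> (real k / 5) ^ 5 / real (size_threshold k)"
    using T(1,3) k0 by (intro divide_left_mono mult_pos_pos) auto
  also have "\<dots> \<le> real ((k + 5) choose 5) / real (size_threshold k)"
  proof (rule divide_right_mono)
    \<comment> \<open>The constant \<open>3125\<close> is \<open>5 ^ 5\<close>.\<close>
    have "(real k / 5) ^ 5 \<le> (real (k + 5) / real 5) ^ 5" by (intro power_mono) auto
    also have "\<dots> \<le> real ((k + 5) choose 5)" by (rule binomial_ge_n_over_k_pow_k) simp
    finally show "(real k / 5) ^ 5 \<le> real ((k + 5) choose 5)" .
  qed simp
  finally show ?thesis
    unfolding popularity_def
    using real_divide_minus_div_le[of "(k + 5) choose 5" "size_threshold k"] by linarith
qed

text \<open>
  The binary logarithm of the number of blocks is at most \<open>10 (k + 5 + s) log (k + 5)\<close>, which is less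
  than \<open>s\<^sup>2\<close> once \<open>s\<close> exceeds \<open>sqrt k\<close> by a logarithmic factor.
\<close>

lemma popularity_block_bound:
  assumes k: "1 \<le> k"
    and F1: "20 * log 2 (real k + 5) \<le> real k powr (3 / 4) / 3125 - 1"
    and F2: "1 + 10 * (real k + 5) * log 2 (real k + 5) \<le> (real k powr (3 / 4) / 3125 - 1) ^ 2 / 2"
  shows "0 < popularity k"
    and "real ((size_threshold k ^ (k + 5) * ((k + 5) ^ 5) ^ popularity k) ^ 2) * (1 / 2) ^ (popularity k ^ 2) \<le> 1 / 2"
proof -
  define L where "L = log 2 (real k + 5)"
  define s where "s = real (popularity k)"
  define s0 where "s0 = real k powr (3 / 4) / 3125 - 1"
  note T = size_threshold_le[OF k]
  have s: "s0 \<le> s" unfolding s_def s0_def by (rule popularity_ge[OF k])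
  have "log 2 2 \<le> L" unfolding L_def using k by (subst log_le_cancel_iff) auto
  then have L: "1 \<le> L" by simp
  have s0L: "20 * L \<le> s0" using F1 by (simp add: L_def s0_def)
  then have s0pos: "20 \<le> s0" using L by linarith
  show "0 < popularity k" using s s0pos unfolding s_def by linarith
  have "s0 ^ 2 \<le> s ^ 2" using s s0pos by (intro power_mono) auto
  then have a: "1 + 10 * (real k + 5) * L \<le> s ^ 2 / 2" using F2 unfolding L_def s0_def by linarith
  have "20 * L * s \<le> s * s" using s s0L s0pos by (intro mult_right_mono) auto
  then have b: "10 * s * L \<le> s ^ 2 / 2" by (simp add: power2_eq_square mult.commute mult.left_commute)
  have main: "1 + 10 * (real k + 5 + s) * L \<le> s ^ 2"
  proof -
    have "10 * (real k + 5 + s) * L = 10 * (real k + 5) * L + 10 * s * L" by (simp add: algebra_simps)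
    then show ?thesis using a b by linarith
  qed
  have kL: "real k + 5 = 2 powr L" unfolding L_def by simp
  have TL: "real (size_threshold k) \<le> 2 powr (5 * L)"
  proof -
    have "real (size_threshold k) \<le> real (k ^ 5)" by (rule of_nat_mono[OF T(2)])
    also have "\<dots> \<le> (real k + 5) ^ 5" by (simp add: power_mono)
    also have "\<dots> = 2 powr (5 * L)" unfolding kL by (simp add: powr_realpow[symmetric] powr_powr mult.commute)
    finally show ?thesis .
  qed
  have "real (size_threshold k ^ (k + 5) * ((k + 5) ^ 5) ^ popularity k)
      = real (size_threshold k) ^ (k + 5) * (real k + 5) ^ (5 * popularity k)"
    by (simp add: power_mult)
  also have "\<dots> \<le> (2 powr (5 * L)) ^ (k + 5) * (2 powr L) ^ (5 * popularity k)"
    unfolding kL by (intro mult_mono power_mono TL) auto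
  also have "\<dots> = 2 powr (5 * L * (real k + 5) + L * (5 * s))"
  proof -
    have "(2 powr (5 * L)) ^ (k + 5) = 2 powr (5 * L * real (k + 5))"
      by (simp add: powr_powr flip: powr_realpow)
    moreover have "(2 powr L) ^ (5 * popularity k) = 2 powr (L * real (5 * popularity k))"
      by (simp add: powr_powr flip: powr_realpow)
    moreover have "real (k + 5) = real k + 5" "real (5 * popularity k) = 5 * s" by (simp_all add: s_def)
    ultimately show ?thesis by (simp only: powr_add)
  qed
  also have "5 * L * (real k + 5) + L * (5 * s) = 5 * (real k + 5 + s) * L" by (simp add: algebra_simps)
  finally have "real (size_threshold k ^ (k + 5) * ((k + 5) ^ 5) ^ popularity k) ^ 2
      \<le> (2 powr (5 * (real k + 5 + s) * L)) ^ 2" by (intro power_mono) auto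
  also have "\<dots> = 2 powr (10 * (real k + 5 + s) * L)"
    unfolding power2_eq_square powr_add[symmetric] by (simp add: algebra_simps)
  also have "\<dots> \<le> 2 powr (s ^ 2 - 1)" using main by (intro powr_mono) auto
  finally have "real (size_threshold k ^ (k + 5) * ((k + 5) ^ 5) ^ popularity k) ^ 2 * (1 / 2) ^ (popularity k ^ 2)
      \<le> 2 powr (s ^ 2 - 1) * (1 / 2) ^ (popularity k ^ 2)" by (intro mult_right_mono) auto
  moreover have "2 powr (s ^ 2 - 1) * (1 / 2) ^ (popularity k ^ 2) = 1 / 2"
  proof -
    have "(2 :: real) ^ (popularity k ^ 2) = 2 powr (s ^ 2)"
      by (simp add: s_def powr_realpow[symmetric])
    then show ?thesis by (simp add: power_one_over powr_diff)
  qed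
  ultimately show "real ((size_threshold k ^ (k + 5) * ((k + 5) ^ 5) ^ popularity k) ^ 2)
      * (1 / 2) ^ (popularity k ^ 2) \<le> 1 / 2" by (simp only: of_nat_power)
qed

lemma few_bad_sets_numeric:
  assumes k: "256 \<le> k"
  shows "2 * (block_count k * (2 * popularity k * size_threshold k ^ 5)) ^ 2 < (2 * (k + 5)) choose (k + 5)"
proof -
  let ?T = "size_threshold k" and ?s = "popularity k" and ?M = "block_count k"
  have k1: "1 \<le> k" using k by simp
  have "?s * ?T \<le> (k + 5) choose 5" unfolding popularity_def by (rule div_times_less_eq_dividend)
  also have "\<dots> \<le> (k + 5) ^ 5" by (rule binomial_le_power)
  also have "\<dots> \<le> (2 * k) ^ 5" using k by (intro power_mono) auto
  finally have sT: "?s * ?T \<le> 32 * k ^ 5" by (simp add: power_mult_distrib)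
  have T4: "?T ^ 4 \<le> (k ^ 5) ^ 4" by (rule power_mono[OF size_threshold_le(2)[OF k1]]) simp
  have "?T ^ 5 = ?T * ?T ^ 4" using power_Suc[of ?T 4] by (simp del: power_Suc)
  then have "?M * (2 * ?s * ?T ^ 5) = 2 * ?M * (?s * ?T) * ?T ^ 4"
    by (simp only: mult.assoc mult.commute mult.left_commute)
  also have "\<dots> \<le> 2 * ?M * (32 * k ^ 5) * (k ^ 5) ^ 4" by (intro mult_mono sT T4) auto
  also have "\<dots> = 64 * (?M * k ^ 25)" by (simp add: power_mult[symmetric] power_add[symmetric])
  finally have X: "?M * (2 * ?s * ?T ^ 5) \<le> 64 * (?M * k ^ 25)" .
  have "?M * k ^ 27 \<le> 2 ^ k" unfolding block_count_def by (rule div_times_less_eq_dividend)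
  then have "k ^ 2 * (?M * k ^ 25) \<le> 2 ^ k"
    by (simp add: power_add[symmetric] mult.left_commute[of "k ^ 2"])
  then have "k ^ 2 * (?M * (2 * ?s * ?T ^ 5)) \<le> 64 * 2 ^ k"
  proof -
    have "k ^ 2 * (?M * (2 * ?s * ?T ^ 5)) \<le> k ^ 2 * (64 * (?M * k ^ 25))"
      by (rule mult_left_mono[OF X]) simp
    also have "\<dots> = 64 * (k ^ 2 * (?M * k ^ 25))" by (rule mult.left_commute)
    also have "\<dots> \<le> 64 * 2 ^ k" by (rule mult_le_mono2) fact
    finally show ?thesis .
  qed
  then have "(k ^ 2 * (?M * (2 * ?s * ?T ^ 5))) ^ 2 \<le> (64 * 2 ^ k) ^ 2" by (rule power_mono) simp
  moreover have "(64 * 2 ^ k) ^ 2 = (4096 :: nat) * 4 ^ k"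
    by (simp add: power_mult_distrib power_mult[symmetric] mult.commute[of k 2] power_mult)
  moreover have "(k ^ 2 * (?M * (2 * ?s * ?T ^ 5))) ^ 2 = k ^ 4 * (?M * (2 * ?s * ?T ^ 5)) ^ 2"
    unfolding power_mult_distrib[of "k ^ 2"] by (simp add: power_mult[symmetric])
  ultimately have "k ^ 4 * (?M * (2 * ?s * ?T ^ 5)) ^ 2 \<le> 4096 * 4 ^ k"
    by (simp only:)
  moreover have "4096 * 2 * 4 ^ k < k ^ 3 * (256 * 4 ^ k)"
  proof -
    have "256 ^ 3 \<le> k ^ 3" by (rule power_mono[OF k]) simp
    then have "32 < k ^ 3" by simp
    then have "32 * (256 * 4 ^ k) < k ^ 3 * (256 * 4 ^ k)" by (intro mult_strict_right_mono) auto
    then show ?thesis by simp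
  qed
  ultimately have "k ^ 4 * (2 * (?M * (2 * ?s * ?T ^ 5)) ^ 2) < k ^ 3 * (256 * 4 ^ k)" by linarith
  moreover have "k ^ 4 = k ^ 3 * k" by (simp add: power3_eq_cube power4_eq_xxxx)
  ultimately have "k ^ 3 * (k * (2 * (?M * (2 * ?s * ?T ^ 5)) ^ 2)) < k ^ 3 * (256 * 4 ^ k)"
    by (simp only: mult.assoc)
  then have less: "k * (2 * (?M * (2 * ?s * ?T ^ 5)) ^ 2) < 256 * 4 ^ k"
    by (simp only: mult_less_cancel1)
  have "256 * 4 ^ k \<le> k * ((2 * (k + 5)) choose (k + 5))"
  proof -
    have "4 ^ (k + 5) / (2 * real (k + 5)) \<le> real ((2 * (k + 5)) choose (k + 5))"
      by (rule central_binomial_lower_bound) simp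
    then have "4 ^ (k + 5) \<le> real ((2 * (k + 5)) choose (k + 5)) * (2 * real (k + 5))"
      by (subst (asm) pos_divide_le_eq) auto
    also have "\<dots> \<le> real ((2 * (k + 5)) choose (k + 5)) * (4 * real k)"
      using k by (intro mult_left_mono) auto
    finally have "256 * 4 ^ k \<le> real k * real ((2 * (k + 5)) choose (k + 5))"
      by (simp add: power_add)
    then have "real (256 * 4 ^ k) \<le> real (k * ((2 * (k + 5)) choose (k + 5)))" by simp
    then show ?thesis by (simp only: of_nat_le_iff)
  qed
  with less have "k * (2 * (?M * (2 * ?s * ?T ^ 5)) ^ 2) < k * ((2 * (k + 5)) choose (k + 5))" by linarith
  then show ?thesis by simp
qed

lemma low_probability_numeric:
  fixes \<delta> :: real
  assumes k: "1 \<le> k" and n: "2 \<le> n" "real n \<le> 2 powr (2 powr (\<delta> * real k))"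
    and F3: "2 * real k ^ 5 * 2 powr (\<delta> * real k) + real k \<le> 2 ^ k / real k ^ 27 - 1"
    and b: "b \<le> 1 / 2" "0 \<le> b"
  shows "real (n + 1) ^ size_threshold k * b ^ block_count k \<le> (1 / 2) ^ k"
proof -
  define P where "P = 2 powr (\<delta> * real k)"
  have M: "2 ^ k / real k ^ 27 - 1 \<le> real (block_count k)"
    using real_divide_minus_div_le[of "2 ^ k" "k ^ 27"] unfolding block_count_def by simp
  have "2 * n \<le> n * n" using n(1) by (intro mult_right_mono) auto
  then have "n + 1 \<le> n ^ 2" using n(1) unfolding power2_eq_square by linarith
  then have "real (n + 1) \<le> real n ^ 2" by (simp only: of_nat_power[symmetric] of_nat_le_iff)
  also have "\<dots> \<le> (2 powr P) ^ 2" using n(2) unfolding P_def by (intro power_mono) auto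
  finally have n1: "real (n + 1) \<le> 2 powr (2 * P)" by (simp add: power2_eq_square powr_add[symmetric])
  have "real (n + 1) ^ size_threshold k \<le> (2 powr (2 * P)) ^ size_threshold k"
    by (rule power_mono[OF n1]) simp
  also have "\<dots> = 2 powr (2 * P * real (size_threshold k))"
    by (simp add: powr_realpow[symmetric] powr_powr)
  also have "\<dots> \<le> 2 powr (2 * real k ^ 5 * P)"
  proof (intro powr_mono)
    have "real (size_threshold k) \<le> real k ^ 5"
      using of_nat_mono[OF size_threshold_le(2)[OF k], where 'a = real] by simp
    then have "2 * P * real (size_threshold k) \<le> 2 * P * real k ^ 5"
      by (intro mult_left_mono) (auto simp: P_def)
    then show "2 * P * real (size_threshold k) \<le> 2 * real k ^ 5 * P" by (simp add: mult.commute mult.left_commute)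
  qed simp
  finally have A: "real (n + 1) ^ size_threshold k \<le> 2 powr (2 * real k ^ 5 * P)" .
  have "b ^ block_count k \<le> (1 / 2) ^ block_count k" by (rule power_mono[OF b])
  also have "\<dots> = 2 powr (- real (block_count k))" by (rule half_power_eq_powr)
  finally have B: "b ^ block_count k \<le> 2 powr (- real (block_count k))" .
  have "real (n + 1) ^ size_threshold k * b ^ block_count k
      \<le> 2 powr (2 * real k ^ 5 * P) * 2 powr (- real (block_count k))"
    by (rule mult_mono[OF A B]) (use b in auto)
  also have "\<dots> = 2 powr (2 * real k ^ 5 * P - real (block_count k))"
    by (simp only: powr_add[symmetric] add_uminus_conv_diff)
  also have "\<dots> \<le> 2 powr (- real k)" using F3 M by (intro powr_mono) (auto simp: P_def)
  also have "\<dots> = (1 / 2) ^ k" by (rule half_power_eq_powr[symmetric])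
  finally show ?thesis .
qed

lemma miss_count_facts:
  assumes "1 \<le> y"
  shows "2 * y \<le> 2 ^ miss_count y" and "0 < miss_count y" and "real (miss_count y) \<le> log 2 (real y) + 2"
proof -
  have y: "1 \<le> real y" using assms by simp
  have lg: "log 2 (2 * real y) = 1 + log 2 (real y)" using y by (simp add: log_mult)
  have l0: "0 \<le> log 2 (real y)" using y by simp
  have up: "log 2 (2 * real y) \<le> real (miss_count y)"
    unfolding miss_count_def using lg l0 by linarith
  have "2 * real y = 2 powr log 2 (2 * real y)" using y by simp
  also have "\<dots> \<le> 2 powr real (miss_count y)" using up by (intro powr_mono) auto
  also have "\<dots> = 2 ^ miss_count y" by (simp add: powr_realpow)
  finally have "real (2 * y) \<le> real (2 ^ miss_count y)" by simp
  then show "2 * y \<le> 2 ^ miss_count y" by (simp only: of_nat_le_iff)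
  show "0 < miss_count y" using up lg l0 by linarith
  show "real (miss_count y) \<le> log 2 (real y) + 2" unfolding miss_count_def using lg l0 by linarith
qed

lemma choose_lower_bound:
  assumes "1 \<le> k" "k ^ 4 \<le> y" shows "real y powr (3 * real k / 4) \<le> real (y choose k)"
proof -
  have "k ^ 1 \<le> k ^ 4" using assms(1) by (intro power_increasing) auto
  then have ky: "k \<le> y" using assms(2) by simp
  then have y: "1 \<le> real y" using assms(1) by simp
  have "real k = real k powr (4 * (1 / 4))" using assms(1) by simp
  also have "\<dots> = (real k powr 4) powr (1 / 4)" by (rule powr_powr[symmetric])
  also have "real k powr 4 = real (k ^ 4)" using assms(1) by simp
  also have "real (k ^ 4) powr (1 / 4) \<le> real y powr (1 / 4)" using assms(2) by (intro powr_mono2) auto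
  finally have kq: "real k \<le> real y powr (1 / 4)" .
  have "real y powr (3 / 4) * real k \<le> real y powr (3 / 4) * real y powr (1 / 4)"
    by (rule mult_left_mono[OF kq]) simp
  also have "\<dots> = real y" using y by (simp add: powr_add[symmetric])
  finally have "real y powr (3 / 4) \<le> real y / real k" using assms(1) by (simp add: pos_le_divide_eq)
  then have "(real y powr (3 / 4)) ^ k \<le> (real y / real k) ^ k" by (rule power_mono) simp
  also have "\<dots> \<le> real (y choose k)" by (rule binomial_ge_n_over_k_pow_k[OF ky])
  also have "(real y powr (3 / 4)) ^ k = real y powr (3 * real k / 4)"
    using y by (simp add: powr_power mult.commute)
  finally show ?thesis .
qed

lemma choose_minus_2:
  assumes "2 \<le> k" "k \<le> y"
  shows "y * (y - 1) * ((y - 2) choose (k - 2)) = k * (k - 1) * (y choose k)"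
proof -
  have 1: "k * (y choose k) = y * ((y - 1) choose (k - 1))"
    using times_binomial_minus1_eq[of k y] assms by simp
  have 2: "(k - 1) * ((y - 1) choose (k - 1)) = (y - 1) * ((y - 1 - 1) choose (k - 1 - 1))"
    using times_binomial_minus1_eq[of "k - 1" "y - 1"] assms by simp
  have e: "y - 1 - 1 = y - 2" "k - 1 - 1 = k - 2" by simp_all
  have "k * (k - 1) * (y choose k) = (k - 1) * (k * (y choose k))" by simp
  also have "\<dots> = y * ((k - 1) * ((y - 1) choose (k - 1)))" unfolding 1 by simp
  also have "\<dots> = y * (y - 1) * ((y - 2) choose (k - 2))" unfolding 2 e by simp
  finally show ?thesis by simp
qed

text \<open>
  A given pair of points lies in a fraction of about \<open>(k / y)\<^sup>2\<close> of the \<open>k\<close>-sets, so \<open>2 k\<^sup>2 D\<^sup>2 y\<close>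
  pairs spoil a fraction of order \<open>k ^ 4 D\<^sup>2 / y\<close>.
\<close>

lemma few_atypical_numeric:
  assumes k: "8 \<le> k" and y: "40 \<le> y" and D: "0 < D" and big: "32 * k ^ 4 * D ^ 2 \<le> y"
  shows "4 * (y * (2 * k ^ 2 * D ^ 2) * ((y - 2) choose (k - 2)) + y * (2 * D) + y * (3 * k * D ^ 2)) \<le> y choose k"
proof -
  have D1: "1 \<le> D ^ 2" "D \<le> D ^ 2" using D by (simp_all add: Suc_le_eq power2_eq_square)
  have "k ^ 4 * 1 \<le> k ^ 4 * D ^ 2" by (rule mult_left_mono[OF D1(1)]) simp
  then have k4: "k ^ 4 \<le> y" using big by linarith
  have "k ^ 1 \<le> k ^ 4" using k by (intro power_increasing) auto
  then have ky: "k \<le> y" and kk4: "k \<le> k ^ 4" using k4 by simp_all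
  let ?C = "y choose k" and ?C2 = "(y - 2) choose (k - 2)"
  have first: "8 * (y * (2 * k ^ 2 * D ^ 2) * ?C2) \<le> ?C"
  proof -
    have "y \<le> 2 * (y - 1)" using y by simp
    then have "y * (8 * (y * (2 * k ^ 2 * D ^ 2) * ?C2)) \<le> 2 * (y - 1) * (8 * (y * (2 * k ^ 2 * D ^ 2) * ?C2))"
      by (rule mult_right_mono) simp
    also have "\<dots> = 32 * k ^ 2 * D ^ 2 * (y * (y - 1) * ?C2)"
    proof -
      have "2 * z * (8 * (y * (2 * a * b) * c)) = 32 * a * b * (y * z * c)" for a b c z :: nat
        by (simp add: mult_ac)
      then show ?thesis .
    qed
    also have "\<dots> = 32 * k ^ 2 * D ^ 2 * (k * (k - 1) * ?C)"
      using choose_minus_2[OF _ ky] k by simp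
    also have "\<dots> \<le> 32 * k ^ 2 * D ^ 2 * (k * k * ?C)"
      by (rule mult_left_mono, rule mult_right_mono, rule mult_left_mono) simp_all
    also have "\<dots> = 32 * k ^ 4 * D ^ 2 * ?C" by (simp add: power2_eq_square power4_eq_xxxx)
    also have "\<dots> \<le> y * ?C" by (rule mult_right_mono[OF big]) simp
    finally show ?thesis using y by simp
  qed
  have kD: "32 * (k * D ^ 2) \<le> y"
  proof -
    have "k * D ^ 2 \<le> k ^ 4 * D ^ 2" by (rule mult_right_mono[OF kk4]) simp
    then have "32 * (k * D ^ 2) \<le> 32 * k ^ 4 * D ^ 2" by (simp only: mult.assoc mult_le_mono2)
    then show ?thesis using big by (rule order_trans)
  qed
  have "D \<le> k * D ^ 2" using D1(2) k mult_mono[of 1 k D "D ^ 2"] by simp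
  then have "8 * (y * (2 * D) + y * (3 * k * D ^ 2)) \<le> 8 * (y * (2 * (k * D ^ 2)) + y * (3 * (k * D ^ 2)))"
    by (simp add: mult.assoc)
  also have "\<dots> = 40 * (k * D ^ 2) * y" by simp
  also have "\<dots> \<le> 2 * y * y" using kD by (intro mult_right_mono) auto
  also have "\<dots> \<le> y ^ 3" unfolding power3_eq_cube using y by (intro mult_right_mono) auto
  also have "y ^ 3 \<le> ?C"
  proof -
    have "real (y ^ 3) = real y powr 3" using y by simp
    also have "\<dots> \<le> real y powr (3 * real k / 4)" using k y by (intro powr_mono) auto
    also have "\<dots> \<le> real ?C" using k by (intro choose_lower_bound k4) simp
    finally show ?thesis by (simp only: of_nat_le_iff)
  qed
  finally have "8 * (y * (2 * D) + y * (3 * k * D ^ 2)) \<le> ?C" .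
  with first show ?thesis by simp
qed

lemma data_count_le:
  assumes k: "1 \<le> k" and D: "0 < D" and big: "32 * k ^ 4 * D ^ 2 \<le> y"
  shows "data_count y k D \<le> 2 ^ (15 * y ^ 3)"
proof -
  have D1: "1 \<le> D ^ 2" "D \<le> D ^ 2" using D by (simp_all add: Suc_le_eq power2_eq_square)
  have k4: "k \<le> k ^ 4" "k ^ 2 \<le> k ^ 4" "1 \<le> k ^ 4"
    using k power_increasing[of 1 4 k] by (auto intro: power_increasing)
  have kD: "k * D ^ 2 \<le> y" "k ^ 2 * D ^ 2 \<le> y" "D \<le> y" "1 \<le> y"
  proof -
    have *: "c * D ^ 2 \<le> y" if "c \<le> k ^ 4" for c
    proof -
      have "c * D ^ 2 \<le> k ^ 4 * D ^ 2" by (rule mult_right_mono[OF that]) simp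
      also have "\<dots> \<le> 32 * k ^ 4 * D ^ 2" by simp
      also note big
      finally show ?thesis .
    qed
    from *[OF k4(1)] *[OF k4(2)] *[OF k4(3)] D1
    show "k * D ^ 2 \<le> y" "k ^ 2 * D ^ 2 \<le> y" "D \<le> y" "1 \<le> y" by simp_all
  qed
  have "(2 :: nat) ^ y + 1 \<le> 2 ^ (y + 1)" by simp
  also have "\<dots> \<le> 2 ^ (2 * y)" using kD(4) by (intro power_increasing) auto
  finally have b: "(2 :: nat) ^ y + 1 \<le> 2 ^ (2 * y)" .
  have pw: "((2 :: nat) ^ y + 1) ^ e \<le> 2 ^ (2 * y * f)" if "e \<le> f" for e f
  proof -
    have "((2 :: nat) ^ y + 1) ^ e \<le> (2 ^ (2 * y)) ^ e" by (rule power_mono[OF b]) simp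
    also have "\<dots> = 2 ^ (2 * y * e)" by (simp add: power_mult)
    also have "\<dots> \<le> 2 ^ (2 * y * f)" using that by (intro power_increasing mult_left_mono) auto
    finally show ?thesis .
  qed
  have "((2 :: nat) ^ y + 1) ^ (3 * k * D ^ 2) + 1 \<le> 2 ^ (2 * y * (3 * y)) + 1"
    using pw[of "3 * k * D ^ 2" "3 * y"] kD(1) by simp
  also have "\<dots> \<le> 2 ^ (2 * y * (3 * y) + 1)" by simp
  also have "\<dots> \<le> 2 ^ (7 * y ^ 2)"
  proof (rule power_increasing)
    have "1 * 1 \<le> y * y" using kD(4) by (intro mult_mono) auto
    then show "2 * y * (3 * y) + 1 \<le> 7 * y ^ 2" by (simp add: power2_eq_square)
  qed simp
  finally have "(((2 :: nat) ^ y + 1) ^ (3 * k * D ^ 2) + 1) ^ y \<le> (2 ^ (7 * y ^ 2)) ^ y"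
    by (rule power_mono) simp
  also have "\<dots> = 2 ^ (7 * y ^ 3)"
    by (simp add: power_mult[symmetric] power2_eq_square power3_eq_cube mult.assoc)
  finally have 1: "(((2 :: nat) ^ y + 1) ^ (3 * k * D ^ 2) + 1) ^ y \<le> 2 ^ (7 * y ^ 3)" .
  have "((2 :: nat) ^ y + 1) ^ (y * (2 * k ^ 2 * D ^ 2 + 2 * D)) \<le> 2 ^ (2 * y * (y * (4 * y)))"
    by (rule pw) (use kD in \<open>auto intro!: mult_left_mono\<close>)
  also have "2 * y * (y * (4 * y)) = 8 * y ^ 3" by (simp add: power3_eq_cube)
  finally have 2: "((2 :: nat) ^ y + 1) ^ (y * (2 * k ^ 2 * D ^ 2 + 2 * D)) \<le> 2 ^ (8 * y ^ 3)" .
  have "data_count y k D \<le> 2 ^ (7 * y ^ 3) * 2 ^ (8 * y ^ 3)"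
    unfolding data_count_def by (rule mult_mono[OF 1 2]) auto
  also have "\<dots> = 2 ^ (15 * y ^ 3)" by (simp add: power_add[symmetric])
  finally show ?thesis .
qed

text \<open>
  Here \<open>y choose k\<close> is at least \<open>y powr (3k / 4)\<close>, whereas \<open>4 ^ k\<close> times the entropy
  \<open>15 y ^ 3 + (y + 2) 2 ^ k\<close> is only about \<open>y powr (4 + 3k / 16)\<close>.
\<close>

lemma high_probability_numeric:
  assumes k: "8 \<le> k" and y: "2 ^ 16 \<le> y" and D: "0 < D" and big: "32 * k ^ 4 * D ^ 2 \<le> y"
    and n: "1 \<le> n" "real n \<le> 2 powr (2 ^ k)"
  shows "real (data_count y k D) * (1 - (1 / 2) ^ (2 * k + 1)) ^ ((y choose k) div 4) \<le> (1 / real n) ^ (y + 2)"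
proof -
  define q :: real where "q = (1 / 2) ^ (2 * k + 1)"
  define N where "N = (y choose k) div 4"
  have q: "0 < q" "q \<le> 1" by (simp_all add: q_def power_le_one del: power_Suc)
  have y1: "1 \<le> real y" using y by simp
  have "1 \<le> D ^ 2" using D by (simp add: Suc_le_eq)
  then have "k ^ 4 * 1 \<le> k ^ 4 * D ^ 2" by (rule mult_left_mono) simp
  then have k4: "k ^ 4 \<le> y" using big by linarith
  have C: "real y powr (3 * real k / 4) \<le> real (y choose k)"
    using k by (intro choose_lower_bound k4) simp
  have two: "2 ^ k \<le> real y powr (real k / 16)"
  proof -
    have "(2 :: real) ^ k = 2 powr (16 * (real k / 16))" by (simp add: powr_realpow)
    \<comment> \<open>The assumption \<open>2 ^ 16 \<le> y\<close> enters here.\<close>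
    also have "\<dots> = (2 powr 16) powr (real k / 16)" by (rule powr_powr[symmetric])
    also have "\<dots> \<le> real y powr (real k / 16)"
    proof (rule powr_mono2)
      show "(2 :: real) powr 16 \<le> real y" using y by simp
    qed auto
    finally show ?thesis .
  qed
  have bits: "32 * 4 ^ k * (15 * real y ^ 3 + (real y + 2) * 2 ^ k) \<le> real (y choose k) / 2"
  proof -
    have p1: "1 \<le> (2 :: real) ^ k" by simp
    have y3: "real y \<le> real y ^ 3" "1 \<le> real y ^ 3"
      using y1 power_increasing[of 1 3 "real y"] by (simp_all add: one_le_power)
    have "15 * real y ^ 3 + (real y + 2) * 2 ^ k \<le> 15 * real y ^ 3 * 2 ^ k + (real y ^ 3 + 2 * real y ^ 3) * 2 ^ k"
      using p1 y3 mult_left_mono[OF p1, of "15 * real y ^ 3"] by (intro add_mono mult_right_mono) auto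
    also have "\<dots> = 18 * real y ^ 3 * 2 ^ k" by (simp add: algebra_simps)
    finally have "64 * 4 ^ k * (15 * real y ^ 3 + (real y + 2) * 2 ^ k) \<le> 64 * 4 ^ k * (18 * real y ^ 3 * 2 ^ k)"
      by (rule mult_left_mono) simp
    also have "\<dots> = 1152 * real y ^ 3 * (2 ^ k) ^ 3"
    proof -
      have "(4 :: real) ^ k = 2 ^ k * 2 ^ k" by (simp add: power_mult_distrib[symmetric])
      then show ?thesis by (simp add: power3_eq_cube)
    qed
    also have "\<dots> \<le> real y * real y ^ 3 * (real y powr (real k / 16)) ^ 3"
      using y by (intro mult_mono power_mono two) auto
    also have "\<dots> = real y powr 4 * real y powr (3 * real k / 16)"
    proof -
      have "(real y powr (real k / 16)) ^ 3 = real y powr (3 * real k / 16)"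
        using y1 by (simp add: powr_power)
      moreover have "real y * real y ^ 3 = real y powr 4"
        using y1 by (simp add: power3_eq_cube power4_eq_xxxx)
      ultimately show ?thesis by simp
    qed
    also have "\<dots> = real y powr (4 + 3 * real k / 16)" by (simp add: powr_add)
    also have "\<dots> \<le> real y powr (3 * real k / 4)" using k y1 by (intro powr_mono) auto
    also have "\<dots> \<le> real (y choose k)" by (rule C)
    finally show ?thesis by simp
  qed
  have "8 \<le> real (y choose k)"
  proof -
    have "32 * 1 * (15 * 1 + 0) \<le> 32 * 4 ^ k * (15 * real y ^ 3 + (real y + 2) * 2 ^ k)"
      using y1 by (intro mult_mono add_mono) (auto simp: one_le_power)
    then have "32 * 1 * (15 * 1 + 0) \<le> real (y choose k) / 2" using bits by (rule order_trans)
    then show ?thesis by simp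
  qed
  then have N: "real (y choose k) / 8 \<le> real N"
    using real_divide_minus_div_le[of "y choose k" 4] unfolding N_def by simp
  have qN: "15 * real y ^ 3 + (real y + 2) * 2 ^ k \<le> q * real N"
  proof -
    have q_eq: "q * (32 * 4 ^ k) = 16"
      unfolding q_def by (simp add: power_mult power_one_over)
    have "16 * (15 * real y ^ 3 + (real y + 2) * 2 ^ k)
        = q * (32 * 4 ^ k * (15 * real y ^ 3 + (real y + 2) * 2 ^ k))"
      unfolding mult.assoc[symmetric] q_eq[symmetric] by simp
    also have "\<dots> \<le> q * (real (y choose k) / 2)" using bits q by (intro mult_left_mono) auto
    also have "\<dots> \<le> q * (4 * real N)" using N q by (intro mult_left_mono) auto
    finally have le: "16 * (15 * real y ^ 3 + (real y + 2) * 2 ^ k) \<le> 4 * (q * real N)" by simp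
    have "u \<le> v" if "16 * u \<le> 4 * v" "0 \<le> u" for u v :: real using that by linarith
    from this[OF le] show ?thesis by simp
  qed
  have "(1 - q) ^ N \<le> exp (- q) ^ N"
    using q exp_ge_add_one_self[of "- q"] by (intro power_mono) auto
  also have "\<dots> = exp (- (q * real N))" by (simp add: exp_of_nat_mult[symmetric] mult.commute)
  also have "\<dots> \<le> exp (- (15 * real y ^ 3 + (real y + 2) * 2 ^ k))" using qN by simp
  also have "\<dots> = exp (- (15 * real y ^ 3)) * exp (- ((real y + 2) * 2 ^ k))" by (simp add: exp_add[symmetric])
  finally have A: "(1 - q) ^ N \<le> exp (- (15 * real y ^ 3)) * exp (- ((real y + 2) * 2 ^ k))" .
  have exp2: "2 powr x \<le> exp x" if "0 \<le> x" for x :: real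
  proof -
    have "ln (2 :: real) \<le> 1" using ln_le_minus_one[of "2 :: real"] by simp
    then show ?thesis using that mult_left_mono[of "ln 2" 1 x] by (simp add: powr_def)
  qed
  have "real (data_count y k D) \<le> real (2 ^ (15 * y ^ 3))"
    using k by (intro of_nat_mono data_count_le D big) simp
  also have "\<dots> = 2 powr real (15 * y ^ 3)" by (simp only: of_nat_power of_nat_numeral powr_realpow[OF zero_less_numeral])
  also have "real (15 * y ^ 3) = 15 * real y ^ 3" by simp
  also have "2 powr (15 * real y ^ 3) \<le> exp (15 * real y ^ 3)" by (rule exp2) simp
  finally have B: "real (data_count y k D) \<le> exp (15 * real y ^ 3)" .
  have "real (data_count y k D) * (1 - q) ^ N
      \<le> exp (15 * real y ^ 3) * (exp (- (15 * real y ^ 3)) * exp (- ((real y + 2) * 2 ^ k)))"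
    by (rule mult_mono[OF B A]) (use q in auto)
  also have "\<dots> = exp (- ((real y + 2) * 2 ^ k))" by (simp add: exp_add[symmetric] mult.assoc[symmetric])
  also have "\<dots> \<le> (1 / real n) ^ (y + 2)"
  proof -
    have "real n \<le> exp (2 ^ k)" using n(2) exp2[of "2 ^ k"] by simp
    then have "real n ^ (y + 2) \<le> exp (2 ^ k) ^ (y + 2)" by (rule power_mono) simp
    also have "\<dots> = exp (real (y + 2) * 2 ^ k)" by (rule exp_of_nat_mult[symmetric])
    also have "real (y + 2) = real y + 2" by simp
    finally show ?thesis using n(1) by (simp add: exp_minus power_one_over inverse_eq_divide frac_le)
  qed
  finally show ?thesis unfolding q_def N_def .
qed


section \<open>The random Kneser graph\<close>

text \<open>
  After the reduction to \<open>S\<close>, the bound \<open>card C + 2k + 11 \<le> card S\<close> is what both cases need: for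
  small \<open>S\<close> it exceeds \<open>card C + 2 (k + 5) - 1\<close>, for large \<open>S\<close> it bounds the number of colours
  by the size of \<open>S\<close>.
\<close>

lemma low_or_high_event:
  assumes k: "2 \<le> k" and E: "E \<subseteq> kneser_edges n k"
    and few_colours: "int (chromatic_number (kneser_verts n k) E) < int n - 2 * int k - 10"
    and s: "0 < s" "s * T \<le> (k + 5) choose 5"
    and M: "2 * (M * (2 * s * T ^ 5)) ^ 2 < (2 * (k + 5)) choose (k + 5)"
    and D: "\<And>y. T < y \<Longrightarrow> 0 < D y"
    and few: "\<And>y. T < y \<Longrightarrow> 4 * (y * (2 * k ^ 2 * D y ^ 2) * ((y - 2) choose (k - 2)) + y * (2 * D y)
      + y * (3 * k * D y ^ 2)) \<le> y choose k"
  shows "low_event n k T s M E \<or> high_event n k T D E"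
proof -
  define c where "c = chromatic_number (kneser_verts n k) E"
  have loopless: "{v} \<notin> E" for v
  proof
    assume "{v} \<in> E"
    then obtain A B where "{v} = {A, B}" "A \<noteq> B" using E unfolding kneser_edges_def by blast
    then show False by (auto simp: singleton_insert_inj_eq)
  qed
  obtain f where f: "proper_colouring (kneser_verts n k) E c f"
    using chromatic_number_attained[OF finite_kneser_verts loopless] unfolding c_def by blast
  have V: "ksubsets {1..n} k = kneser_verts n k" by (simp add: ksubsets_def kneser_verts_def)
  have "\<exists>S C'. S \<subseteq> {1..n} \<and> C' \<subseteq> {..<c} \<and> card C' + (2 * k + 11) \<le> card S \<and> (\<forall>A\<in>ksubsets S k. f A \<in> C')
    \<and> (\<forall>i\<in>C'. \<forall>x\<in>S. \<exists>A\<in>ksubsets S k. f A = i \<and> x \<notin> A)"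
  proof (rule star_reduction)
    show "card {..<c} + (2 * k + 11) \<le> card {1..n}" using few_colours by (simp add: c_def)
    show "f A \<in> {..<c}" if "A \<in> ksubsets {1..n} k" for A
      using f that unfolding V proper_colouring_def by blast
  qed simp_all
  then obtain S C where S: "S \<subseteq> {1..n}" and C: "C \<subseteq> {..<c}" "card C + (2 * k + 11) \<le> card S"
    and fC: "\<forall>A\<in>ksubsets S k. f A \<in> C" and ns: "\<forall>i\<in>C. \<forall>x\<in>S. \<exists>A\<in>ksubsets S k. f A = i \<and> x \<notin> A"
    by blast
  have finS: "finite S" by (rule finite_subset[OF S]) simp
  have finC: "finite C" by (rule finite_subset[OF C(1)]) simp
  have indep: "{A, B} \<notin> E" if "A \<in> ksubsets S k" "B \<in> ksubsets S k" "f A = f B" for A B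
  proof -
    have "A \<in> kneser_verts n k" "B \<in> kneser_verts n k"
      using that(1,2) S unfolding V[symmetric] ksubsets_def by blast+
    then show ?thesis using f that(3) unfolding proper_colouring_def by blast
  qed
  show ?thesis
  proof (cases "card S \<le> T")
    case True
    have "\<exists>W\<subseteq>mono_blocks S k s. card W = M \<and> (\<forall>v\<in>W. \<forall>w\<in>W. v \<noteq> w \<longrightarrow> cross v \<inter> cross w = {})
        \<and> (\<Union>w\<in>W. cross w) \<inter> E = {}"
      by (rule colouring_small_ground_set[OF finS True finC _ _ _ s M, where f = f])
        (use C(2) fC indep in auto)
    then have "low_event n k T s M E" unfolding low_event_def using S True by blast
    then show ?thesis ..
  next
    case False
    then have T: "T < card S" by simp
    have "\<exists>\<BB> \<X>. \<BB> \<in> families S k (D (card S)) \<and> \<X> \<subseteq> Pow S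
      \<and> card \<X> \<le> card S * (2 * k ^ 2 * D (card S) ^ 2 + 2 * D (card S))
      \<and> card S choose k \<le> 4 * card (typical S k (D (card S)) \<BB> \<X>)
      \<and> (\<forall>A\<in>typical S k (D (card S)) \<BB> \<X>. \<exists>\<G>\<in>\<BB>. (\<lambda>B. {A, B}) ` misses \<G> A \<inter> E = {})"
    proof (rule colouring_large_ground_set[where f = f, OF finS _ finC _ D[OF T] k _ _ _ few[OF T]])
      show "f A \<in> C" if "A \<in> ksubsets S k" for A using fC that by blast
      show "\<exists>A\<in>ksubsets S k. f A = i \<and> x \<notin> A" if "i \<in> C" "x \<in> S" for i x using ns that by blast
      show "{A, B} \<notin> E" if "A \<in> ksubsets S k" "B \<in> ksubsets S k" "A \<inter> B = {}" "f A = f B" for A B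
        by (rule indep[OF that(1,2,4)])
    qed (use C(2) in auto)
    then obtain \<BB> \<X> where BX: "\<BB> \<in> families S k (D (card S))" "\<X> \<subseteq> Pow S"
      "card \<X> \<le> card S * (2 * k ^ 2 * D (card S) ^ 2 + 2 * D (card S))"
      "card S choose k \<le> 4 * card (typical S k (D (card S)) \<BB> \<X>)"
      "\<forall>A\<in>typical S k (D (card S)) \<BB> \<X>. \<exists>\<G>\<in>\<BB>. (\<lambda>B. {A, B}) ` misses \<G> A \<inter> E = {}"
      by (elim exE conjE)
    have "S \<in> {S. S \<subseteq> {1..n} \<and> T < card S}" using S T by (intro CollectI conjI)
    moreover have "\<X> \<in> {\<X>. \<X> \<subseteq> Pow S \<and> card \<X> \<le> card S * (2 * k ^ 2 * D (card S) ^ 2 + 2 * D (card S))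
       \<and> card S choose k \<le> 4 * card (typical S k (D (card S)) \<BB> \<X>)}"
      using BX(2-4) by (intro CollectI conjI)
    ultimately have "high_event n k T D E" unfolding high_event_def using BX(1,5) by (intro bexI)
    then show ?thesis ..
  qed
qed

text \<open>
  Everything except the last condition compares fixed functions of \<open>k\<close>. The last one holds since
  \<open>y \<ge> k powr (17/4)\<close> gives \<open>k ^ 4 \<le> y powr (16/17)\<close>, and \<open>miss_count y\<close> is logarithmic in \<open>y\<close>.
\<close>

lemma eventually_numeric_conditions:
  fixes \<delta> :: real
  assumes "0 < \<delta>" "\<delta> < 1"
  shows "\<forall>\<^sub>F k in at_top. 256 \<le> k
    \<and> 20 * log 2 (real k + 5) \<le> real k powr (3 / 4) / 3125 - 1
    \<and> 1 + 10 * (real k + 5) * log 2 (real k + 5) \<le> (real k powr (3 / 4) / 3125 - 1) ^ 2 / 2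
    \<and> 2 * real k ^ 5 * 2 powr (\<delta> * real k) + real k \<le> 2 ^ k / real k ^ 27 - 1
    \<and> (\<forall>y. size_threshold k < y \<longrightarrow> 2 ^ 16 \<le> y \<and> 32 * k ^ 4 * miss_count y ^ 2 \<le> y)"
proof (intro eventually_conj)
  show "\<forall>\<^sub>F k in at_top. (256 :: nat) \<le> k" by (rule eventually_ge_at_top)
  show "\<forall>\<^sub>F k in at_top. 20 * log 2 (real k + 5) \<le> real k powr (3 / 4) / 3125 - 1"
    by real_asymp
  show "\<forall>\<^sub>F k in at_top. 1 + 10 * (real k + 5) * log 2 (real k + 5) \<le> (real k powr (3 / 4) / 3125 - 1) ^ 2 / 2"
    by real_asymp
  show "\<forall>\<^sub>F k in at_top. 2 * real k ^ 5 * 2 powr (\<delta> * real k) + real k \<le> 2 ^ k / real k ^ 27 - 1"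
    using assms by real_asymp
  have "\<forall>\<^sub>F y in at_top. 32 * (y powr (16 / 17)) * (log 2 y + 2) ^ 2 \<le> (y :: real)"
    by real_asymp
  then obtain Y0 where Y0: "\<And>y. Y0 \<le> y \<Longrightarrow> 32 * (y powr (16 / 17)) * (log 2 y + 2) ^ 2 \<le> (y :: real)"
    by (auto simp: eventually_at_top_linorder)
  define Y where "Y = max Y0 (2 ^ 16)"
  have "\<forall>\<^sub>F k in at_top. Y \<le> real k powr (17 / 4)" by real_asymp
  then show "\<forall>\<^sub>F k in at_top. \<forall>y. size_threshold k < y \<longrightarrow> 2 ^ 16 \<le> y \<and> 32 * k ^ 4 * miss_count y ^ 2 \<le> y"
    using eventually_ge_at_top[of 1]
  proof eventually_elim
    case (elim k)
    show ?case
    proof (intro allI impI)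
      fix y assume y: "size_threshold k < y"
      have ky: "real k powr (17 / 4) \<le> real y" using y unfolding size_threshold_def by linarith
      then have yY: "Y \<le> real y" using elim(1) by linarith
      then have "2 ^ 16 \<le> real y" "Y0 \<le> real y" unfolding Y_def by simp_all
      then have y16: "2 ^ 16 \<le> y" by simp
      then have y1: "1 \<le> y" by simp
      have "real k ^ 4 = (real k powr (17 / 4)) powr (16 / 17)"
        using elim(2) by (simp add: powr_powr)
      also have "\<dots> \<le> real y powr (16 / 17)" using ky by (intro powr_mono2) auto
      finally have k4: "real k ^ 4 \<le> real y powr (16 / 17)" .
      have "real (32 * k ^ 4 * miss_count y ^ 2) = 32 * real k ^ 4 * real (miss_count y) ^ 2" by simp
      also have "\<dots> \<le> 32 * (real y powr (16 / 17)) * (log 2 (real y) + 2) ^ 2"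
        using miss_count_facts(3)[OF y1] k4 by (intro mult_mono power_mono) auto
      also have "\<dots> \<le> real y" by (rule Y0) fact
      finally have "32 * k ^ 4 * miss_count y ^ 2 \<le> y" by (simp only: of_nat_le_iff)
      with y16 show "2 ^ 16 \<le> y \<and> 32 * k ^ 4 * miss_count y ^ 2 \<le> y" by blast
    qed
  qed
qed

lemma prb_many_colours_ge:
  fixes \<delta> :: real
  assumes \<delta>: "\<delta> < 1" and k: "256 \<le> k"
    and n: "2 \<le> n" "real n \<le> 2 powr (2 powr (\<delta> * real k))"
    and F1: "20 * log 2 (real k + 5) \<le> real k powr (3 / 4) / 3125 - 1"
    and F2: "1 + 10 * (real k + 5) * log 2 (real k + 5) \<le> (real k powr (3 / 4) / 3125 - 1) ^ 2 / 2"
    and F3: "2 * real k ^ 5 * 2 powr (\<delta> * real k) + real k \<le> 2 ^ k / real k ^ 27 - 1"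
    and F4: "\<And>y. size_threshold k < y \<Longrightarrow> 2 ^ 16 \<le> y \<and> 32 * k ^ 4 * miss_count y ^ 2 \<le> y"
  shows "1 - ((1 / 2) ^ k + (real n + 1) / real n ^ 2)
    \<le> prb (kneser_edges n k) (\<lambda>E. int (chromatic_number (kneser_verts n k) E) \<ge> int n - 2 * int k - 10)"
proof -
  let ?U = "kneser_edges n k" and ?T = "size_threshold k" and ?s = "popularity k" and ?M = "block_count k"
  let ?low = "low_event n k ?T ?s ?M" and ?high = "high_event n k ?T miss_count"
  let ?good = "\<lambda>E. int (chromatic_number (kneser_verts n k) E) \<ge> int n - 2 * int k - 10"
  have U: "finite ?U" by (rule finite_kneser_edges)
  have k1: "1 \<le> k" "0 < k" using k by simp_all
  have y1: "1 \<le> y" "0 < miss_count y" if "?T < y" for y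
    using F4[OF that] miss_count_facts(2)[of y] by simp_all
  note pop = popularity_block_bound[OF k1(1) F1 F2]
  have n2: "real n \<le> 2 powr (2 ^ k)"
  proof -
    have "2 powr (\<delta> * real k) \<le> 2 powr (1 * real k)"
      using \<delta> by (intro powr_mono mult_right_mono) auto
    then have "2 powr (2 powr (\<delta> * real k)) \<le> (2 :: real) powr (2 ^ k)"
      by (intro powr_mono) (simp_all add: powr_realpow)
    then show ?thesis using n(2) by linarith
  qed
  have low: "prb ?U ?low \<le> (1 / 2) ^ k"
  proof -
    have "prb ?U ?low \<le> real (n + 1) ^ ?T *
        (real ((?T ^ (k + 5) * ((k + 5) ^ 5) ^ ?s) ^ 2) * (1 / 2) ^ (?s ^ 2)) ^ ?M"
      by (rule prb_low_event_le[OF k1(2)])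
    also have "\<dots> \<le> (1 / 2) ^ k"
      by (rule low_probability_numeric[OF k1(1) n F3 pop(2)]) simp
    finally show ?thesis .
  qed
  have high: "prb ?U ?high \<le> (real n + 1) / real n ^ 2"
  proof (rule prb_high_event_le[OF k1(2)])
    show "0 < n" using n(1) by simp
    fix y assume y: "?T < y" "y \<le> n"
    show "2 * y \<le> 2 ^ miss_count y" by (rule miss_count_facts(1)[OF y1(1)[OF y(1)]])
    show "real (data_count y k (miss_count y)) * (1 - (1 / 2) ^ (2 * k + 1)) ^ ((y choose k) div 4)
        \<le> (1 / real n) ^ (y + 2)"
      using F4[OF y(1)] y1(2)[OF y(1)] k n(1) n2 by (intro high_probability_numeric) auto
  qed
  have "prb ?U (\<lambda>E. \<not> ?good E) \<le> prb ?U (\<lambda>E. ?low E \<or> ?high E)"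
  proof (rule prb_mono[OF U])
    fix E assume E: "E \<subseteq> ?U" "\<not> ?good E"
    show "?low E \<or> ?high E"
    proof (rule low_or_high_event[OF _ E(1)])
      show "2 \<le> k" using k by simp
      show "int (chromatic_number (kneser_verts n k) E) < int n - 2 * int k - 10" using E(2) by simp
      show "0 < ?s" by (rule pop(1))
      show "?s * ?T \<le> (k + 5) choose 5" unfolding popularity_def by (rule div_times_less_eq_dividend)
      show "2 * (?M * (2 * ?s * ?T ^ 5)) ^ 2 < (2 * (k + 5)) choose (k + 5)"
        by (rule few_bad_sets_numeric[OF k])
      fix y assume y: "?T < y"
      show "0 < miss_count y" by (rule y1(2)[OF y])
      show "4 * (y * (2 * k ^ 2 * miss_count y ^ 2) * ((y - 2) choose (k - 2)) + y * (2 * miss_count y)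
          + y * (3 * k * miss_count y ^ 2)) \<le> y choose k"
        using F4[OF y] y1(2)[OF y] k by (intro few_atypical_numeric) auto
    qed
  qed
  also have "\<dots> \<le> prb ?U ?low + prb ?U ?high" by (rule prb_disj_le)
  also have "\<dots> \<le> (1 / 2) ^ k + (real n + 1) / real n ^ 2" using low high by (rule add_mono)
  finally show ?thesis unfolding prb_Not by linarith
qed

theorem theorem2:
  fixes \<epsilon> :: real and k :: "nat \<Rightarrow> nat"
  assumes "\<epsilon> > 0"
    and "\<forall>n. k n > 0"
    and "\<forall>\<^sub>F n in sequentially.
           n \<ge> 2 * k n \<and> real (k n) \<ge> (1 + \<epsilon>) * log 2 (log 2 (real n))"
  shows "(\<lambda>n. measure_pmf.prob (random_kneser_edges n (k n) (1/2))
            {E. int (chromatic_number (kneser_verts n (k n)) E) \<ge> int n - 2 * int (k n) - 10})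
         \<longlonglongrightarrow> 1"
proof -
  define \<delta> where "\<delta> = 1 / (1 + \<epsilon>)"
  have \<delta>: "0 < \<delta>" "\<delta> < 1" using assms(1) by (simp_all add: \<delta>_def)
  let ?p = "\<lambda>n. measure_pmf.prob (random_kneser_edges n (k n) (1/2))
            {E. int (chromatic_number (kneser_verts n (k n)) E) \<ge> int n - 2 * int (k n) - 10}"
  have p_eq: "?p n = prb (kneser_edges n (k n))
      (\<lambda>E. int (chromatic_number (kneser_verts n (k n)) E) \<ge> int n - 2 * int (k n) - 10)" for n
    unfolding prb_def random_kneser_edges_def
    by (simp add: pmf_of_set_Pow_conv_bernoulli[OF finite_kneser_edges])
  have lim_k: "filterlim k at_top sequentially"
  proof -
    have "filterlim (\<lambda>n. (1 + \<epsilon>) * log 2 (log 2 (real n))) at_top sequentially"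
      using assms(1) by real_asymp
    then have "filterlim (\<lambda>n. real (k n)) at_top sequentially"
      by (rule filterlim_at_top_mono) (use assms(3) in \<open>auto elim: eventually_mono\<close>)
    then show ?thesis by (simp add: filterlim_sequentially_iff_filterlim_real)
  qed
  have lower: "\<forall>\<^sub>F n in sequentially. 1 - ((1 / 2) ^ k n + (real n + 1) / real n ^ 2) \<le> ?p n"
    using eventually_compose_filterlim[OF eventually_numeric_conditions[OF \<delta>] lim_k]
      assms(3) eventually_ge_at_top[of 3]
  proof eventually_elim
    case (elim n)
    have l: "1 < log 2 (real n)"
    proof -
      have "log 2 2 < log 2 (real n)" using elim(3) by (subst log_less_cancel_iff) auto
      then show ?thesis by simp
    qed
    have "log 2 (log 2 (real n)) \<le> \<delta> * real (k n)"
      using elim(2) assms(1) by (simp add: \<delta>_def field_simps)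
    then have "2 powr (log 2 (log 2 (real n))) \<le> 2 powr (\<delta> * real (k n))" by (intro powr_mono) auto
    then have "log 2 (real n) \<le> 2 powr (\<delta> * real (k n))" using l by simp
    then have "2 powr (log 2 (real n)) \<le> 2 powr (2 powr (\<delta> * real (k n)))" by (intro powr_mono) auto
    then have n: "real n \<le> 2 powr (2 powr (\<delta> * real (k n)))" using elim(3) by simp
    show ?case unfolding p_eq
      by (rule prb_many_colours_ge[OF \<delta>(2) _ _ n]) (use elim in auto)
  qed
  have "(\<lambda>m::nat. (1 / 2 :: real) ^ m) \<longlonglongrightarrow> 0" by (rule LIMSEQ_power_zero) simp
  then have "(\<lambda>n. (1 / 2 :: real) ^ k n) \<longlonglongrightarrow> 0" by (rule filterlim_compose[OF _ lim_k])
  moreover have "(\<lambda>n. (real n + 1) / real n ^ 2) \<longlonglongrightarrow> 0" by real_asymp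
  ultimately have "(\<lambda>n. 1 - ((1 / 2) ^ k n + (real n + 1) / real n ^ 2)) \<longlonglongrightarrow> 1 - (0 + 0)"
    by (intro tendsto_intros)
  then have lim: "(\<lambda>n. 1 - ((1 / 2) ^ k n + (real n + 1) / real n ^ 2)) \<longlonglongrightarrow> 1" by simp
  show ?thesis
    by (rule tendsto_sandwich[OF lower _ lim tendsto_const]) simp
qed

end
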